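(* Let $\kappa$ be a finite field of characteristic $p\neq 2$ and fix $c,d\in\kappa^\times$. For a closed point $u_0 \in \mathbf{A}^1_\kappa$, let $\kappa_0 = \kappa(u_0)$ be its residue field, also write $u_0 \in \kappa_0$ for the image of $u$ under $\kappa[u]\to\kappa_0$, and define $$\pi_1 = c^{1/p}(T^2+u_0)^2 + d^{1/p}u_0^{1/p}, \qquad \pi_2 = 1 + 4\pi_1 \quad \in \kappa_0[T].$$ Then there exist infinitely many closed points $u_0 \in \mathbf{A}^1_\kappa$ such that both $\pi_1$ and $\pi_2$ are irreducible in $\kappa_0[T]$.
   Context: Here $x^{1/p}$ denotes the unique $p$th root in the (perfect) finite field. *)

theory Defs
  imports "HOL-Algebra.Algebra"
begin

text \<open>The unique p-th root of x in a (perfect, finite) field S.\<close>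
definition pth_root :: "('a, 'b) ring_scheme \<Rightarrow> nat \<Rightarrow> 'a \<Rightarrow> 'a" where
  "pth_root S p x = (THE y. y \<in> carrier S \<and> y [^]\<^bsub>S\<^esub> p = x)"

abbreviation res_field :: "('a, 'b) ring_scheme \<Rightarrow> 'a list \<Rightarrow> 'a list set ring" where
  "res_field R f \<equiv> Rupt\<^bsub>R\<^esub> (carrier R) f"

definition res_map :: "('a, 'b) ring_scheme \<Rightarrow> 'a list \<Rightarrow> 'a list \<Rightarrow> 'a list set" where
  "res_map R f q = (PIdl\<^bsub>poly_ring R\<^esub> f) +>\<^bsub>poly_ring R\<^esub> q"

definition res_u :: "('a, 'b) ring_scheme \<Rightarrow> 'a list \<Rightarrow> 'a list set" where
  "res_u R f = res_map R f (X\<^bsub>R\<^esub>)"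

definition res_const :: "('a, 'b) ring_scheme \<Rightarrow> 'a list \<Rightarrow> 'a \<Rightarrow> 'a list set" where
  "res_const R f c = res_map R f (ring.poly_of_const R c)"

definition pi1 :: "('a, 'b) ring_scheme \<Rightarrow> nat \<Rightarrow> 'a \<Rightarrow> 'a \<Rightarrow> 'a list \<Rightarrow> 'a list set list" where
  "pi1 R p c d f =
    (let K0 = res_field R f; P = poly_ring K0; T = X\<^bsub>K0\<^esub>;
         C = ring.poly_of_const K0; u0 = res_u R f;
         cr = pth_root K0 p (res_const R f c);
         dr = pth_root K0 p (res_const R f d);
         ur = pth_root K0 p u0
     in C cr \<otimes>\<^bsub>P\<^esub> ((T [^]\<^bsub>P\<^esub> (2::nat) \<oplus>\<^bsub>P\<^esub> C u0) [^]\<^bsub>P\<^esub> (2::nat))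
        \<oplus>\<^bsub>P\<^esub> C (dr \<otimes>\<^bsub>K0\<^esub> ur))"

definition pi2 :: "('a, 'b) ring_scheme \<Rightarrow> nat \<Rightarrow> 'a \<Rightarrow> 'a \<Rightarrow> 'a list \<Rightarrow> 'a list set list" where
  "pi2 R p c d f =
    (let P = poly_ring (res_field R f)
     in \<one>\<^bsub>P\<^esub> \<oplus>\<^bsub>P\<^esub> ([(4::nat)] \<cdot>\<^bsub>P\<^esub> pi1 R p c d f))"

text \<open>Closed points of the affine line over kappa = monic irreducible polynomials in kappa[u].\<close>
definition closed_point :: "('a, 'b) ring_scheme \<Rightarrow> 'a list \<Rightarrow> bool" where
  "closed_point R f \<longleftrightarrow> f \<in> carrier (poly_ring R) \<and> lead_coeff f = \<one>\<^bsub>R\<^esub>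
      \<and> pirreducible\<^bsub>R\<^esub> (carrier R) f"

end

theory Submission
  imports Defs "HOL-Computational_Algebra.Formal_Power_Series"
begin

text \<open>Comparing coefficients, a quartic \<open>c (T\<^sup>2 + u)\<^sup>2 + e\<close> over a field is irreducible as soon as
  neither \<open>- e / c\<close> nor \<open>u\<^sup>2 + e / c\<close> is a square. Raising to the \<open>p\<close>-th power, which preserves
  nonsquares, the two quartics are irreducible once four explicit polynomials \<open>D\<^sub>1, \<dots>, D\<^sub>4\<close> over the
  base field are nonsquares in the residue field of the point. Infinitely many such points are found
  as in Dirichlet's theorem. The Jacobi symbol of \<open>f\<close> modulo \<open>g\<close> is defined by Gauss' lemma, as a
  product of leading coefficients; reciprocity is a double product over monic \<open>h\<close> and \<open>k\<close> of the
  leading coefficients of \<open>f h - g k\<close>. It turns the condition at a point \<open>P\<close> into a character of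
  \<open>P\<close> modulo \<open>D\<^sub>i\<close>. The products of these characters are nontrivial because each product of the
  \<open>D\<^sub>i\<close> has a simple irreducible factor, so their L-functions are polynomials, which do not vanish at
  \<open>1/q\<close>; hence their logarithmic derivatives stay bounded near \<open>1/q\<close>, while that of the zeta function
  does not.\<close>

section \<open>Primes with prescribed characters in an additive arithmetical semigroup\<close>

text \<open>The p-th roots of c, d and u_0 live in a residue field that changes with the point, so
  they are not the values of fixed polynomials at u_0. Frobenius replaces them by reductions of
  fixed polynomials, to which symbols apply. The four nonresidue conditions must hold at once.
  Outside finitely many \<open>P\<close>, having all values -1 is detected by the product of the 1 -
  \<chi>_i(P); expanding it brings in the product of characters over every subset. Independence is
  delicate because the four polynomials are not pairwise coprime: X divides two of them, and another
  pair may share a root, so a comparison of degrees has to step in. The symbol at a point has the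
  point as its modulus, and an L-function needs multiplicativity in the modulus. A product over
  monic residues is visibly multiplicative only in the upper argument, for every modulus;
  reciprocity then yields multiplicativity in the modulus without factoring it. All characters are
  real, so nonvanishing at 1/q rests on 1 + \<chi>(P)^k >= 0 alone. There are exactly q^n monic
  polynomials of degree n, so zeta is 1/(1 - q u) without error terms.\<close>

locale arith_semigroup = comm_monoid G for G :: "('m, 'x) monoid_scheme" (structure) +
  fixes deg :: "'m \<Rightarrow> nat" and Pr :: "'m set" and q :: nat
  assumes cancel: "\<lbrakk>x \<in> carrier G; y \<in> carrier G; z \<in> carrier G; x \<otimes> y = x \<otimes> z\<rbrakk> \<Longrightarrow> y = z"
    and deg_mult: "\<lbrakk>x \<in> carrier G; y \<in> carrier G\<rbrakk> \<Longrightarrow> deg (x \<otimes> y) = deg x + deg y"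
    and card_deg: "card {x \<in> carrier G. deg x = n} = q ^ n"
    and q_ge_2: "2 \<le> q"
    and Pr_closed: "P \<in> Pr \<Longrightarrow> P \<in> carrier G"
    and Pr_deg: "P \<in> Pr \<Longrightarrow> 0 < deg P"
    and Pr_divides_mult: "\<lbrakk>P \<in> Pr; x \<in> carrier G; y \<in> carrier G; P divides x \<otimes> y\<rbrakk>
            \<Longrightarrow> P divides x \<or> P divides y"
    and Pr_divides_Pr: "\<lbrakk>P \<in> Pr; Q \<in> Pr; P divides Q\<rbrakk> \<Longrightarrow> P = Q"
    and Pr_divisor_ex: "\<lbrakk>x \<in> carrier G; x \<noteq> \<one>\<rbrakk> \<Longrightarrow> \<exists>P\<in>Pr. P divides x"
begin

section \<open>Degrees as weighted counts of prime power divisors\<close>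

definition Deg :: "nat \<Rightarrow> 'm set" where
  "Deg n = {x \<in> carrier G. deg x = n}"

lemma finite_Deg: "finite (Deg n)"
  using card_deg[of n] q_ge_2 unfolding Deg_def by (intro card_ge_0_finite) simp

lemma deg_one [simp]: "deg \<one> = 0"
  using deg_mult[of \<one> \<one>] by simp

lemma Deg_0: "Deg 0 = {\<one>}"
proof -
  have "card (Deg 0) = 1" using card_deg[of 0] unfolding Deg_def by simp
  moreover have "\<one> \<in> Deg 0" unfolding Deg_def by simp
  ultimately show ?thesis by (metis card_1_singletonE singletonD)
qed

lemma deg_pow: "x \<in> carrier G \<Longrightarrow> deg (x [^] (k::nat)) = k * deg x"
  by (induction k) (auto simp: deg_mult)

lemma divides_deg_le: "\<lbrakk>x \<in> carrier G; y \<in> carrier G; x divides y\<rbrakk> \<Longrightarrow> deg x \<le> deg y"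
  by (auto simp: factor_def deg_mult)

text \<open>Over a fixed \<open>P\<close>, k runs from 1 to the multiplicity of \<open>P\<close> in
  x. Weighting each pair by \<open>deg P\<close> therefore recovers \<open>deg x\<close> without
  valuations or unique factorization.\<close>

definition prime_powers_dividing :: "'m \<Rightarrow> ('m \<times> nat) set" where
  "prime_powers_dividing x = {(P, k). P \<in> Pr \<and> 1 \<le> k \<and> P [^] k divides x}"

text \<open>The factors \<open>Q\<close> are peeled off one at a time: primality moves each past
  \<open>P\<close>, since distinct primes do not divide each other, and cancellation lowers
  k.\<close>

lemma prime_power_divides_cancel:
  assumes "P \<in> Pr" "Q \<in> Pr" "P \<noteq> Q"
  shows "g \<in> carrier G \<Longrightarrow> Q [^] (k::nat) divides P \<otimes> g \<Longrightarrow> Q [^] k divides g"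
proof (induction k arbitrary: g)
  case 0 then show ?case by (auto simp: factor_def)
next
  case (Suc k)
  have PQ: "P \<in> carrier G" "Q \<in> carrier G" using assms Pr_closed by auto
  obtain y where y: "y \<in> carrier G" "P \<otimes> g = Q [^] Suc k \<otimes> y"
    using Suc.prems unfolding factor_def by blast
  have "P \<otimes> g = Q \<otimes> (Q [^] k \<otimes> y)"
    using y PQ by (simp add: m_ac)
  then have "Q divides P \<otimes> g" unfolding factor_def using y PQ by blast
  then have "Q divides g"
    using Pr_divides_mult[OF assms(2) PQ(1) Suc.prems(1)] Pr_divides_Pr[OF assms(2,1)] assms(3) by blast
  then obtain g' where g': "g' \<in> carrier G" "g = Q \<otimes> g'" unfolding factor_def by blast
  have "Q \<otimes> (P \<otimes> g') = Q \<otimes> (Q [^] k \<otimes> y)"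
    using \<open>P \<otimes> g = Q \<otimes> (Q [^] k \<otimes> y)\<close> g' PQ by (simp add: m_ac)
  then have "P \<otimes> g' = Q [^] k \<otimes> y"
    using cancel[of Q "P \<otimes> g'" "Q [^] k \<otimes> y"] PQ g' y by simp
  then have "Q [^] k divides P \<otimes> g'" unfolding factor_def using y by blast
  then have "Q [^] k divides g'" using Suc.IH g' by blast
  then obtain z where "z \<in> carrier G" "g' = Q [^] k \<otimes> z" unfolding factor_def by blast
  then have "g = Q [^] Suc k \<otimes> z" using g' PQ by (simp add: m_ac)
  then show ?case unfolding factor_def using \<open>z \<in> carrier G\<close> by blast
qed

text \<open>Multiplication by \<open>P\<close> raises the multiplicity of \<open>P\<close> alone:
  its old entries shift from k to k + 1, which frees the slot (P, 1).\<close>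

lemma prime_powers_dividing_mult:
  assumes "P \<in> Pr" "g \<in> carrier G"
  shows "prime_powers_dividing (P \<otimes> g) =
    insert (P, 1) ((\<lambda>(Q, k). if Q = P then (Q, Suc k) else (Q, k)) ` prime_powers_dividing g)"
    (is "_ = insert _ (?\<phi> ` _)")
proof -
  have P: "P \<in> carrier G" using assms Pr_closed by auto
  have same: "P [^] Suc k divides P \<otimes> g \<longleftrightarrow> P [^] k divides g" for k
  proof
    assume "P [^] Suc k divides P \<otimes> g"
    then obtain y where y: "y \<in> carrier G" "P \<otimes> g = P [^] Suc k \<otimes> y" unfolding factor_def by blast
    then have "P \<otimes> g = P \<otimes> (P [^] k \<otimes> y)" using P by (simp add: m_ac)
    then show "P [^] k divides g" using cancel[of P g "P [^] k \<otimes> y"] P y assms by (auto simp: factor_def)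
  next
    assume "P [^] k divides g"
    then obtain y where y: "y \<in> carrier G" "g = P [^] k \<otimes> y" unfolding factor_def by blast
    then have "P \<otimes> g = P [^] Suc k \<otimes> y" using P by (simp add: m_ac)
    then show "P [^] Suc k divides P \<otimes> g" using y by (auto simp: factor_def)
  qed
  have diff: "Q [^] k divides P \<otimes> g \<longleftrightarrow> Q [^] k divides g" if "Q \<in> Pr" "Q \<noteq> P" for Q and k :: nat
  proof
    assume "Q [^] k divides P \<otimes> g" then show "Q [^] k divides g"
      using prime_power_divides_cancel[of P Q g k] that assms by auto
  next
    assume "Q [^] k divides g"
    then show "Q [^] k divides P \<otimes> g"
      using divides_prod_l[of "Q [^] k" g P] P assms Pr_closed[OF that(1)] by auto
  qed
  have "(Q, k) \<in> prime_powers_dividing (P \<otimes> g) \<longleftrightarrow> (Q, k) \<in> insert (P, 1) (?\<phi> ` prime_powers_dividing g)" for Q k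
  proof (cases "Q = P")
    case True
    show ?thesis
    proof (cases k)
      case 0 then show ?thesis using True
        by (auto simp: prime_powers_dividing_def split: if_splits)
    next
      case (Suc k')
      have "(Q, k) \<in> prime_powers_dividing (P \<otimes> g) \<longleftrightarrow> P [^] k' divides g"
        using True Suc same assms unfolding prime_powers_dividing_def by simp
      also have "\<dots> \<longleftrightarrow> k' = 0 \<or> (P, k') \<in> prime_powers_dividing g"
        using assms unfolding prime_powers_dividing_def by (cases k') (auto simp: factor_def)
      also have "\<dots> \<longleftrightarrow> (Q, k) \<in> insert (P, 1) (?\<phi> ` prime_powers_dividing g)"
        using True Suc by (force simp: image_iff split: if_splits)
      finally show ?thesis .
    qed
  next
    case False
    then have "(Q, k) \<in> prime_powers_dividing (P \<otimes> g) \<longleftrightarrow> (Q, k) \<in> prime_powers_dividing g"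
      using diff unfolding prime_powers_dividing_def by auto
    also have "\<dots> \<longleftrightarrow> (Q, k) \<in> insert (P, 1) (?\<phi> ` prime_powers_dividing g)"
      using False by (force simp: image_iff split: if_splits)
    finally show ?thesis .
  qed
  then show ?thesis unfolding set_eq_iff split_paired_All by blast
qed

lemma deg_eq_sum_prime_powers:
  assumes "x \<in> carrier G"
  shows "finite (prime_powers_dividing x) \<and> (\<Sum>(P, k)\<in>prime_powers_dividing x. deg P) = deg x"
  using assms
proof (induction "deg x" arbitrary: x rule: less_induct)
  case less
  show ?case
  proof (cases "x = \<one>")
    case True
    have "\<not> P [^] k divides \<one>" if "P \<in> Pr" "1 \<le> k" for P and k :: nat
      using divides_deg_le[of "P [^] k" \<one>] deg_pow[of P k] Pr_closed[OF that(1)] Pr_deg[OF that(1)] that(2)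
      by (metis deg_one mult_eq_0_iff nat_pow_closed not_gr_zero one_closed not_one_le_zero le_zero_eq)
    then have "prime_powers_dividing x = {}" using True unfolding prime_powers_dividing_def by auto
    then show ?thesis using True by simp
  next
    case False
    then obtain P where P: "P \<in> Pr" "P divides x" using Pr_divisor_ex less.prems by blast
    then obtain g where g: "g \<in> carrier G" "x = P \<otimes> g" unfolding factor_def by blast
    have dx: "deg x = deg P + deg g" using g P Pr_closed deg_mult by simp
    let ?f = "(\<lambda>(Q, k). if Q = P then (Q, Suc k) else (Q, k)) :: 'm \<times> nat \<Rightarrow> 'm \<times> nat"
    let ?W = "prime_powers_dividing g"
    have IH: "finite ?W" "(\<Sum>(P, k)\<in>?W. deg P) = deg g"
      using less.hyps[of g] dx Pr_deg[OF P(1)] g by auto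
    have W: "prime_powers_dividing x = insert (P, 1) (?f ` ?W)"
      using prime_powers_dividing_mult[OF P(1) g(1)] g(2) by simp
    have notin: "(P, 1) \<notin> ?f ` ?W"
      by (auto simp: prime_powers_dividing_def split: if_splits)
    have inj: "inj_on ?f ?W" by (auto simp: inj_on_def split: if_splits)
    have "(\<Sum>(P, k)\<in>?f ` ?W. deg P) = (\<Sum>(P, k)\<in>?W. deg P)"
      unfolding sum.reindex[OF inj] by (rule sum.cong) auto
    then show ?thesis using W notin IH dx by simp
  qed
qed

section \<open>Completely multiplicative functions and their von Mangoldt coefficients\<close>

definition completely_mult :: "('m \<Rightarrow> real) \<Rightarrow> bool" where
  "completely_mult \<chi> \<longleftrightarrow> \<chi> \<one> = 1 \<and> (\<forall>x\<in>carrier G. \<forall>y\<in>carrier G. \<chi> (x \<otimes> y) = \<chi> x * \<chi> y)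
     \<and> (\<forall>x\<in>carrier G. \<chi> x \<in> {-1, 0, 1})"

lemma completely_mult_one: "completely_mult (\<lambda>_. 1)"
  unfolding completely_mult_def by simp

lemma completely_mult_pow:
  "\<lbrakk>completely_mult \<chi>; x \<in> carrier G\<rbrakk> \<Longrightarrow> \<chi> (x [^] (k::nat)) = \<chi> x ^ k"
  by (induction k) (auto simp: completely_mult_def)

definition coeff_sum :: "('m \<Rightarrow> real) \<Rightarrow> nat \<Rightarrow> real" where
  "coeff_sum \<chi> n = (\<Sum>x\<in>Deg n. \<chi> x)"

definition prime_powers :: "nat \<Rightarrow> ('m \<times> nat) set" where
  "prime_powers n = {(P, k). P \<in> Pr \<and> 1 \<le> k \<and> k * deg P = n}"

text \<open>The coefficients of u L'/L: the von Mangoldt function twisted by \<chi>.\<close>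

definition mangoldt :: "('m \<Rightarrow> real) \<Rightarrow> nat \<Rightarrow> real" where
  "mangoldt \<chi> n = (\<Sum>(P, k)\<in>prime_powers n. real (deg P) * \<chi> P ^ k)"

lemma finite_prime_powers: "finite (prime_powers n)"
proof -
  have "prime_powers n \<subseteq> (\<Union>m\<le>n. Deg m) \<times> {..n}"
  proof
    fix y assume "y \<in> prime_powers n"
    then obtain P k where y: "y = (P, k)" "P \<in> Pr" "1 \<le> k" "k * deg P = n"
      unfolding prime_powers_def by auto
    then have "deg P \<le> n" "k \<le> n" using Pr_deg[of P] by auto
    then show "y \<in> (\<Union>m\<le>n. Deg m) \<times> {..n}" using y Pr_closed unfolding Deg_def by auto
  qed
  then show ?thesis using finite_Deg by (meson finite_SigmaI finite_UN finite_atMost finite_subset)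
qed

lemma mangoldt_0 [simp]: "mangoldt \<chi> 0 = 0"
proof -
  have "prime_powers 0 = {}" using Pr_deg unfolding prime_powers_def by fastforce
  then show ?thesis unfolding mangoldt_def by simp
qed

lemma coeff_sum_0: "completely_mult \<chi> \<Longrightarrow> coeff_sum \<chi> 0 = 1"
  unfolding coeff_sum_def Deg_0 completely_mult_def by simp

lemma sum_multiples_of_prime_power:
  assumes \<chi>: "completely_mult \<chi>" and P: "P \<in> Pr" and kn: "k * deg P \<le> n"
  shows "(\<Sum>x\<in>{x\<in>Deg n. P [^] k divides x}. \<chi> x) = \<chi> P ^ k * coeff_sum \<chi> (n - k * deg P)"
proof -
  have Pc: "P \<in> carrier G" using Pr_closed P by auto
  let ?Q = "P [^] k"
  have im: "{x\<in>Deg n. ?Q divides x} = (\<lambda>g. ?Q \<otimes> g) ` Deg (n - k * deg P)"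
  proof (intro equalityI subsetI)
    fix x assume "x \<in> {x\<in>Deg n. ?Q divides x}"
    then obtain g where g: "x \<in> Deg n" "g \<in> carrier G" "x = ?Q \<otimes> g" unfolding factor_def by blast
    then have "n = k * deg P + deg g"
      using deg_mult[of ?Q g] deg_pow[OF Pc] Pc unfolding Deg_def by simp
    then show "x \<in> (\<lambda>g. ?Q \<otimes> g) ` Deg (n - k * deg P)" using g unfolding Deg_def by auto
  next
    fix x assume "x \<in> (\<lambda>g. ?Q \<otimes> g) ` Deg (n - k * deg P)"
    then obtain g where g: "g \<in> carrier G" "deg g = n - k * deg P" "x = ?Q \<otimes> g" unfolding Deg_def by auto
    then show "x \<in> {x\<in>Deg n. ?Q divides x}"
      using deg_mult[of ?Q g] deg_pow[OF Pc] Pc kn unfolding Deg_def factor_def by auto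
  qed
  have inj: "inj_on (\<lambda>g. ?Q \<otimes> g) (Deg (n - k * deg P))"
    unfolding inj_on_def Deg_def using cancel[of ?Q] Pc by auto
  have "(\<Sum>x\<in>{x\<in>Deg n. ?Q divides x}. \<chi> x) = (\<Sum>g\<in>Deg (n - k * deg P). \<chi> (?Q \<otimes> g))"
    unfolding im using sum.reindex[OF inj, of \<chi>] by simp
  also have "\<dots> = (\<Sum>g\<in>Deg (n - k * deg P). \<chi> P ^ k * \<chi> g)"
    using \<chi> completely_mult_pow[OF \<chi> Pc] Pc
    by (intro sum.cong) (auto simp: completely_mult_def Deg_def)
  finally show ?thesis unfolding coeff_sum_def sum_distrib_left .
qed

text \<open>The logarithmic derivative of the Euler product, coefficientwise.\<close>

lemma coeff_sum_recurrence:
  assumes \<chi>: "completely_mult \<chi>"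
  shows "real n * coeff_sum \<chi> n = (\<Sum>m\<le>n. mangoldt \<chi> m * coeff_sum \<chi> (n - m))"
proof -
  define W where "W = (\<Union>m\<le>n. prime_powers m)"
  have finW: "finite W" unfolding W_def using finite_prime_powers by simp
  have W_iff: "(P, k) \<in> W \<longleftrightarrow> P \<in> Pr \<and> 1 \<le> k \<and> k * deg P \<le> n" for P k
    unfolding W_def prime_powers_def by auto
  have sub: "prime_powers_dividing x = {y\<in>W. (fst y) [^] (snd y) divides x}" if "x \<in> Deg n" for x
  proof -
    have "k * deg P \<le> n" if "P \<in> Pr" "P [^] k divides x" for P and k :: nat
      using divides_deg_le[of "P [^] k" x] deg_pow[of P k] Pr_closed[OF that(1)] that \<open>x \<in> Deg n\<close>
      unfolding Deg_def by auto
    then show ?thesis using W_iff unfolding prime_powers_dividing_def by auto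
  qed
  have "real n * coeff_sum \<chi> n = (\<Sum>x\<in>Deg n. \<chi> x * real (deg x))"
    unfolding coeff_sum_def sum_distrib_left by (intro sum.cong) (auto simp: Deg_def)
  also have "\<dots> = (\<Sum>x\<in>Deg n. \<Sum>y\<in>W. if (fst y) [^] (snd y) divides x then \<chi> x * real (deg (fst y)) else 0)"
  proof (rule sum.cong[OF refl])
    fix x assume x: "x \<in> Deg n"
    have "deg x = (\<Sum>y\<in>prime_powers_dividing x. deg (fst y))"
      using deg_eq_sum_prime_powers[of x] x unfolding Deg_def by (simp add: case_prod_unfold)
    then have "\<chi> x * real (deg x) = (\<Sum>y\<in>prime_powers_dividing x. \<chi> x * real (deg (fst y)))"
      by (simp add: sum_distrib_left)
    then show "\<chi> x * real (deg x) =
        (\<Sum>y\<in>W. if (fst y) [^] (snd y) divides x then \<chi> x * real (deg (fst y)) else 0)"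
      unfolding sub[OF x] using finW by (simp add: sum.inter_filter)
  qed
  \<comment> \<open>Exchanging the sums groups the incidences of x and prime powers by the prime
    power instead of by x.\<close>
  also have "\<dots> = (\<Sum>y\<in>W. real (deg (fst y)) * (\<Sum>x\<in>{x\<in>Deg n. (fst y) [^] (snd y) divides x}. \<chi> x))"
    unfolding sum_distrib_left
    by (subst sum.swap) (simp add: sum.inter_filter[symmetric] finite_Deg mult.commute)
  also have "\<dots> = (\<Sum>y\<in>W. real (deg (fst y)) * (\<chi> (fst y) ^ snd y * coeff_sum \<chi> (n - snd y * deg (fst y))))"
    using sum_multiples_of_prime_power[OF \<chi>] W_iff by (intro sum.cong) auto
  also have "\<dots> = (\<Sum>m\<le>n. \<Sum>y\<in>prime_powers m. real (deg (fst y)) * (\<chi> (fst y) ^ snd y * coeff_sum \<chi> (n - snd y * deg (fst y))))"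
    unfolding W_def
    by (rule sum.UNION_disjoint) (simp_all add: finite_prime_powers, auto simp: prime_powers_def)
  also have "\<dots> = (\<Sum>m\<le>n. mangoldt \<chi> m * coeff_sum \<chi> (n - m))"
    unfolding mangoldt_def sum_distrib_right
    by (intro sum.cong) (auto simp: prime_powers_def)
  finally show ?thesis .
qed

lemma coeff_sum_one: "coeff_sum (\<lambda>_. 1) n = real q ^ n"
  unfolding coeff_sum_def Deg_def using card_deg by simp

text \<open>An exact prime number theorem: subtracting q times the recurrence at n from the
  recurrence at n + 1 leaves only the top term.\<close>

lemma mangoldt_one: "mangoldt (\<lambda>_. 1) (Suc n) = real q ^ Suc n"
proof -
  let ?L = "mangoldt (\<lambda>_. 1)"
  have rec: "real n * real q ^ n = (\<Sum>m\<le>n. ?L m * real q ^ (n - m))" for n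
    using coeff_sum_recurrence[OF completely_mult_one, of n] unfolding coeff_sum_one .
  have "(\<Sum>m\<le>n. ?L m * real q ^ (Suc n - m)) = real q * (\<Sum>m\<le>n. ?L m * real q ^ (n - m))"
    unfolding sum_distrib_left by (intro sum.cong) (auto simp: Suc_diff_le)
  then have "(\<Sum>m\<le>Suc n. ?L m * real q ^ (Suc n - m)) = ?L (Suc n) + real q * (real n * real q ^ n)"
    using rec[of n] by simp
  then show ?thesis using rec[of "Suc n"] by (simp add: algebra_simps)
qed

lemma abs_mangoldt_le:
  assumes "completely_mult \<chi>"
  shows "\<bar>mangoldt \<chi> n\<bar> \<le> real q ^ n"
proof -
  have "\<bar>\<chi> P ^ k\<bar> \<le> 1" if "P \<in> Pr" for P k
  proof -
    have "\<bar>\<chi> P\<bar> \<le> 1" using assms Pr_closed[OF that] unfolding completely_mult_def by force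
    then show ?thesis by (simp add: power_abs power_le_one)
  qed
  then have "\<bar>mangoldt \<chi> n\<bar> \<le> mangoldt (\<lambda>_. 1) n"
    unfolding mangoldt_def
    by (intro order.trans[OF sum_abs] sum_mono)
       (auto simp: prime_powers_def abs_mult mult_left_le)
  also have "\<dots> \<le> real q ^ n" by (cases n) (simp_all add: mangoldt_one)
  finally show ?thesis .
qed

text \<open>A prime power contributes \<open>deg P\<close> times 1 + \<chi>(P)^k, which is
  nonnegative for a real character. At k = 2 it is positive as soon as \<chi>(P) is nonzero, whence
  the index 2 \<open>deg P\<close> in the strict part.\<close>

lemma mangoldt_one_add_nonneg:
  assumes "completely_mult \<chi>"
  shows "0 \<le> mangoldt \<chi> n + mangoldt (\<lambda>_. 1) n"
    and "\<lbrakk>P \<in> Pr; \<chi> P \<noteq> 0; n = 2 * deg P\<rbrakk> \<Longrightarrow> 0 < mangoldt \<chi> n + mangoldt (\<lambda>_. 1) n"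
proof -
  have eq: "mangoldt \<chi> n + mangoldt (\<lambda>_. 1) n =
      (\<Sum>y\<in>prime_powers n. real (deg (fst y)) * (\<chi> (fst y) ^ snd y + 1))"
    unfolding mangoldt_def by (simp add: sum.distrib[symmetric] case_prod_unfold algebra_simps)
  have ge: "0 \<le> real (deg (fst y)) * (\<chi> (fst y) ^ snd y + 1)" if "y \<in> prime_powers n" for y
  proof -
    have "\<chi> (fst y) \<in> {-1, 0, 1}" using that assms Pr_closed unfolding prime_powers_def completely_mult_def by auto
    then have "\<bar>\<chi> (fst y) ^ snd y\<bar> \<le> 1" unfolding power_abs by (intro power_le_one) auto
    then show ?thesis by (intro mult_nonneg_nonneg) auto
  qed
  show "0 \<le> mangoldt \<chi> n + mangoldt (\<lambda>_. 1) n" unfolding eq using ge by (rule sum_nonneg)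
  assume P: "P \<in> Pr" "\<chi> P \<noteq> 0" "n = 2 * deg P"
  have "\<chi> P \<in> {-1, 1}" using P assms Pr_closed unfolding completely_mult_def by auto
  then have "\<chi> P ^ 2 = 1" by auto
  then have "0 < real (deg (fst (P, 2::nat))) * (\<chi> (fst (P, 2::nat)) ^ snd (P, 2::nat) + 1)"
    using Pr_deg[OF P(1)] by simp
  moreover have "(P, 2) \<in> prime_powers n" using P unfolding prime_powers_def by auto
  ultimately show "0 < mangoldt \<chi> n + mangoldt (\<lambda>_. 1) n"
    unfolding eq using ge finite_prime_powers by (meson sum_pos2)
qed

text \<open>The degenerate case of \<open>L_nonzero\<close>: the L-function is the constant 1, and
  the positivity argument has no prime to start from.\<close>

lemma completely_mult_trivial:
  assumes \<chi>: "completely_mult \<chi>" and "\<And>P. P \<in> Pr \<Longrightarrow> \<chi> P = 0" and "0 < n"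
  shows "coeff_sum \<chi> n = 0"
proof -
  have "\<chi> x = 0" if "x \<in> Deg n" for x
  proof -
    have x: "x \<in> carrier G" "x \<noteq> \<one>" using that assms(3) by (auto simp: Deg_def)
    obtain P g where "P \<in> Pr" "g \<in> carrier G" "x = P \<otimes> g"
      using Pr_divisor_ex[OF x] unfolding factor_def by blast
    then show ?thesis using assms(2) \<chi> Pr_closed unfolding completely_mult_def by simp
  qed
  then show ?thesis unfolding coeff_sum_def by simp
qed

text \<open>If the polynomial L-function of \<open>\<chi>\<close> vanished at \<open>1/q\<close>, its product with the zeta function
  would be a polynomial; but the logarithmic derivative of that product has nonnegative
  coefficients, which makes infinitely many of its coefficients positive.\<close>

lemma L_nonzero:
  assumes \<chi>: "completely_mult \<chi>" and van: "\<And>n. N \<le> n \<Longrightarrow> coeff_sum \<chi> n = 0"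
  shows "(\<Sum>n<N. coeff_sum \<chi> n / real q ^ n) \<noteq> 0"
proof
  assume zero: "(\<Sum>n<N. coeff_sum \<chi> n / real q ^ n) = 0"
  have N: "0 < N" using van[of 0] coeff_sum_0[OF \<chi>] by (cases N) auto
  have q0: "real q \<noteq> 0" using q_ge_2 by simp
  define a where "a = Abs_fps (coeff_sum \<chi>)"
  define z where "z = Abs_fps (\<lambda>n. real q ^ n)"
  define l where "l = Abs_fps (mangoldt \<chi>)"
  define l1 where "l1 = Abs_fps (mangoldt (\<lambda>_. 1))"
  have log: "fps_X * fps_deriv (Abs_fps (coeff_sum \<psi>)) = Abs_fps (mangoldt \<psi>) * Abs_fps (coeff_sum \<psi>)"
    if "completely_mult \<psi>" for \<psi>
  proof (rule fps_ext)
    fix n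
    have "fps_nth (fps_X * fps_deriv (Abs_fps (coeff_sum \<psi>))) n = real n * coeff_sum \<psi> n"
      by (cases n) auto
    then show "fps_nth (fps_X * fps_deriv (Abs_fps (coeff_sum \<psi>))) n =
        fps_nth (Abs_fps (mangoldt \<psi>) * Abs_fps (coeff_sum \<psi>)) n"
      using coeff_sum_recurrence[OF that, of n] by (simp add: fps_mult_nth atMost_atLeast0)
  qed
  have za: "z = Abs_fps (coeff_sum (\<lambda>_. 1))" unfolding z_def coeff_sum_one ..
  have "fps_X * fps_deriv (z * a) = z * (fps_X * fps_deriv a) + (fps_X * fps_deriv z) * a"
    by (simp add: algebra_simps)
  also have "\<dots> = (l + l1) * (z * a)"
    using log[OF \<chi>] log[OF completely_mult_one] unfolding za l_def l1_def a_def by (simp add: algebra_simps)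
  finally have logb: "fps_X * fps_deriv (z * a) = (l + l1) * (z * a)" .
  \<comment> \<open>The coefficients of zeta times L. As zeta has coefficients q^n, from index N on
    \<open>b n\<close> is q^n times L(1/q), so the assumed zero makes \<open>b\<close> a finite
    sequence.\<close>
  define b where "b n = fps_nth (z * a) n" for n
  have rec: "real n * b n = (\<Sum>i=0..n. (mangoldt \<chi> i + mangoldt (\<lambda>_. 1) i) * b (n - i))" for n
  proof -
    have X_deriv: "fps_nth (fps_X * fps_deriv F) n = real n * fps_nth F n" for F :: "real fps"
      by (cases n) auto
    have "real n * b n = fps_nth (fps_X * fps_deriv (z * a)) n"
      unfolding b_def X_deriv ..
    moreover have "fps_nth (l + l1) i = mangoldt \<chi> i + mangoldt (\<lambda>_. 1) i" for i
      unfolding l_def l1_def by simp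
    ultimately show ?thesis unfolding logb fps_mult_nth[of "l + l1"] b_def by simp
  qed
  have b_large: "b n = 0" if "N \<le> n" for n
  proof -
    have "b n = (\<Sum>i=0..n. coeff_sum \<chi> i * real q ^ (n - i))"
      using fps_mult_nth[of a z n] unfolding b_def a_def z_def
      by (simp add: mult.commute[of "Abs_fps (\<lambda>n. real q ^ n)"])
    also have "\<dots> = (\<Sum>i<N. coeff_sum \<chi> i * real q ^ (n - i))"
      using that van by (intro sum.mono_neutral_right) auto
    also have "\<dots> = real q ^ n * (\<Sum>i<N. coeff_sum \<chi> i / real q ^ i)"
      unfolding sum_distrib_left using that q0 by (intro sum.cong) (auto simp: power_diff)
    finally show ?thesis using zero by simp
  qed
  have b0: "b 0 = 1" unfolding b_def a_def z_def using coeff_sum_0[OF \<chi>] by simp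
  have b_nonneg: "0 \<le> b n" for n
  proof (induction n rule: less_induct)
    case (less n)
    show ?case
    proof (cases "n = 0")
      case False
      have "0 \<le> (\<Sum>i=0..n. (mangoldt \<chi> i + mangoldt (\<lambda>_. 1) i) * b (n - i))"
      proof (rule sum_nonneg)
        fix i assume "i \<in> {0..n}"
        then show "0 \<le> (mangoldt \<chi> i + mangoldt (\<lambda>_. 1) i) * b (n - i)"
          using mangoldt_one_add_nonneg(1)[OF \<chi>, of i] less[of "n - i"] False by (cases "i = 0") auto
      qed
      then have "0 \<le> real n * b n" using rec[of n] by simp
      then show ?thesis using False by (simp add: zero_le_mult_iff)
    qed (simp add: b0)
  qed
  show False
  proof (cases "\<exists>P\<in>Pr. \<chi> P \<noteq> 0")
    case True
    then obtain P where P: "P \<in> Pr" "\<chi> P \<noteq> 0" by blast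
    \<comment> \<open>Twice the degree, because only the even power \<chi>(P)^2 = 1 is sure to
      contribute positively.\<close>
    define m where "m = 2 * deg P"
    have m: "0 < m" unfolding m_def using Pr_deg[OF P(1)] by simp
    \<comment> \<open>In the recurrence the single positive summand at index m carries positivity
      from k m to (k + 1) m; the others are nonnegative.\<close>
    have "0 < b (k * m)" for k
    proof (induction k)
      case 0 then show ?case using b0 by simp
    next
      case (Suc k)
      have "0 < (mangoldt \<chi> m + mangoldt (\<lambda>_. 1) m) * b (Suc k * m - m)"
        using mangoldt_one_add_nonneg(2)[OF \<chi> P m_def] Suc by simp
      then have "0 < (\<Sum>i=0..Suc k * m. (mangoldt \<chi> i + mangoldt (\<lambda>_. 1) i) * b (Suc k * m - i))"
        using mangoldt_one_add_nonneg(1)[OF \<chi>] b_nonneg by (intro sum_pos2[of _ m]) auto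
      then have "0 < real (Suc k * m) * b (Suc k * m)" using rec[of "Suc k * m"] by simp
      then show ?case using b_nonneg[of "Suc k * m"] by (simp only: zero_less_mult_iff) linarith
    qed
    from this[of N] b_large[of "N * m"] m show False by simp
  next
    case False
    then have "(\<Sum>n<N. coeff_sum \<chi> n / real q ^ n) = (\<Sum>n\<in>{0}. coeff_sum \<chi> n / real q ^ n)"
      using completely_mult_trivial[OF \<chi>] N by (intro sum.mono_neutral_right) auto
    then show False using zero coeff_sum_0[OF \<chi>] by simp
  qed
qed

section \<open>Behaviour of the logarithmic derivatives near 1/q\<close>

lemma summable_mangoldt:
  assumes "completely_mult \<chi>" "0 \<le> u" "u < 1 / real q"
  shows "summable (\<lambda>n. norm (mangoldt \<chi> n * u ^ n))"
proof (rule summable_comparison_test')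
  have "real q * u < 1" using assms(3) q_ge_2 by (simp add: field_simps)
  then show "summable (\<lambda>n. (real q * u) ^ n)" using assms(2) by (intro summable_geometric) simp
  fix n :: nat
  show "norm (norm (mangoldt \<chi> n * u ^ n)) \<le> (real q * u) ^ n"
    using abs_mangoldt_le[OF assms(1), of n] assms(2)
    by (simp add: abs_mult power_mult_distrib mult_right_mono)
qed

lemma mangoldt_series_bounded:
  assumes \<chi>: "completely_mult \<chi>" and van: "\<And>n. N \<le> n \<Longrightarrow> coeff_sum \<chi> n = 0"
  shows "\<exists>B. eventually (\<lambda>u. \<bar>suminf (\<lambda>n. mangoldt \<chi> n * u ^ n)\<bar> \<le> B) (at_left (1 / real q))"
proof -
  define L where "L u = (\<Sum>n<N. coeff_sum \<chi> n * u ^ n)" for u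
  \<comment> \<open>This is u times the derivative of \<open>L\<close>; the recurrence says that the
    series times \<open>L\<close> equals \<open>D\<close>.\<close>
  define D where "D u = (\<Sum>n<N. real n * coeff_sum \<chi> n * u ^ n)" for u
  have L0: "L (1 / real q) \<noteq> 0"
    using L_nonzero[OF \<chi>, of N] van unfolding L_def by (simp add: power_one_over divide_inverse power_inverse)
  have eq: "suminf (\<lambda>n. mangoldt \<chi> n * u ^ n) * L u = D u" if u: "0 \<le> u" "u < 1 / real q" for u
  proof -
    have fin: "(\<lambda>n. c n * u ^ n) sums (\<Sum>n<N. c n * u ^ n)" if "\<And>n. N \<le> n \<Longrightarrow> c n = 0" for c :: "nat \<Rightarrow> real"
      using that by (intro sums_finite) auto
    have sL: "(\<lambda>n. coeff_sum \<chi> n * u ^ n) sums L u"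
      unfolding L_def using fin[of "coeff_sum \<chi>"] van by simp
    have sD: "(\<lambda>n. real n * coeff_sum \<chi> n * u ^ n) sums D u"
      unfolding D_def using fin[of "\<lambda>n. real n * coeff_sum \<chi> n"] van by simp
    have absL: "summable (\<lambda>n. norm (coeff_sum \<chi> n * u ^ n))"
      by (rule summable_finite[of "{..<N}"]) (use van in auto)
    have "(\<lambda>k. \<Sum>i\<le>k. (mangoldt \<chi> i * u ^ i) * (coeff_sum \<chi> (k - i) * u ^ (k - i))) sums
        (suminf (\<lambda>n. mangoldt \<chi> n * u ^ n) * suminf (\<lambda>n. coeff_sum \<chi> n * u ^ n))"
      by (rule Cauchy_product_sums[OF summable_mangoldt[OF \<chi> u] absL])
    moreover have "(\<Sum>i\<le>k. (mangoldt \<chi> i * u ^ i) * (coeff_sum \<chi> (k - i) * u ^ (k - i))) =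
        real k * coeff_sum \<chi> k * u ^ k" for k
    proof -
      have "u ^ i * u ^ (k - i) = u ^ k" if "i \<le> k" for i
        using that by (simp add: power_add[symmetric])
      then have "(\<Sum>i\<le>k. (mangoldt \<chi> i * u ^ i) * (coeff_sum \<chi> (k - i) * u ^ (k - i))) =
          (\<Sum>i\<le>k. mangoldt \<chi> i * coeff_sum \<chi> (k - i) * u ^ k)"
        by (intro sum.cong) (auto simp: mult_ac)
      then show ?thesis unfolding coeff_sum_recurrence[OF \<chi>, of k] sum_distrib_right .
    qed
    ultimately have "(\<lambda>k. real k * coeff_sum \<chi> k * u ^ k) sums (suminf (\<lambda>n. mangoldt \<chi> n * u ^ n) * L u)"
      using sL by (simp add: sums_iff)
    then show ?thesis using sD sums_unique2 by blast
  qed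
  have "((\<lambda>u. D u / L u) \<longlongrightarrow> D (1 / real q) / L (1 / real q)) (at_left (1 / real q))"
    unfolding D_def L_def
    by (intro tendsto_intros) (use L0 in \<open>auto simp: L_def\<close>)
  then have "((\<lambda>u. \<bar>D u / L u\<bar>) \<longlongrightarrow> \<bar>D (1 / real q) / L (1 / real q)\<bar>) (at_left (1 / real q))"
    by (rule tendsto_rabs)
  then have ev1: "eventually (\<lambda>u. \<bar>D u / L u\<bar> < \<bar>D (1 / real q) / L (1 / real q)\<bar> + 1) (at_left (1 / real q))"
    by (rule order_tendstoD) simp
  have "(L \<longlongrightarrow> L (1 / real q)) (at_left (1 / real q))"
    unfolding L_def by (intro tendsto_intros)
  then have ev2: "eventually (\<lambda>u. L u \<noteq> 0) (at_left (1 / real q))"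
    using L0 by (rule tendsto_imp_eventually_ne)
  have ev3: "eventually (\<lambda>u. u \<in> {0<..<1 / real q}) (at_left (1 / real q))"
    by (rule eventually_at_leftI[of 0]) (use q_ge_2 in auto)
  show ?thesis
  proof (intro exI)
    show "eventually (\<lambda>u. \<bar>suminf (\<lambda>n. mangoldt \<chi> n * u ^ n)\<bar> \<le> \<bar>D (1 / real q) / L (1 / real q)\<bar> + 1) (at_left (1 / real q))"
      using ev1 ev2 ev3
    proof eventually_elim
      case (elim u)
      then have "suminf (\<lambda>n. mangoldt \<chi> n * u ^ n) = D u / L u"
        using eq[of u] by (simp add: field_simps)
      then show ?case using elim by simp
    qed
  qed
qed

text \<open>The alternating sum of the logarithmic derivatives over all subsets S counts prime
  powers with weight the product of the 1 - \<chi>_i(P)^k. If only finitely many \<open>P\<close>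
  had all values -1, its coefficients would be bounded above and the sum would stay bounded above
  near 1/q. But the empty subset contributes zeta, which blows up there, while all other terms stay
  bounded.\<close>

theorem infinitely_many_primes_prescribed:
  fixes \<chi> :: "'i \<Rightarrow> 'm \<Rightarrow> real"
  assumes fin: "finite J" and \<chi>: "\<And>i. i \<in> J \<Longrightarrow> completely_mult (\<chi> i)"
    and van: "\<And>S. \<lbrakk>S \<subseteq> J; S \<noteq> {}\<rbrakk> \<Longrightarrow> \<exists>N. \<forall>n\<ge>N. coeff_sum (\<lambda>x. \<Prod>i\<in>S. \<chi> i x) n = 0"
    and ram: "\<And>i. i \<in> J \<Longrightarrow> finite {P \<in> Pr. \<chi> i P = 0}"
  shows "infinite {P \<in> Pr. \<forall>i\<in>J. \<chi> i P = -1}"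
proof
  assume good: "finite {P \<in> Pr. \<forall>i\<in>J. \<chi> i P = -1}"
  \<comment> \<open>Outside \<open>F\<close> all values are 1 or -1, and at least one of them is
    1.\<close>
  define F where "F = {P \<in> Pr. \<forall>i\<in>J. \<chi> i P = -1} \<union> (\<Union>i\<in>J. {P \<in> Pr. \<chi> i P = 0})"
  have finF: "finite F" unfolding F_def using good fin ram by blast
  define \<psi> where "\<psi> S = (\<lambda>x. \<Prod>i\<in>S. \<chi> i x)" for S
  have sub: "finite S" if "S \<subseteq> J" for S using that fin finite_subset by blast
  have \<psi>: "completely_mult (\<psi> S)" if "S \<subseteq> J" for S
  proof -
    have "\<psi> S x \<in> {-1, 0, 1}" if "x \<in> carrier G" for x
      using sub[OF \<open>S \<subseteq> J\<close>] \<open>S \<subseteq> J\<close>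
    proof (induction S rule: finite_induct)
      case (insert i S)
      have "\<chi> i x \<in> {-1, 0, 1}" using insert.prems \<chi>[of i] that unfolding completely_mult_def by blast
      moreover have "\<psi> (insert i S) x = \<chi> i x * \<psi> S x" unfolding \<psi>_def using insert.hyps by simp
      ultimately show ?case using insert by fastforce
    qed (simp add: \<psi>_def)
    moreover have "\<psi> S \<one> = 1"
      unfolding \<psi>_def using \<chi> \<open>S \<subseteq> J\<close> unfolding completely_mult_def by (intro prod.neutral) blast
    moreover have "\<psi> S (x \<otimes> y) = \<psi> S x * \<psi> S y" if "x \<in> carrier G" "y \<in> carrier G" for x y
      unfolding \<psi>_def prod.distrib[symmetric] using \<chi> \<open>S \<subseteq> J\<close> that
      unfolding completely_mult_def by (intro prod.cong) blast+
    ultimately show ?thesis unfolding completely_mult_def by blast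
  qed
  \<comment> \<open>Each factor 1 - \<chi>_i(P)^k is at most 2, and for given n each
    \<open>P\<close> in \<open>F\<close> accounts for at most one prime power; so the bound is
    independent of n.\<close>
  define C where "C = 2 ^ card J * (\<Sum>P\<in>F. real (deg P))"
  text \<open>The factor \<open>\<Prod>i\<in>J. (1 - \<chi> i P ^ k)\<close> vanishes for every \<open>P\<close> outside the finite set \<open>F\<close>.\<close>
  have comb: "(\<Sum>S\<in>Pow J. (-1) ^ card S * mangoldt (\<psi> S) n) \<le> C" for n
  proof -
    have "(\<Sum>S\<in>Pow J. (-1) ^ card S * mangoldt (\<psi> S) n) =
        (\<Sum>y\<in>prime_powers n. real (deg (fst y)) * (\<Sum>S\<in>Pow J. (-1) ^ card S * \<psi> S (fst y) ^ snd y))"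
      unfolding mangoldt_def sum_distrib_left
      by (subst sum.swap) (simp add: case_prod_unfold mult_ac)
    also have "\<dots> = (\<Sum>y\<in>prime_powers n. real (deg (fst y)) * (\<Prod>i\<in>J. 1 - \<chi> i (fst y) ^ snd y))"
    proof (intro sum.cong refl arg_cong2[where f = "(*)"])
      fix y :: "'m \<times> nat"
      have "(\<Prod>i\<in>J. 1 - \<chi> i (fst y) ^ snd y) = (\<Prod>i\<in>J. - (\<chi> i (fst y) ^ snd y) + 1)" by simp
      also have "\<dots> = (\<Sum>S\<in>Pow J. (\<Prod>i\<in>S. - (\<chi> i (fst y) ^ snd y)) * (\<Prod>i\<in>J - S. 1))"
        by (rule prod_add[OF fin])
      also have "\<dots> = (\<Sum>S\<in>Pow J. (-1) ^ card S * \<psi> S (fst y) ^ snd y)"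
        unfolding \<psi>_def by (intro sum.cong) (auto simp: prod_uminus prod_power_distrib)
      finally show "(\<Sum>S\<in>Pow J. (-1) ^ card S * \<psi> S (fst y) ^ snd y) = (\<Prod>i\<in>J. 1 - \<chi> i (fst y) ^ snd y)" ..
    qed
    also have "\<dots> \<le> (\<Sum>y\<in>prime_powers n. if fst y \<in> F then real (deg (fst y)) * 2 ^ card J else 0)"
    proof (rule sum_mono)
      fix y assume "y \<in> prime_powers n"
      then have P: "fst y \<in> Pr" "1 \<le> snd y" unfolding prime_powers_def by auto
      have vals: "\<chi> i (fst y) \<in> {-1, 0, 1}" if "i \<in> J" for i
        using \<chi>[OF that] Pr_closed[OF P(1)] unfolding completely_mult_def by blast
      show "real (deg (fst y)) * (\<Prod>i\<in>J. 1 - \<chi> i (fst y) ^ snd y) \<le>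
          (if fst y \<in> F then real (deg (fst y)) * 2 ^ card J else 0)"
      proof (cases "fst y \<in> F")
        case True
        have "(\<Prod>i\<in>J. 1 - \<chi> i (fst y) ^ snd y) \<le> (\<Prod>i\<in>J. 2)"
        proof (rule prod_mono)
          fix i assume "i \<in> J"
          then have "\<bar>\<chi> i (fst y)\<bar> \<le> 1" using vals[of i] by auto
          then have "\<bar>\<chi> i (fst y) ^ snd y\<bar> \<le> 1" unfolding power_abs by (intro power_le_one) auto
          then show "0 \<le> 1 - \<chi> i (fst y) ^ snd y \<and> 1 - \<chi> i (fst y) ^ snd y \<le> 2" by auto
        qed
        then show ?thesis using True by (simp add: mult_left_mono)
      next
        case False
        then have "\<exists>i\<in>J. \<chi> i (fst y) \<noteq> -1" "\<forall>i\<in>J. \<chi> i (fst y) \<noteq> 0"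
          using P unfolding F_def by auto
        then obtain i where "i \<in> J" "\<chi> i (fst y) = 1" using vals by blast
        then have "(\<Prod>i\<in>J. 1 - \<chi> i (fst y) ^ snd y) = 0"
          using fin by (intro prod_zero bexI[of _ i]) auto
        then show ?thesis using False by simp
      qed
    qed
    also have "\<dots> = (\<Sum>y\<in>{y\<in>prime_powers n. fst y \<in> F}. real (deg (fst y)) * 2 ^ card J)"
      by (simp add: sum.inter_filter finite_prime_powers)
    also have "\<dots> = (\<Sum>P\<in>fst ` {y\<in>prime_powers n. fst y \<in> F}. real (deg P) * 2 ^ card J)"
    proof -
      have "inj_on fst {y\<in>prime_powers n. fst y \<in> F}"
      proof (rule inj_onI)
        fix x y assume xy: "x \<in> {y\<in>prime_powers n. fst y \<in> F}" "y \<in> {y\<in>prime_powers n. fst y \<in> F}"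
          "fst x = fst y"
        then have "snd x * deg (fst x) = snd y * deg (fst x)" "fst x \<in> Pr"
          unfolding prime_powers_def by auto
        then have "snd x = snd y" using Pr_deg[of "fst x"] by auto
        then show "x = y" using xy(3) by (rule prod_eqI[rotated])
      qed
      then show ?thesis by (simp add: sum.reindex)
    qed
    also have "\<dots> \<le> (\<Sum>P\<in>F. real (deg P) * 2 ^ card J)"
      by (rule sum_mono2[OF finF]) auto
    also have "\<dots> = C" unfolding C_def sum_distrib_right[symmetric] by simp
    finally show ?thesis .
  qed
  define M where "M S u = suminf (\<lambda>n. mangoldt (\<psi> S) n * u ^ n)" for S u
  have "\<exists>B. \<forall>S\<in>Pow J - {{}}. eventually (\<lambda>u. \<bar>M S u\<bar> \<le> B S) (at_left (1 / real q))"
  proof (rule bchoice, rule ballI)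
    fix S assume S: "S \<in> Pow J - {{}}"
    then obtain N where "\<forall>n\<ge>N. coeff_sum (\<psi> S) n = 0" using van[of S] unfolding \<psi>_def by auto
    then show "\<exists>B. eventually (\<lambda>u. \<bar>M S u\<bar> \<le> B) (at_left (1 / real q))"
      using mangoldt_series_bounded[OF \<psi>, of S N] S unfolding M_def by auto
  qed
  then obtain B where B: "\<forall>S\<in>Pow J - {{}}. eventually (\<lambda>u. \<bar>M S u\<bar> \<le> B S) (at_left (1 / real q))" ..
  have ev1: "eventually (\<lambda>u. \<forall>S\<in>Pow J - {{}}. \<bar>M S u\<bar> \<le> B S) (at_left (1 / real q))"
    using B fin by (intro eventually_ball_finite) auto
  have q0: "real q > 1" using q_ge_2 by simp
  \<comment> \<open>The first term bounds |C|/(1 - u) for all u < 1/q; the second collects the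
    bounds for the nonempty subsets.\<close>
  define K where "K = \<bar>C\<bar> / (1 - 1 / real q) + (\<Sum>S\<in>Pow J - {{}}. B S)"
  have bound: "1 / (1 - real q * u) - 1 \<le> K"
    if u: "0 < u" "u < 1 / real q" and MB: "\<forall>S\<in>Pow J - {{}}. \<bar>M S u\<bar> \<le> B S" for u
  proof -
    have u1: "u < 1" using u q0 by (smt (verit) divide_le_eq_1)
    have sums: "(\<lambda>n. mangoldt (\<psi> S) n * u ^ n) sums M S u" if "S \<in> Pow J" for S
      using summable_norm_cancel[OF summable_mangoldt[OF \<psi>, of S u]] u that unfolding M_def by auto
    have "(\<lambda>n. \<Sum>S\<in>Pow J. (-1) ^ card S * (mangoldt (\<psi> S) n * u ^ n)) sums (\<Sum>S\<in>Pow J. (-1) ^ card S * M S u)"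
      by (intro sums_sum sums_mult sums)
    then have s1: "(\<lambda>n. (\<Sum>S\<in>Pow J. (-1) ^ card S * mangoldt (\<psi> S) n) * u ^ n) sums (\<Sum>S\<in>Pow J. (-1) ^ card S * M S u)"
      unfolding sum_distrib_right by (simp only: mult.assoc)
    have s2: "(\<lambda>n. \<bar>C\<bar> * u ^ n) sums (\<bar>C\<bar> * (1 / (1 - u)))"
      using u u1 by (intro sums_mult geometric_sums) simp
    have s3: "(\<Sum>S\<in>Pow J. (-1) ^ card S * mangoldt (\<psi> S) n) * u ^ n \<le> \<bar>C\<bar> * u ^ n" for n
      using comb[of n] u by (intro mult_right_mono) auto
    have 1: "(\<Sum>S\<in>Pow J. (-1) ^ card S * M S u) \<le> \<bar>C\<bar> * (1 / (1 - u))"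
      by (rule sums_le[OF s3 s1 s2])
    have 2: "\<bar>C\<bar> * (1 / (1 - u)) \<le> \<bar>C\<bar> / (1 - 1 / real q)"
    proof -
      have "1 / (1 - u) \<le> 1 / (1 - 1 / real q)"
        using u u1 q0 by (intro divide_left_mono) (auto simp: field_simps)
      then have "\<bar>C\<bar> * (1 / (1 - u)) \<le> \<bar>C\<bar> * (1 / (1 - 1 / real q))" by (intro mult_left_mono) auto
      then show ?thesis by simp
    qed
    have "\<psi> {} = (\<lambda>_. 1)" unfolding \<psi>_def by simp
    have "(\<lambda>n. mangoldt (\<psi> {}) n * u ^ n) sums (1 / (1 - real q * u) - 1)"
    proof -
      have "(\<lambda>n. (real q * u) ^ n) sums (1 / (1 - real q * u))"
        using u q0 by (intro geometric_sums) (simp add: field_simps)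
      then have "(\<lambda>n. (real q * u) ^ Suc n) sums (1 / (1 - real q * u) - 1)"
        by (subst sums_Suc_iff) simp
      then have "(\<lambda>n. mangoldt (\<psi> {}) (Suc n) * u ^ Suc n) sums (1 / (1 - real q * u) - 1)"
        unfolding \<open>\<psi> {} = (\<lambda>_. 1)\<close> mangoldt_one by (simp add: power_mult_distrib mult_ac)
      then show ?thesis by (subst (asm) sums_Suc_iff) simp
    qed
    then have M0: "M {} u = 1 / (1 - real q * u) - 1"
      using sums[of "{}"] sums_unique2 by auto
    have "(\<Sum>S\<in>Pow J. (-1) ^ card S * M S u) = M {} u + (\<Sum>S\<in>Pow J - {{}}. (-1) ^ card S * M S u)"
      using fin by (subst sum.remove[of _ "{}"]) auto
    moreover have "- (\<Sum>S\<in>Pow J - {{}}. B S) \<le> (\<Sum>S\<in>Pow J - {{}}. (-1) ^ card S * M S u)"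
      unfolding sum_negf[symmetric]
    proof (rule sum_mono)
      fix S assume "S \<in> Pow J - {{}}"
      then have "\<bar>(-1) ^ card S * M S u\<bar> \<le> B S" using MB by (simp add: abs_mult)
      then show "- B S \<le> (-1) ^ card S * M S u" by linarith
    qed
    ultimately show ?thesis using 1 2 M0 unfolding K_def by linarith
  qed
  have lim: "filterlim (\<lambda>u. 1 / (1 - real q * u)) at_top (at_left (1 / real q))"
  proof -
    have "((\<lambda>u. 1 - real q * u) \<longlongrightarrow> 1 - real q * (1 / real q)) (at_left (1 / real q))"
      by (intro tendsto_intros)
    then have "((\<lambda>u. 1 - real q * u) \<longlongrightarrow> 0) (at_left (1 / real q))" using q0 by simp
    moreover have "eventually (\<lambda>u. 0 < 1 - real q * u) (at_left (1 / real q))"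
      by (rule eventually_at_leftI[of 0]) (use q0 in \<open>auto simp: field_simps\<close>)
    ultimately have "filterlim (\<lambda>u. inverse (1 - real q * u)) at_top (at_left (1 / real q))"
      by (rule filterlim_inverse_at_top)
    then show ?thesis by (simp add: divide_inverse)
  qed
  \<comment> \<open>One more than the upper limit K + 1 that \<open>bound\<close> puts on 1/(1 - q
    u).\<close>
  have "eventually (\<lambda>u. K + 2 \<le> 1 / (1 - real q * u)) (at_left (1 / real q))"
    using lim unfolding filterlim_at_top by blast
  moreover have "eventually (\<lambda>u. u \<in> {0<..<1 / real q}) (at_left (1 / real q))"
    by (rule eventually_at_leftI[of 0]) (use q0 in auto)
  ultimately have "eventually (\<lambda>u. False) (at_left (1 / real q))"
    using ev1
  proof eventually_elim
    case (elim u)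
    then show ?case using bound[of u] by auto
  qed
  then show False by simp
qed

end

section \<open>The quadratic character and polynomials over a finite field\<close>

text \<open>A pairing without fixed points, as in Wilson's theorem; it will cancel x against its
  inverse.\<close>

lemma prod_involution_eq_1:
  fixes F :: "'x \<Rightarrow> real"
  assumes "finite A" "\<And>x. x \<in> A \<Longrightarrow> i x \<in> A" "\<And>x. x \<in> A \<Longrightarrow> i (i x) = x" "\<And>x. x \<in> A \<Longrightarrow> i x \<noteq> x"
    and "\<And>x. x \<in> A \<Longrightarrow> F x * F (i x) = 1"
  shows "prod F A = 1"
  using assms
proof (induction "card A" arbitrary: A rule: less_induct)
  case less
  show ?case
  proof (cases "A = {}")
    case False
    then obtain x where x: "x \<in> A" by blast
    let ?B = "A - {x, i x}"
    have ix: "i x \<in> A" "i x \<noteq> x" using less.prems x by auto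
    have "card ?B < card A" using x less.prems(1) by (intro psubset_card_mono) auto
    moreover have "i y \<in> ?B" if "y \<in> ?B" for y
      using less.prems(2,3)[of y] less.prems(3)[OF x] that by auto
    ultimately have "prod F ?B = 1" using less.prems by (intro less.hyps) auto
    moreover have "prod F A = F x * (F (i x) * prod F ?B)"
    proof -
      have "A = insert x (insert (i x) ?B)" using x ix by auto
      then have "prod F A = prod F (insert x (insert (i x) ?B))" by simp
      also have "\<dots> = F x * (F (i x) * prod F ?B)" using less.prems(1) ix by simp
      finally show ?thesis .
    qed
    ultimately show ?thesis using less.prems(5)[OF x] by simp
  qed simp
qed

locale finite_field_odd = field R for R :: "('a, 'b) ring_scheme" (structure) +
  assumes finite_carrier: "finite (carrier R)" and two_neq_0: "\<one> \<oplus> \<one> \<noteq> \<zero>"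
begin

definition qchar :: "'a \<Rightarrow> real" where
  "qchar x = (if x = \<zero> then 0 else if \<exists>y\<in>carrier R. y \<otimes> y = x then 1 else -1)"

abbreviation U where "U \<equiv> carrier R - {\<zero>}"

lemma finite_U: "finite U" using finite_carrier by simp

lemma minus_neq_self: assumes "x \<in> U" shows "\<ominus> x \<noteq> x"
proof
  assume eq: "\<ominus> x = x"
  have "x \<otimes> (\<one> \<oplus> \<one>) = x \<oplus> x" using assms by (simp add: r_distr)
  also have "\<dots> = \<ominus> x \<oplus> x" unfolding eq ..
  also have "\<dots> = \<zero>" using assms by (simp add: l_neg)
  finally show False using integral[of x "\<one> \<oplus> \<one>"] assms two_neq_0 by auto
qed

lemma square_eq_iff:
  assumes "x \<in> carrier R" "y \<in> carrier R"
  shows "x \<otimes> x = y \<otimes> y \<longleftrightarrow> x = y \<or> x = \<ominus> y"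
proof
  assume eq: "x \<otimes> x = y \<otimes> y"
  have "(x \<ominus> y) \<otimes> (x \<oplus> y) = x \<otimes> x \<ominus> y \<otimes> y" using assms by algebra
  also have "\<dots> = \<zero>" using eq assms by simp
  finally have "x \<ominus> y = \<zero> \<or> x \<oplus> y = \<zero>" using integral[of "x \<ominus> y" "x \<oplus> y"] assms by auto
  then show "x = y \<or> x = \<ominus> y" using assms by (metis minus_equality r_right_minus_eq)
next
  assume "x = y \<or> x = \<ominus> y" then show "x \<otimes> x = y \<otimes> y" using assms by (auto simp: l_minus r_minus)
qed

definition Sq where "Sq = (\<lambda>y. y \<otimes> y) ` U"

lemma Sq_subset: "Sq \<subseteq> U"
  unfolding Sq_def using integral by auto

text \<open>Squaring is two-to-one on \<open>U\<close>, because y and -y differ.\<close>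

lemma card_U: "card U = 2 * card Sq"
proof -
  have fib: "card {y \<in> U. y \<otimes> y = s} = 2" if "s \<in> Sq" for s
  proof -
    obtain y where y: "y \<in> U" "s = y \<otimes> y" using \<open>s \<in> Sq\<close> unfolding Sq_def by blast
    have "{z \<in> U. z \<otimes> z = s} = {y, \<ominus> y}"
      using y square_eq_iff[of _ y] by auto
    then show ?thesis using minus_neq_self[OF y(1)] by simp
  qed
  have "U = (\<Union>s\<in>Sq. {y \<in> U. y \<otimes> y = s})" unfolding Sq_def by auto
  then have "card U = card (\<Union>s\<in>Sq. {y \<in> U. y \<otimes> y = s})" by (rule arg_cong)
  also have "\<dots> = (\<Sum>s\<in>Sq. card {y \<in> U. y \<otimes> y = s})"
    using finite_U Sq_subset by (intro card_UN_disjoint) (auto dest: finite_subset)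
  also have "\<dots> = 2 * card Sq" using fib by simp
  finally show ?thesis .
qed

text \<open>Oddness of q is what makes a sign raised to any power of q equal to itself, which
  collapses the exponents in the reciprocity law.\<close>

lemma odd_card: "odd (card (carrier R))"
proof -
  have "card (carrier R) = Suc (card U)" using finite_carrier card.remove[of "carrier R" \<zero>] by simp
  then show ?thesis using card_U by simp
qed

lemma qchar_alt: "x \<in> U \<Longrightarrow> qchar x = (if x \<in> Sq then 1 else -1)"
  unfolding qchar_def Sq_def by (auto simp: image_iff)

lemma Sq_mult: "\<lbrakk>x \<in> Sq; y \<in> Sq\<rbrakk> \<Longrightarrow> x \<otimes> y \<in> Sq"
proof -
  assume "x \<in> Sq" "y \<in> Sq"
  then obtain a b where ab: "a \<in> U" "b \<in> U" "x = a \<otimes> a" "y = b \<otimes> b" unfolding Sq_def by blast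
  then have "x \<otimes> y = (a \<otimes> b) \<otimes> (a \<otimes> b)" by (simp add: m_ac)
  moreover have "a \<otimes> b \<in> U" using ab integral by auto
  ultimately show ?thesis unfolding Sq_def by blast
qed

lemma Sq_mult_iff:
  assumes x: "x \<in> U" and y: "y \<in> U"
  shows "x \<otimes> y \<in> Sq \<longleftrightarrow> (x \<in> Sq \<longleftrightarrow> y \<in> Sq)"
proof -
  have inv_Sq: "inv a \<in> Sq" if "a \<in> Sq" for a
  proof -
    obtain b where b: "b \<in> U" "a = b \<otimes> b" using \<open>a \<in> Sq\<close> unfolding Sq_def by blast
    then have bU: "b \<in> Units R" using field_Units by simp
    then have ib: "inv b \<in> carrier R" "b \<otimes> inv b = \<one>" using Units_r_inv by auto
    have "a \<otimes> (inv b \<otimes> inv b) = (b \<otimes> inv b) \<otimes> (b \<otimes> inv b)"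
      using b ib(1) by (simp add: m_ac)
    then have "inv a = inv b \<otimes> inv b" using b ib by (intro comm_inv_char) auto
    moreover have "inv b \<in> U" using Units_inv_Units[OF bU] field_Units by simp
    ultimately show ?thesis unfolding Sq_def by blast
  qed
  have one: "b \<in> Sq" if "a \<in> Sq" "b \<in> U" "a \<otimes> b \<in> Sq" for a b
  proof -
    have a: "a \<in> Units R" using that Sq_subset field_Units by auto
    have "b = inv a \<otimes> (a \<otimes> b)" using a that(2) by (simp add: m_assoc[symmetric] Units_closed)
    then show ?thesis using Sq_mult[OF inv_Sq[OF that(1)] that(3)] by simp
  qed
  \<comment> \<open>Multiplication by the nonsquare x maps \<open>Sq\<close> injectively into its
    complement, which has the same size. Hence y = x s with s a square, and x y = x^2 s.\<close>
  have both: "x \<otimes> y \<in> Sq" if "x \<notin> Sq" "y \<notin> Sq"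
  proof -
    have inj: "inj_on (\<lambda>s. x \<otimes> s) Sq"
    proof (rule inj_onI)
      fix s t assume "s \<in> Sq" "t \<in> Sq" "x \<otimes> s = x \<otimes> t"
      then show "s = t" using m_lcancel[of x s t] x Sq_subset by auto
    qed
    have sub: "(\<lambda>s. x \<otimes> s) ` Sq \<subseteq> U - Sq"
    proof
      fix z assume "z \<in> (\<lambda>s. x \<otimes> s) ` Sq"
      then obtain s where s: "s \<in> Sq" "z = x \<otimes> s" by auto
      have sU: "s \<in> U" using s Sq_subset by auto
      have "z \<in> U" using s x sU integral[of x s] by auto
      moreover have "z \<notin> Sq" using one[of s x] s x sU that(1) m_comm[of x s] by auto
      ultimately show "z \<in> U - Sq" by simp
    qed
    have "card (U - Sq) = card Sq"
      using card_U Sq_subset finite_U by (simp add: card_Diff_subset finite_subset)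
    then have "(\<lambda>s. x \<otimes> s) ` Sq = U - Sq"
      using sub finite_U card_image[OF inj] by (intro card_subset_eq) auto
    then obtain s where s: "s \<in> Sq" "y = x \<otimes> s" using y \<open>y \<notin> Sq\<close> by blast
    have "x \<otimes> y = (x \<otimes> x) \<otimes> s" using s x Sq_subset by (auto simp: m_assoc)
    moreover have "x \<otimes> x \<in> Sq" using x unfolding Sq_def by blast
    ultimately show ?thesis using Sq_mult s by simp
  qed
  show ?thesis using Sq_mult[of x y] one[of x y] one[of y x] both x y m_comm[of x y] by auto
qed

lemma qchar_mult:
  assumes "x \<in> carrier R" "y \<in> carrier R"
  shows "qchar (x \<otimes> y) = qchar x * qchar y"
proof (cases "x = \<zero> \<or> y = \<zero>")
  case True then show ?thesis using assms by (auto simp: qchar_def)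
next
  case False
  then have "x \<in> U" "y \<in> U" "x \<otimes> y \<in> U" using assms integral by auto
  then show ?thesis using Sq_mult_iff[of x y] by (simp add: qchar_alt)
qed

lemma qchar_zero [simp]: "qchar \<zero> = 0" by (simp add: qchar_def)

lemma qchar_one [simp]: "qchar \<one> = 1"
  unfolding qchar_def using one_not_zero by (auto intro: bexI[of _ \<one>])

lemma qchar_values: "qchar x \<in> {-1, 0, 1}" by (simp add: qchar_def)

lemma qchar_eq_0_iff: "qchar x = 0 \<longleftrightarrow> x = \<zero>" by (simp add: qchar_def)

lemma qchar_square: "x \<in> U \<Longrightarrow> qchar x * qchar x = 1"
  by (simp add: qchar_def)

text \<open>The sign (-1)^((q-1)/2) that governs quadratic reciprocity.\<close>

definition sgn1 :: real where "sgn1 = qchar (\<ominus> \<one>)"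

lemma sgn1_sq: "sgn1 * sgn1 = 1"
  unfolding sgn1_def using one_not_zero by (intro qchar_square) auto

lemma sgn1_pow_odd: "odd n \<Longrightarrow> sgn1 ^ n = sgn1"
  using sgn1_sq by (auto elim!: oddE simp: power_mult power2_eq_square)

lemma qchar_minus: "x \<in> carrier R \<Longrightarrow> qchar (\<ominus> x) = sgn1 * qchar x"
  unfolding sgn1_def using qchar_mult[of "\<ominus> \<one>" x] by (simp add: l_minus)

text \<open>Factors at x and at its inverse cancel unless x is 1 or -1, so only the factor at -1
  survives.\<close>

lemma prod_qchar_U: "(\<Prod>c\<in>U. qchar c) = sgn1"
proof -
  let ?A = "U - {\<one>, \<ominus> \<one>}"
  have inv: "inv x \<in> U" "x \<otimes> inv x = \<one>" "inv (inv x) = x" if "x \<in> U" for x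
    using that field_Units Units_inv_Units Units_r_inv Units_inv_inv by auto
  have "(\<Prod>c\<in>?A. qchar c) = 1"
  proof (rule prod_involution_eq_1[where i = "\<lambda>x. inv x"])
    fix x assume x: "x \<in> ?A"
    then have xU: "x \<in> U" by simp
    note i = inv[OF xU]
    show "inv (inv x) = x" by (rule i)
    have "inv x \<noteq> \<one>" using i x by auto
    moreover have "inv x \<noteq> \<ominus> \<one>"
    proof
      assume "inv x = \<ominus> \<one>"
      then have "\<ominus> x = \<one>" using i(2) xU by (simp add: r_minus)
      then show False using x xU by (metis DiffD2 DiffD1 insertCI minus_minus)
    qed
    ultimately show "inv x \<in> ?A" using i by simp
    show "inv x \<noteq> x"
    proof
      assume "inv x = x"
      then have "x \<otimes> x = \<one> \<otimes> \<one>" using i by simp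
      then show False using square_eq_iff[of x \<one>] x by auto
    qed
    show "qchar x * qchar (inv x) = 1"
      using qchar_mult[of x "inv x"] i xU by simp
  qed (use finite_U in auto)
  moreover have "(\<Prod>c\<in>U. qchar c) = qchar \<one> * (qchar (\<ominus> \<one>) * (\<Prod>c\<in>?A. qchar c))"
  proof -
    have "\<one> \<in> U" "\<ominus> \<one> \<in> U" "\<ominus> \<one> \<noteq> \<one>" using one_not_zero minus_neq_self[of \<one>] by auto
    then have "U = insert \<one> (insert (\<ominus> \<one>) ?A)" by auto
    then have "(\<Prod>c\<in>U. qchar c) = (\<Prod>c\<in>insert \<one> (insert (\<ominus> \<one>) ?A). qchar c)" by simp
    also have "\<dots> = qchar \<one> * (qchar (\<ominus> \<one>) * (\<Prod>c\<in>?A. qchar c))"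
      using finite_U \<open>\<ominus> \<one> \<noteq> \<one>\<close> by simp
    finally show ?thesis .
  qed
  ultimately show ?thesis unfolding sgn1_def by simp
qed

section \<open>Polynomials as coefficient lists and division with remainder\<close>

abbreviation PR where "PR \<equiv> poly_ring R"

sublocale P: principal_domain PR
  by (rule univ_poly_is_principal[OF carrier_is_subfield])

abbreviation P_zero ("0\<^sub>P") where "0\<^sub>P \<equiv> \<zero>\<^bsub>PR\<^esub>"
abbreviation P_one ("1\<^sub>P") where "1\<^sub>P \<equiv> \<one>\<^bsub>PR\<^esub>"
abbreviation P_add (infixl "+\<^sub>P" 65) where "f +\<^sub>P g \<equiv> f \<oplus>\<^bsub>PR\<^esub> g"
abbreviation P_diff (infixl "-\<^sub>P" 65) where "f -\<^sub>P g \<equiv> f \<ominus>\<^bsub>PR\<^esub> g"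
abbreviation P_minus ("-\<^sub>P _" [81] 80) where "-\<^sub>P f \<equiv> \<ominus>\<^bsub>PR\<^esub> f"
abbreviation P_mult (infixl "*\<^sub>P" 70) where "f *\<^sub>P g \<equiv> f \<otimes>\<^bsub>PR\<^esub> g"
abbreviation P_pow (infixr "^\<^sub>P" 75) where "f ^\<^sub>P n \<equiv> f [^]\<^bsub>PR\<^esub> (n::nat)"

lemma zero_PR: "0\<^sub>P = []" and one_PR: "1\<^sub>P = [\<one>]"
  by (simp_all add: univ_poly_zero univ_poly_one)

text \<open>Lists start with the leading coefficient. The value 0 at the zero polynomial makes
  \<open>lc\<close> multiplicative without exception and lets a zero remainder annihilate the symbol
  through \<open>qchar\<close>.\<close>

definition lc :: "'a list \<Rightarrow> 'a" where "lc f = (if f = [] then \<zero> else hd f)"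

lemma lc_closed: "f \<in> carrier PR \<Longrightarrow> lc f \<in> carrier R"
  unfolding lc_def by (auto simp: univ_poly_carrier[symmetric] polynomial_def)

lemma lc_eq_0: "f \<in> carrier PR \<Longrightarrow> lc f = \<zero> \<longleftrightarrow> f = []"
  unfolding lc_def by (auto simp: univ_poly_carrier[symmetric] polynomial_def)

lemma lc_mult: "\<lbrakk>f \<in> carrier PR; g \<in> carrier PR\<rbrakk> \<Longrightarrow> lc (f *\<^sub>P g) = lc f \<otimes> lc g"
proof -
  assume fg: "f \<in> carrier PR" "g \<in> carrier PR"
  show ?thesis
  proof (cases "f = [] \<or> g = []")
    case True
    then have "f *\<^sub>P g = []" using fg P.l_null P.r_null zero_PR by auto
    then show ?thesis using True lc_closed[OF fg(1)] lc_closed[OF fg(2)] by (auto simp: lc_def)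
  next
    case False
    then have "f *\<^sub>P g \<noteq> []" using P.integral[of f g] fg zero_PR by auto
    then show ?thesis using poly_mult_lead_coeff[OF carrier_is_subring] fg False
      by (simp add: lc_def univ_poly_carrier univ_poly_mult)
  qed
qed

lemma length_mult:
  assumes "f \<in> carrier PR" "g \<in> carrier PR" "f \<noteq> []" "g \<noteq> []"
  shows "length (f *\<^sub>P g) = length f + length g - 1" "f *\<^sub>P g \<noteq> []"
proof -
  show ne: "f *\<^sub>P g \<noteq> []" using P.integral[of f g] assms zero_PR by auto
  have "degree (f *\<^sub>P g) = degree f + degree g"
    using poly_mult_degree_eq[OF carrier_is_subring, of f g] assms
    by (simp add: univ_poly_carrier univ_poly_mult)
  moreover have "length f > 0" "length g > 0" "length (f *\<^sub>P g) > 0" using ne assms by auto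
  ultimately show "length (f *\<^sub>P g) = length f + length g - 1" by linarith
qed

lemma length_add_le: "length (f +\<^sub>P g) \<le> max (length f) (length g)"
  unfolding univ_poly_add using poly_add_length_le .

lemma add_lower:
  assumes "f \<in> carrier PR" "r \<in> carrier PR" "length r < length f"
  shows "length (f +\<^sub>P r) = length f" "lc (f +\<^sub>P r) = lc f"
proof -
  have pf: "polynomial (carrier R) f" "polynomial (carrier R) r" using assms univ_poly_carrier by auto
  have s: "set f \<subseteq> carrier R" "set r \<subseteq> carrier R" using pf by (auto dest: polynomial_in_carrier[OF carrier_is_subring])
  show l: "length (f +\<^sub>P r) = length f"
    using poly_add_length_eq[OF carrier_is_subring pf] assms(3) by (simp add: univ_poly_add)
  then have ne: "f +\<^sub>P r \<noteq> []" "f \<noteq> []" using assms(3) by auto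
  have "lc (f +\<^sub>P r) = coeff (poly_add f r) (degree f)"
    using lead_coeff_simp[OF ne(1)] l ne by (simp add: lc_def univ_poly_add)
  also have "\<dots> = coeff f (degree f) \<oplus> coeff r (degree f)"
    using poly_add_coeff[OF s] by simp
  also have "coeff r (degree f) = \<zero>" using assms(3) by (intro coeff_length) auto
  finally show "lc (f +\<^sub>P r) = lc f"
    using ne lead_coeff_simp[OF ne(2)] lc_closed[OF assms(1)] by (simp add: lc_def)
qed

lemma const_PR: "c \<in> U \<Longrightarrow> [c] \<in> carrier PR"
  by (auto simp: univ_poly_carrier[symmetric] polynomial_def)

lemma lc_const: "lc [c] = c" by (simp add: lc_def)

lemma length_smult:
  assumes "c \<in> U" "f \<in> carrier PR" shows "length ([c] *\<^sub>P f) = length f"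
proof (cases "f = []")
  case True then show ?thesis using P.r_null[OF const_PR[OF assms(1)]] zero_PR by simp
next
  case False then show ?thesis using length_mult(1)[OF const_PR[OF assms(1)] assms(2)] by simp
qed

lemma const_mult: "\<lbrakk>a \<in> U; b \<in> U\<rbrakk> \<Longrightarrow> [a] *\<^sub>P [b] = [a \<otimes> b]"
proof -
  assume ab: "a \<in> U" "b \<in> U"
  then have "length ([a] *\<^sub>P [b]) = 1" "lc ([a] *\<^sub>P [b]) = a \<otimes> b"
    using length_smult[OF ab(1) const_PR[OF ab(2)]] lc_mult[OF const_PR[OF ab(1)] const_PR[OF ab(2)]]
    by (auto simp: lc_const)
  then show ?thesis by (cases "[a] *\<^sub>P [b]") (auto simp: lc_def)
qed

definition Mon :: "nat \<Rightarrow> 'a list set" where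
  "Mon n = {f \<in> carrier PR. length f = Suc n \<and> lc f = \<one>}"

lemma MonD: "f \<in> Mon n \<Longrightarrow> f \<in> carrier PR" "f \<in> Mon n \<Longrightarrow> length f = Suc n" "f \<in> Mon n \<Longrightarrow> lc f = \<one>"
  "f \<in> Mon n \<Longrightarrow> f \<noteq> []"
  unfolding Mon_def by auto

lemma Mon_eq: "Mon n = (\<lambda>l. \<one> # l) ` {l. set l \<subseteq> carrier R \<and> length l = n}"
proof (intro equalityI subsetI)
  fix f assume "f \<in> Mon n"
  then show "f \<in> (\<lambda>l. \<one> # l) ` {l. set l \<subseteq> carrier R \<and> length l = n}"
    unfolding Mon_def by (cases f) (auto simp: lc_def univ_poly_carrier[symmetric] polynomial_def)
next
  fix f assume "f \<in> (\<lambda>l. \<one> # l) ` {l. set l \<subseteq> carrier R \<and> length l = n}"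
  then show "f \<in> Mon n"
    unfolding Mon_def using one_not_zero
    by (auto simp: lc_def univ_poly_carrier[symmetric] polynomial_def)
qed

lemma card_Mon: "card (Mon n) = card (carrier R) ^ n"
  unfolding Mon_eq using card_lists_length_eq[OF finite_carrier]
  by (subst card_image) (auto simp: inj_on_def)

lemma finite_Mon: "finite (Mon n)"
  unfolding Mon_eq using finite_lists_length_eq[OF finite_carrier] by simp

lemma Mon_mult: "\<lbrakk>f \<in> Mon m; g \<in> Mon n\<rbrakk> \<Longrightarrow> f *\<^sub>P g \<in> Mon (m + n)"
  using length_mult(1)[of f g] lc_mult[of f g] MonD(4)[of f m] MonD(4)[of g n] unfolding Mon_def by auto

text \<open>One representative per scalar class of nonzero residues modulo a polynomial of degree n:
  the counterpart of the half system 1, ..., (l-1)/2 modulo an odd prime l.\<close>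

definition MonLt :: "nat \<Rightarrow> 'a list set" where "MonLt n = (\<Union>k<n. Mon k)"

lemma finite_MonLt: "finite (MonLt n)" unfolding MonLt_def using finite_Mon by blast

lemma MonLt_iff: "f \<in> MonLt n \<longleftrightarrow> f \<in> carrier PR \<and> lc f = \<one> \<and> length f \<le> n"
proof -
  have "f \<noteq> []" if "lc f = \<one>" using that one_not_zero by (auto simp: lc_def)
  then show ?thesis unfolding MonLt_def Mon_def by (cases f) auto
qed

text \<open>The count is 1 + q + ... + q^(n-1), and q is odd.\<close>

lemma odd_card_MonLt_iff: "odd (card (MonLt n)) \<longleftrightarrow> odd n"
proof (induction n)
  case (Suc n)
  have "MonLt (Suc n) = MonLt n \<union> Mon n" unfolding MonLt_def by (auto simp: less_Suc_eq)
  moreover have "MonLt n \<inter> Mon n = {}" by (auto simp: MonLt_iff Mon_def)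
  ultimately have "card (MonLt (Suc n)) = card (MonLt n) + card (carrier R) ^ n"
    using card_Un_disjoint finite_Mon finite_MonLt card_Mon by metis
  then show ?case using Suc odd_card by simp
qed (simp add: MonLt_def)

lemma normalize_monic:
  assumes "f \<in> carrier PR" "f \<noteq> []"
  shows "\<exists>f'. f' \<in> Mon (length f - 1) \<and> f = [lc f] *\<^sub>P f'"
proof -
  let ?c = "lc f"
  have c: "?c \<in> U" using assms lc_closed lc_eq_0 by auto
  then have ic: "inv ?c \<in> U" "?c \<otimes> inv ?c = \<one>" "inv ?c \<otimes> ?c = \<one>"
    using field_Units Units_inv_Units Units_r_inv Units_l_inv by auto
  let ?f' = "[inv ?c] *\<^sub>P f"
  have "?f' \<in> carrier PR" using assms const_PR[OF ic(1)] by simp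
  moreover have "length ?f' = Suc (length f - 1)" using length_smult[OF ic(1) assms(1)] assms(2) by (cases f) auto
  moreover have "lc ?f' = \<one>" using lc_mult[OF const_PR[OF ic(1)] assms(1)] ic lc_const by simp
  moreover have "[?c] *\<^sub>P ?f' = f"
    using P.m_assoc[OF const_PR[OF c] const_PR[OF ic(1)] assms(1)] const_mult[OF c ic(1)] ic(2) assms(1)
    by (simp add: one_PR[symmetric])
  ultimately show ?thesis unfolding Mon_def by (intro exI[of _ ?f']) auto
qed

lemma pmod_closed: "\<lbrakk>f \<in> carrier PR; g \<in> carrier PR\<rbrakk> \<Longrightarrow> f pmod g \<in> carrier PR"
  and pdiv_closed: "\<lbrakk>f \<in> carrier PR; g \<in> carrier PR\<rbrakk> \<Longrightarrow> f pdiv g \<in> carrier PR"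
  using long_division_closed[OF carrier_is_subfield] by auto

lemma length_pmod:
  assumes "f \<in> carrier PR" "g \<in> carrier PR" "g \<noteq> []" shows "length (f pmod g) < length g"
  using pmod_degree[OF carrier_is_subfield assms] assms(3) by (cases g) auto

lemma pdiv_pmod_eq: "\<lbrakk>f \<in> carrier PR; g \<in> carrier PR\<rbrakk> \<Longrightarrow> f = g *\<^sub>P (f pdiv g) +\<^sub>P (f pmod g)"
  using pdiv_pmod[OF carrier_is_subfield] .

lemma pdiv_pmod_unique:
  assumes "g \<in> carrier PR" "k \<in> carrier PR" "r \<in> carrier PR" "length r < length g"
    and "f = g *\<^sub>P k +\<^sub>P r"
  shows "f pdiv g = k" "f pmod g = r"
proof -
  have "long_divides f g (k, r)" using assms by (intro long_dividesI) (auto, cases r, auto)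
  moreover have "f \<in> carrier PR" "g \<noteq> []" using assms by auto
  ultimately have "(k, r) = (f pdiv g, f pmod g)"
    using long_divisionI[OF carrier_is_subfield] assms(1) by blast
  then show "f pdiv g = k" "f pmod g = r" by auto
qed

lemma pmod_small: "\<lbrakk>f \<in> carrier PR; g \<in> carrier PR; length f < length g\<rbrakk> \<Longrightarrow> f pmod g = f"
  using pdiv_pmod_unique(2)[of g "0\<^sub>P" f f] by simp

lemma pmod_eq_iff:
  "\<lbrakk>a \<in> carrier PR; b \<in> carrier PR; g \<in> carrier PR\<rbrakk> \<Longrightarrow> a pmod g = b pmod g \<longleftrightarrow> g pdivides (a -\<^sub>P b)"
  using same_pmod_iff_pdivides[OF carrier_is_subfield] .

lemma pmod_Nil_iff: "\<lbrakk>a \<in> carrier PR; g \<in> carrier PR\<rbrakk> \<Longrightarrow> a pmod g = [] \<longleftrightarrow> g pdivides a"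
  using pmod_zero_iff_pdivides[OF carrier_is_subfield] .

lemma pdividesI: "\<lbrakk>k \<in> carrier PR; f = g *\<^sub>P k\<rbrakk> \<Longrightarrow> g pdivides f"
  unfolding pdivides_def factor_def by blast

lemma pdividesE: assumes "g pdivides f" obtains k where "k \<in> carrier PR" "f = g *\<^sub>P k"
  using assms unfolding pdivides_def factor_def by blast

lemma pdivides_mult: "\<lbrakk>g pdivides f; g \<in> carrier PR; x \<in> carrier PR\<rbrakk> \<Longrightarrow> g pdivides (f *\<^sub>P x)"
  by (elim pdividesE, rule pdividesI[of "_ *\<^sub>P x"]) (auto simp: P.m_assoc)

lemma pdivides_add: "\<lbrakk>g pdivides f; g pdivides h; g \<in> carrier PR\<rbrakk> \<Longrightarrow> g pdivides (f +\<^sub>P h)"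
proof (elim pdividesE)
  fix k l assume "g \<in> carrier PR" "k \<in> carrier PR" "l \<in> carrier PR" "f = g *\<^sub>P k" "h = g *\<^sub>P l"
  then show ?thesis by (intro pdividesI[of "k +\<^sub>P l"]) (auto simp: P.r_distr)
qed

lemma pmod_mult_cong:
  assumes "a \<in> carrier PR" "b \<in> carrier PR" "x \<in> carrier PR" "g \<in> carrier PR" "a pmod g = b pmod g"
  shows "(a *\<^sub>P x) pmod g = (b *\<^sub>P x) pmod g"
proof -
  have "g pdivides ((a -\<^sub>P b) *\<^sub>P x)" using assms pmod_eq_iff pdivides_mult by simp
  moreover have "(a -\<^sub>P b) *\<^sub>P x = (a *\<^sub>P x) -\<^sub>P (b *\<^sub>P x)"
    using assms by (simp add: P.l_distr P.l_minus a_minus_def)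
  ultimately show ?thesis using assms pmod_eq_iff by simp
qed

lemma pmod_pmod: "\<lbrakk>f \<in> carrier PR; g \<in> carrier PR; g \<noteq> []\<rbrakk> \<Longrightarrow> (f pmod g) pmod g = f pmod g"
  using pmod_small[OF pmod_closed] length_pmod by blast

lemma pmod_smult:
  assumes c: "c \<in> U" and fg: "f \<in> carrier PR" "g \<in> carrier PR" "g \<noteq> []"
  shows "([c] *\<^sub>P f) pmod g = [c] *\<^sub>P (f pmod g)"
proof (rule pdiv_pmod_unique(2)[of _ "[c] *\<^sub>P (f pdiv g)"])
  let ?q = "f pdiv g" and ?r = "f pmod g"
  have cl: "?q \<in> carrier PR" "?r \<in> carrier PR" "[c] \<in> carrier PR"
    using fg pdiv_closed pmod_closed const_PR[OF c] by auto
  show "length ([c] *\<^sub>P ?r) < length g" using length_smult[OF c cl(2)] length_pmod fg by simp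
  have "[c] *\<^sub>P f = [c] *\<^sub>P (g *\<^sub>P ?q +\<^sub>P ?r)" using pdiv_pmod_eq fg by simp
  also have "\<dots> = g *\<^sub>P ([c] *\<^sub>P ?q) +\<^sub>P [c] *\<^sub>P ?r"
    using cl fg by (simp add: P.r_distr P.m_lcomm)
  finally show "[c] *\<^sub>P f = g *\<^sub>P ([c] *\<^sub>P ?q) +\<^sub>P [c] *\<^sub>P ?r" .
qed (use assms pdiv_closed pmod_closed const_PR[OF c] in auto)

end

section \<open>The Jacobi symbol and its reciprocity law\<close>

context finite_field_odd
begin

text \<open>For coprime \<open>f\<close> and \<open>g\<close> this is the Jacobi symbol \<open>(f/g)\<close>: the leading coefficients
  play the role of the signs in Gauss' lemma over the integers.\<close>

definition J :: "'a list \<Rightarrow> 'a list \<Rightarrow> real" where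
  "J g f = (\<Prod>h\<in>MonLt (degree g). qchar (lc ((f *\<^sub>P h) pmod g)))"

lemma J_eq_0_iff:
  assumes "g \<in> Mon n" "f \<in> carrier PR"
  shows "J g f = 0 \<longleftrightarrow> (\<exists>h\<in>MonLt n. g pdivides (f *\<^sub>P h))"
proof -
  have "degree g = n" "g \<in> carrier PR" using assms(1) MonD by auto
  then have "qchar (lc ((f *\<^sub>P h) pmod g)) = 0 \<longleftrightarrow> g pdivides (f *\<^sub>P h)" if "h \<in> MonLt n" for h
    using that assms(2) lc_eq_0 pmod_closed pmod_Nil_iff by (simp add: qchar_eq_0_iff MonLt_iff)
  then show ?thesis unfolding J_def \<open>degree g = n\<close> using finite_MonLt by (simp add: prod_zero_iff)
qed

lemma J_values: "J g f \<in> {-1, 0, 1}"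
proof -
  have vals: "(\<Prod>h\<in>A. qchar (F h)) \<in> {-1, 0, 1}" if "finite A" for A :: "'a list set" and F
    using that
  proof (induction A rule: finite_induct)
    case (insert x A)
    then show ?case using qchar_values[of "F x"] by auto
  qed simp
  show ?thesis unfolding J_def by (rule vals[OF finite_MonLt])
qed

text \<open>Nonvanishing of the symbol plays the part of coprimality. If x had a nonzero remainder,
  its monic associate h would lie in \<open>MonLt n\<close> with f h divisible by g, giving a zero
  factor of \<open>J g f\<close>.\<close>

lemma cancel_mod:
  assumes g: "g \<in> Mon n" and f: "f \<in> carrier PR" and "J g f \<noteq> 0"
    and x: "x \<in> carrier PR" "g pdivides (f *\<^sub>P x)"
  shows "g pdivides x"
proof (rule ccontr)
  assume "\<not> g pdivides x"
  note gD = MonD[OF g]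
  let ?r = "x pmod g"
  have r: "?r \<in> carrier PR" "?r \<noteq> []" "length ?r < length g"
    using pmod_closed[of x g] length_pmod[of x g] pmod_Nil_iff[of x g] gD x \<open>\<not> g pdivides x\<close> by auto
  obtain h where h: "h \<in> Mon (length ?r - 1)" "?r = [lc ?r] *\<^sub>P h"
    using normalize_monic[OF r(1,2)] by blast
  have hL: "h \<in> MonLt n" using h(1) r gD(2) unfolding Mon_def MonLt_iff by auto
  have hc: "h \<in> carrier PR" using hL MonLt_iff by simp
  have c: "lc ?r \<in> U" using r lc_closed lc_eq_0 by auto
  have "(x *\<^sub>P f) pmod g = (?r *\<^sub>P f) pmod g"
    using pmod_mult_cong[of x ?r f g] pmod_pmod x(1) f gD r by simp
  then have "(?r *\<^sub>P f) pmod g = []"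
    using pmod_Nil_iff[of "x *\<^sub>P f" g] x f gD P.m_comm[of x f] by simp
  moreover have "?r *\<^sub>P f = [lc ?r] *\<^sub>P (f *\<^sub>P h)"
    by (subst (1) h(2)) (use const_PR[OF c] hc f in \<open>simp add: P.m_ac\<close>)
  ultimately have "[lc ?r] *\<^sub>P ((f *\<^sub>P h) pmod g) = []"
    using pmod_smult[OF c, of "f *\<^sub>P h" g] f hc gD by simp
  then have "length ((f *\<^sub>P h) pmod g) = 0"
    using length_smult[OF c pmod_closed, of "f *\<^sub>P h" g] f hc gD(1) by simp
  then have "g pdivides (f *\<^sub>P h)" using pmod_Nil_iff[of "f *\<^sub>P h" g] f hc gD(1) by simp
  then show False using J_eq_0_iff[OF g f] hL assms(3) by blast
qed

lemma J_cong:
  assumes "g \<in> Mon n" "f \<in> carrier PR" "f' \<in> carrier PR" "f pmod g = f' pmod g"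
  shows "J g f = J g f'"
  unfolding J_def using pmod_mult_cong[OF assms(2,3) _ MonD(1)[OF assms(1)] assms(4)]
  by (intro prod.cong) (auto simp: MonLt_iff)

text \<open>Multiplication by f permutes the nonzero residues up to scalars. If h and k have the
  same image, then d f h and c f k agree modulo g for scalars c and d; cancelling f and comparing
  degrees and leading coefficients gives h = k.\<close>

lemma monic_residue_bij:
  assumes g: "g \<in> Mon n" and f: "f \<in> carrier PR" and nz: "J g f \<noteq> 0"
  obtains \<tau> where "bij_betw \<tau> (MonLt n) (MonLt n)"
    "\<And>h. h \<in> MonLt n \<Longrightarrow> lc ((f *\<^sub>P h) pmod g) \<in> U
      \<and> (f *\<^sub>P h) pmod g = [lc ((f *\<^sub>P h) pmod g)] *\<^sub>P \<tau> h"
proof -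
  note gD = MonD[OF g]
  let ?r = "\<lambda>h. (f *\<^sub>P h) pmod g"
  have r: "?r h \<in> carrier PR" "?r h \<noteq> []" "length (?r h) < length g" if "h \<in> MonLt n" for h
  proof -
    have "h \<in> carrier PR" using that MonLt_iff by simp
    then show "?r h \<in> carrier PR" "length (?r h) < length g" using f gD pmod_closed length_pmod[of "f *\<^sub>P h" g] by auto
    show "?r h \<noteq> []" using J_eq_0_iff[OF g f] nz that \<open>h \<in> carrier PR\<close> pmod_Nil_iff f gD by auto
  qed
  have c: "lc (?r h) \<in> U" if "h \<in> MonLt n" for h using r[OF that] lc_closed lc_eq_0 by auto
  have "\<forall>h\<in>MonLt n. \<exists>k. k \<in> Mon (length (?r h) - 1) \<and> ?r h = [lc (?r h)] *\<^sub>P k"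
    using normalize_monic r by blast
  then obtain \<tau> where \<tau>: "\<And>h. h \<in> MonLt n \<Longrightarrow> \<tau> h \<in> Mon (length (?r h) - 1)"
    "\<And>h. h \<in> MonLt n \<Longrightarrow> ?r h = [lc (?r h)] *\<^sub>P \<tau> h" by metis
  have \<tau>L: "\<tau> h \<in> MonLt n" if "h \<in> MonLt n" for h
    using \<tau>(1)[OF that] r[OF that] gD(2) unfolding Mon_def MonLt_iff by auto
  have "inj_on \<tau> (MonLt n)"
  proof (rule inj_onI)
    fix h k assume hk: "h \<in> MonLt n" "k \<in> MonLt n" "\<tau> h = \<tau> k"
    let ?c = "lc (?r h)" and ?d = "lc (?r k)"
    have cd: "[?c] \<in> carrier PR" "[?d] \<in> carrier PR" using c hk const_PR by auto
    have hkc: "h \<in> carrier PR" "k \<in> carrier PR" "\<tau> h \<in> carrier PR" using hk \<tau>L MonLt_iff by auto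
    have "(f *\<^sub>P ([?d] *\<^sub>P h)) pmod g = [?d] *\<^sub>P ([?c] *\<^sub>P \<tau> h)"
      using pmod_smult[OF c[OF hk(2)], of "f *\<^sub>P h" g] \<tau>(2)[OF hk(1)] P.m_lcomm[of f "[?d]" h] f hkc gD cd
      by simp
    also have "\<dots> = [?c] *\<^sub>P ([?d] *\<^sub>P \<tau> k)" using hk(3) P.m_lcomm cd hkc by simp
    also have "\<dots> = (f *\<^sub>P ([?c] *\<^sub>P k)) pmod g"
      using pmod_smult[OF c[OF hk(1)], of "f *\<^sub>P k" g] \<tau>(2)[OF hk(2)] P.m_lcomm[of f "[?c]" k] f hkc gD cd
      by simp
    finally have "g pdivides (f *\<^sub>P ([?d] *\<^sub>P h) -\<^sub>P f *\<^sub>P ([?c] *\<^sub>P k))"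
      using pmod_eq_iff f hkc cd gD by simp
    moreover have "f *\<^sub>P ([?d] *\<^sub>P h) -\<^sub>P f *\<^sub>P ([?c] *\<^sub>P k) =
        f *\<^sub>P ([?d] *\<^sub>P h -\<^sub>P [?c] *\<^sub>P k)"
      using f hkc cd by (simp add: P.r_distr P.r_minus a_minus_def)
    ultimately have "g pdivides ([?d] *\<^sub>P h -\<^sub>P [?c] *\<^sub>P k)"
      using cancel_mod[OF g f nz] hkc cd by simp
    then have "([?d] *\<^sub>P h) pmod g = ([?c] *\<^sub>P k) pmod g"
      using pmod_eq_iff hkc cd gD by simp
    moreover have "length h < length g" "length k < length g" using hk gD(2) MonLt_iff by auto
    ultimately have eq: "[?d] *\<^sub>P h = [?c] *\<^sub>P k"
      using pmod_small hkc cd gD length_smult[OF c[OF hk(2)], of h] length_smult[OF c[OF hk(1)], of k] by simp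
    have "lc h = \<one>" "lc k = \<one>" using hk MonLt_iff by auto
    then have "?d = ?c" using arg_cong[OF eq, of lc] lc_mult cd hkc c hk by (simp add: lc_const)
    have "[?c] *\<^sub>P h = [?c] *\<^sub>P k" using eq unfolding \<open>?d = ?c\<close> .
    moreover have "[?c] \<noteq> 0\<^sub>P" using zero_PR by simp
    ultimately show "h = k" using P.m_lcancel[OF _ cd(1) hkc(1,2)] by blast
  qed
  moreover have "\<tau> ` MonLt n \<subseteq> MonLt n" using \<tau>L by auto
  ultimately have "bij_betw \<tau> (MonLt n) (MonLt n)"
    unfolding bij_betw_def using finite_MonLt by (auto simp: endo_inj_surj)
  moreover have "lc (?r h) \<in> U \<and> ?r h = [lc (?r h)] *\<^sub>P \<tau> h" if "h \<in> MonLt n" for h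
    using \<tau>(2)[OF that] c[OF that] by (rule conjI[rotated])
  ultimately show thesis by (rule that)
qed

text \<open>Multiplying h by f2 first yields a scalar times \<open>\<tau> h\<close>. The scalars
  make up \<open>J g f2\<close>; reindexing along \<open>\<tau>\<close> turns the rest into
  \<open>J g f1\<close>. A witness for \<open>J g f2 = 0\<close> survives multiplication by
  f1.\<close>

lemma J_mult:
  assumes g: "g \<in> Mon n" and f: "f1 \<in> carrier PR" "f2 \<in> carrier PR"
  shows "J g (f1 *\<^sub>P f2) = J g f1 * J g f2"
proof (cases "J g f2 = 0")
  case True
  then obtain h where h: "h \<in> MonLt n" "g pdivides (f2 *\<^sub>P h)" using J_eq_0_iff[OF g f(2)] by blast
  then have hc: "h \<in> carrier PR" using MonLt_iff by simp
  have "g pdivides (f2 *\<^sub>P h *\<^sub>P f1)" using pdivides_mult[OF h(2)] MonD(1)[OF g] f by simp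
  then have "g pdivides (f1 *\<^sub>P f2 *\<^sub>P h)" using f hc by (simp add: P.m_ac)
  then have "J g (f1 *\<^sub>P f2) = 0" using J_eq_0_iff[OF g, of "f1 *\<^sub>P f2"] f h by auto
  then show ?thesis using True by simp
next
  case False
  note gD = MonD[OF g]
  obtain \<tau> where \<tau>: "bij_betw \<tau> (MonLt n) (MonLt n)"
    "\<And>h. h \<in> MonLt n \<Longrightarrow> lc ((f2 *\<^sub>P h) pmod g) \<in> U
      \<and> (f2 *\<^sub>P h) pmod g = [lc ((f2 *\<^sub>P h) pmod g)] *\<^sub>P \<tau> h"
    using monic_residue_bij[OF g f(2) False] by blast
  have deg: "degree g = n" using gD by simp
  have "qchar (lc ((f1 *\<^sub>P f2 *\<^sub>P h) pmod g)) =
      qchar (lc ((f2 *\<^sub>P h) pmod g)) * qchar (lc ((f1 *\<^sub>P \<tau> h) pmod g))" if h: "h \<in> MonLt n" for h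
  proof -
    let ?r = "(f2 *\<^sub>P h) pmod g"
    have hc: "h \<in> carrier PR" "\<tau> h \<in> carrier PR" "?r \<in> carrier PR"
      using h bij_betwE[OF \<tau>(1)] MonLt_iff pmod_closed f gD by auto
    have c: "lc ?r \<in> U" "?r = [lc ?r] *\<^sub>P \<tau> h" using \<tau>(2)[OF h] by auto
    have "(f1 *\<^sub>P f2 *\<^sub>P h) pmod g = ((f2 *\<^sub>P h) *\<^sub>P f1) pmod g" using f hc by (simp add: P.m_ac)
    also have "\<dots> = (?r *\<^sub>P f1) pmod g"
      using pmod_mult_cong[of "f2 *\<^sub>P h" ?r f1 g] pmod_pmod f hc gD by simp
    also have "?r *\<^sub>P f1 = [lc ?r] *\<^sub>P (f1 *\<^sub>P \<tau> h)"
      by (subst (1) c(2)) (use const_PR[OF c(1)] hc f in \<open>simp add: P.m_ac\<close>)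
    also have "\<dots> pmod g = [lc ?r] *\<^sub>P ((f1 *\<^sub>P \<tau> h) pmod g)"
      using pmod_smult[OF c(1)] f hc gD by simp
    finally have "lc ((f1 *\<^sub>P f2 *\<^sub>P h) pmod g) = lc ?r \<otimes> lc ((f1 *\<^sub>P \<tau> h) pmod g)"
      using lc_mult[OF const_PR[OF c(1)] pmod_closed] f hc gD by (simp add: lc_const)
    then show ?thesis using qchar_mult lc_closed pmod_closed f hc gD by simp
  qed
  then have "J g (f1 *\<^sub>P f2) = J g f2 * (\<Prod>h\<in>MonLt n. qchar (lc ((f1 *\<^sub>P \<tau> h) pmod g)))"
    unfolding J_def deg prod.distrib[symmetric] by (rule prod.cong[OF refl])
  also have "(\<Prod>h\<in>MonLt n. qchar (lc ((f1 *\<^sub>P \<tau> h) pmod g))) = J g f1"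
    unfolding J_def deg by (rule prod.reindex_bij_betw[OF \<tau>(1)])
  finally show ?thesis by simp
qed

lemma J_one: "g \<in> Mon n \<Longrightarrow> J g 1\<^sub>P = 1"
  unfolding J_def using MonD[of g n]
  by (intro prod.neutral) (auto simp: MonLt_iff pmod_small)

text \<open>No reduction takes place, so every factor equals \<open>qchar c\<close>, and the number
  of factors has the parity of n.\<close>

lemma J_const:
  assumes g: "g \<in> Mon n" and c: "c \<in> U" shows "J g [c] = qchar c ^ n"
proof -
  have "lc (([c] *\<^sub>P h) pmod g) = c" if "h \<in> MonLt n" for h
  proof -
    have h: "h \<in> carrier PR" "lc h = \<one>" "length h \<le> n" using that MonLt_iff by auto
    then have "([c] *\<^sub>P h) pmod g = [c] *\<^sub>P h"
      using pmod_small[of "[c] *\<^sub>P h" g] length_smult[OF c h(1)] MonD[OF g] const_PR[OF c] by simp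
    then show ?thesis using lc_mult[OF const_PR[OF c] h(1)] h c by (simp add: lc_const)
  qed
  then have "J g [c] = qchar c ^ card (MonLt n)"
    unfolding J_def using MonD(2)[OF g] by simp
  also have "\<dots> = qchar c ^ n"
  proof -
    have "qchar c = 1 \<or> qchar c = -1" using qchar_alt[OF c] by auto
    then show ?thesis using odd_card_MonLt_iff[of n] by auto
  qed
  finally show ?thesis .
qed

section \<open>Reciprocity from a double product over monic polynomials\<close>

definition NZ :: "nat \<Rightarrow> 'a list set" where
  "NZ b = {w \<in> carrier PR. w \<noteq> [] \<and> length w \<le> b}"

text \<open>In each degree k < b every nonzero leading coefficient occurs q^k times, an odd number,
  so each degree contributes the product of \<open>qchar\<close> over \<open>U\<close>, which is
  \<open>sgn1\<close>.\<close>

lemma prod_qchar_NZ: "finite (NZ b) \<and> (\<Prod>w\<in>NZ b. qchar (lc w)) = sgn1 ^ b"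
proof (induction b)
  case 0
  have "NZ 0 = {}" unfolding NZ_def by auto
  then show ?case by simp
next
  case (Suc b)
  let ?L = "{l. set l \<subseteq> carrier R \<and> length l = b}"
  let ?E = "{w \<in> carrier PR. length w = Suc b}"
  have NZ_eq: "NZ (Suc b) = NZ b \<union> ?E" unfolding NZ_def by (auto simp: le_Suc_eq)
  have disj: "NZ b \<inter> ?E = {}" unfolding NZ_def by auto
  have E: "?E = (\<lambda>(c, l). c # l) ` (U \<times> ?L)"
  proof (intro equalityI subsetI)
    fix w assume "w \<in> ?E"
    then show "w \<in> (\<lambda>(c, l). c # l) ` (U \<times> ?L)"
      by (cases w) (auto simp: univ_poly_carrier[symmetric] polynomial_def image_iff)
  qed (auto simp: univ_poly_carrier[symmetric] polynomial_def)
  have finL: "finite ?L" "card ?L = card (carrier R) ^ b"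
    using finite_lists_length_eq[OF finite_carrier] card_lists_length_eq[OF finite_carrier] by auto
  have finE: "finite ?E" unfolding E using finL finite_U by (intro finite_imageI finite_cartesian_product)
  have "(\<Prod>w\<in>?E. qchar (lc w)) = (\<Prod>(c, l)\<in>U \<times> ?L. qchar c)"
    unfolding E by (subst prod.reindex) (auto simp: inj_on_def lc_def intro!: prod.cong)
  also have "\<dots> = (\<Prod>c\<in>U. \<Prod>l\<in>?L. qchar c)"
    by (rule prod.cartesian_product[symmetric])
  also have "\<dots> = (\<Prod>c\<in>U. qchar c) ^ card (carrier R) ^ b"
    unfolding prod_constant finL(2) prod_power_distrib ..
  also have "\<dots> = sgn1" unfolding prod_qchar_U using odd_card by (intro sgn1_pow_odd) simp
  finally have "(\<Prod>w\<in>?E. qchar (lc w)) = sgn1" .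
  then show ?case
    unfolding NZ_eq using Suc finE disj by (simp add: prod.union_disjoint)
qed

lemma length_lc_minus:
  "w \<in> carrier PR \<Longrightarrow> length (-\<^sub>P w) = length w"
  "w \<in> carrier PR \<Longrightarrow> lc (-\<^sub>P w) = \<ominus> lc w"
  using univ_poly_a_inv_length[OF carrier_is_subring, of w] univ_poly_a_inv_def'[OF carrier_is_subring, of w]
  by (auto simp: lc_def hd_map)

text \<open>Turns a product over monic polynomials of one degree into a product over all nonzero
  polynomials of smaller degree, to which \<open>prod_qchar_NZ\<close> applies.\<close>

lemma Mon_diff:
  assumes "k \<in> Mon b"
  shows "bij_betw (\<lambda>k'. k -\<^sub>P k') (Mon b - {k}) (NZ b)"
proof (rule bij_betw_byWitness[where f' = "\<lambda>w. k -\<^sub>P w"])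
  note kD = MonD[OF assms]
  have id: "k -\<^sub>P (k -\<^sub>P x) = x" if "x \<in> carrier PR" for x
    using that kD(1) by algebra
  show "\<forall>a\<in>Mon b - {k}. k -\<^sub>P (k -\<^sub>P a) = a" using id MonD by blast
  show "\<forall>a\<in>NZ b. k -\<^sub>P (k -\<^sub>P a) = a" using id unfolding NZ_def by blast
  show "(\<lambda>k'. k -\<^sub>P k') ` (Mon b - {k}) \<subseteq> NZ b"
  proof
    fix w assume "w \<in> (\<lambda>k'. k -\<^sub>P k') ` (Mon b - {k})"
    then obtain k' where k': "k' \<in> Mon b" "k' \<noteq> k" "w = k -\<^sub>P k'" by blast
    note k'D = MonD[OF k'(1)]
    have w: "w \<in> carrier PR" using k'(3) kD k'D by simp
    have ne: "w \<noteq> []" using k' kD k'D zero_PR P.r_right_minus_eq[of k k'] by auto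
    have le: "length w \<le> Suc b"
      using length_add_le[of k "-\<^sub>P k'"] length_lc_minus(1)[OF k'D(1)] kD k'D k'(3) by (simp add: a_minus_def)
    have "length w \<noteq> Suc b"
    proof
      assume lw: "length w = Suc b"
      have "set k \<subseteq> carrier R" "set (-\<^sub>P k') \<subseteq> carrier R"
        using kD(1) P.a_inv_closed[OF k'D(1)]
        by (auto simp: univ_poly_carrier[symmetric] dest!: polynomial_in_carrier[OF carrier_is_subring])
      then have "coeff w b = coeff k b \<oplus> coeff (-\<^sub>P k') b"
        using poly_add_coeff[of k "-\<^sub>P k'"] k'(3) by (simp add: a_minus_def univ_poly_add)
      moreover have "coeff x b = lc x" if "length x = Suc b" for x
        using that lead_coeff_simp[of x] by (auto simp: lc_def)
      ultimately have "lc w = lc k \<oplus> \<ominus> lc k'"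
        using lw kD(2) k'D(1,2) length_lc_minus by simp
      then have "lc w = \<zero>" using kD(3) k'D(3) by (simp add: r_neg)
      then show False using lc_eq_0[OF w] ne by simp
    qed
    then show "w \<in> NZ b" using w ne le unfolding NZ_def by simp
  qed
  show "(\<lambda>w. k -\<^sub>P w) ` NZ b \<subseteq> Mon b - {k}"
  proof
    fix k' assume "k' \<in> (\<lambda>w. k -\<^sub>P w) ` NZ b"
    then obtain w where w: "w \<in> carrier PR" "w \<noteq> []" "length w \<le> b" "k' = k -\<^sub>P w" unfolding NZ_def by blast
    have "k' \<in> Mon b"
      using add_lower[of k "-\<^sub>P w"] length_lc_minus(1)[OF w(1)] kD w
      unfolding Mon_def by (simp add: a_minus_def)
    moreover have "k' \<noteq> k"
    proof
      assume "k' = k"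
      then have "w = 0\<^sub>P" using id[OF w(1)] w(4) kD(1) by (simp add: a_minus_def P.r_neg)
      then show False using w(2) zero_PR by simp
    qed
    ultimately show "k' \<in> Mon b - {k}" by simp
  qed
qed

text \<open>With quotient k0 and remainder r of f h by g, f h - g k = g (k0 - k) + r. For k other
  than k0 the leading coefficient is that of k0 - k, and these multiply up to a power of
  \<open>sgn1\<close>; for k = k0 only r is left.\<close>

lemma inner_product:
  assumes f: "f \<in> Mon m" and g: "g \<in> Mon n" and h: "h \<in> Mon a" and deg: "m + a = n + b"
  shows "(\<Prod>k\<in>Mon b. qchar (lc (f *\<^sub>P h -\<^sub>P g *\<^sub>P k))) =
    qchar (lc ((f *\<^sub>P h) pmod g)) * sgn1 ^ b"
proof -
  let ?F = "f *\<^sub>P h" and ?k = "(f *\<^sub>P h) pdiv g" and ?r = "(f *\<^sub>P h) pmod g"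
  note fD = MonD[OF f] and gD = MonD[OF g] and hD = MonD[OF h]
  note FD = MonD[OF Mon_mult[OF f h]]
  have cl: "?k \<in> carrier PR" "?r \<in> carrier PR" "length ?r < length g"
    using pdiv_closed pmod_closed length_pmod[of "f *\<^sub>P h" g] FD gD by auto
  have eq: "?F = g *\<^sub>P ?k +\<^sub>P ?r" using pdiv_pmod_eq FD gD by simp
  \<comment> \<open>The degree condition m + a = n + b puts the quotient among the polynomials k of
    the product.\<close>
  have k: "?k \<in> Mon b"
  proof -
    have "?k \<noteq> []"
    proof
      assume "?k = []"
      then have "?F = ?r" using eq gD cl zero_PR by (metis P.l_zero P.r_null)
      then show False using cl(3) FD(2) gD(2) deg by simp
    qed
    then have gk: "length (g *\<^sub>P ?k) = length g + length ?k - 1" using length_mult gD cl by simp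
    then have lt: "length ?r < length (g *\<^sub>P ?k)" using cl(3) \<open>?k \<noteq> []\<close> by (cases ?k) auto
    have "length ?F = length (g *\<^sub>P ?k)" "lc ?F = lc (g *\<^sub>P ?k)"
      using add_lower[OF _ cl(2) lt] eq gD cl by auto
    then show ?thesis
      using gk FD gD deg lc_mult[OF gD(1) cl(1)] cl(1) lc_closed[OF cl(1)] \<open>?k \<noteq> []\<close> unfolding Mon_def by auto
  qed
  have "qchar (lc (?F -\<^sub>P g *\<^sub>P k')) = qchar (lc (?k -\<^sub>P k'))" if "k' \<in> Mon b - {?k}" for k'
  proof -
    have k': "k' \<in> carrier PR" using that MonD by blast
    let ?w = "?k -\<^sub>P k'"
    have "?w \<in> NZ b" using bij_betwE[OF Mon_diff[OF k]] that by blast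
    then have w: "?w \<in> carrier PR" "?w \<noteq> []" unfolding NZ_def by auto
    have "?F -\<^sub>P g *\<^sub>P k' = g *\<^sub>P ?w +\<^sub>P ?r"
      by (subst eq) (use gD(1) cl(1,2) k' in algebra)
    moreover have "length ?r < length (g *\<^sub>P ?w)"
      using length_mult[OF gD(1) w(1) gD(4) w(2)] cl(3) w(2) by (cases ?w) auto
    ultimately have "lc (?F -\<^sub>P g *\<^sub>P k') = lc (g *\<^sub>P ?w)"
      using add_lower(2)[of "g *\<^sub>P ?w" ?r] gD w cl by simp
    then show ?thesis using lc_mult[OF gD(1) w(1)] gD(3) lc_closed[OF w(1)] by simp
  qed
  then have "(\<Prod>k'\<in>Mon b - {?k}. qchar (lc (?F -\<^sub>P g *\<^sub>P k'))) = (\<Prod>k'\<in>Mon b - {?k}. qchar (lc (?k -\<^sub>P k')))"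
    by (rule prod.cong[OF refl])
  also have "\<dots> = (\<Prod>w\<in>NZ b. qchar (lc w))"
    by (rule prod.reindex_bij_betw[OF Mon_diff[OF k]])
  finally have "(\<Prod>k'\<in>Mon b - {?k}. qchar (lc (?F -\<^sub>P g *\<^sub>P k'))) = sgn1 ^ b"
    using prod_qchar_NZ by simp
  moreover have "?F -\<^sub>P g *\<^sub>P ?k = ?r"
    by (subst (1) eq) (use gD(1) cl(1,2) in algebra)
  ultimately show ?thesis using prod.remove[OF finite_Mon k, of "\<lambda>k. qchar (lc (?F -\<^sub>P g *\<^sub>P k))"] by simp
qed

definition J_part :: "'a list \<Rightarrow> 'a list \<Rightarrow> nat \<Rightarrow> real" where
  "J_part g f a = (\<Prod>h\<in>Mon a. qchar (lc ((f *\<^sub>P h) pmod g)))"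

text \<open>Indexing by the degree d of f h makes the range symmetric in f and g: for d < n the
  product f h is monic and already reduced, so it contributes 1.\<close>

lemma J_eq_prod_parts:
  assumes f: "f \<in> Mon m" and g: "g \<in> Mon n"
  shows "J g f = (\<Prod>d\<in>{max m n..<m + n}. J_part g f (d - m))"
proof -
  have "J g f = (\<Prod>a<n. J_part g f a)"
    unfolding J_def J_part_def MonLt_def using MonD(2)[OF g]
    by (subst prod.UNION_disjoint) (simp_all add: finite_Mon, auto simp: Mon_def)
  also have "\<dots> = (\<Prod>d\<in>{m..<m + n}. J_part g f (d - m))"
    by (rule prod.reindex_bij_witness[of _ "\<lambda>d. d - m" "\<lambda>a. a + m"]) auto
  also have "\<dots> = (\<Prod>d\<in>{max m n..<m + n}. J_part g f (d - m))"
  proof (rule prod.mono_neutral_right)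
    show "\<forall>d\<in>{m..<m + n} - {max m n..<m + n}. J_part g f (d - m) = 1"
    proof
      fix d assume d: "d \<in> {m..<m + n} - {max m n..<m + n}"
      have "(f *\<^sub>P h) pmod g = f *\<^sub>P h \<and> lc (f *\<^sub>P h) = \<one>" if "h \<in> Mon (d - m)" for h
        using MonD[OF Mon_mult[OF f that]] MonD[OF g] pmod_small d by auto
      then show "J_part g f (d - m) = 1" unfolding J_part_def by (intro prod.neutral) auto
    qed
  qed auto
  finally show ?thesis .
qed

text \<open>The double product over h and k is evaluated in both orders. Exchanging f and g negates
  the polynomial in each of the q^(a+b) factors, an odd number of times, which costs one
  \<open>sgn1\<close>.\<close>

lemma J_part_swap:
  assumes f: "f \<in> Mon m" and g: "g \<in> Mon n" and deg: "m + a = n + b"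
  shows "J_part g f a * sgn1 ^ b = J_part f g b * sgn1 ^ a * sgn1"
proof -
  have qpow: "x ^ (card (carrier R) ^ k) = x" if "x = sgn1 ^ j" for x k j
    using that sgn1_pow_odd[of "card (carrier R) ^ k"] odd_card
    by (simp add: power_mult[symmetric] mult.commute[of j] power_mult)
  have side: "(\<Prod>h\<in>Mon a. \<Prod>k\<in>Mon b. qchar (lc (f *\<^sub>P h -\<^sub>P g *\<^sub>P k))) = J_part g f a * sgn1 ^ b"
    if "f \<in> Mon m" "g \<in> Mon n" "m + a = n + b" for f g m n a b
  proof -
    have "(\<Prod>h\<in>Mon a. \<Prod>k\<in>Mon b. qchar (lc (f *\<^sub>P h -\<^sub>P g *\<^sub>P k))) =
        (\<Prod>h\<in>Mon a. qchar (lc ((f *\<^sub>P h) pmod g)) * sgn1 ^ b)"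
      using inner_product[OF that(1,2) _ that(3)] by (intro prod.cong) auto
    also have "\<dots> = J_part g f a * sgn1 ^ b"
      unfolding J_part_def prod.distrib prod_constant card_Mon qpow[OF refl] ..
    finally show ?thesis .
  qed
  have "qchar (lc (f *\<^sub>P h -\<^sub>P g *\<^sub>P k)) = sgn1 * qchar (lc (g *\<^sub>P k -\<^sub>P f *\<^sub>P h))"
    if "h \<in> Mon a" "k \<in> Mon b" for h k
  proof -
    have cl: "f *\<^sub>P h \<in> carrier PR" "g *\<^sub>P k \<in> carrier PR"
      using that f g MonD(1)[OF Mon_mult] by auto
    have "f *\<^sub>P h -\<^sub>P g *\<^sub>P k = -\<^sub>P (g *\<^sub>P k -\<^sub>P f *\<^sub>P h)" using cl by algebra
    then show ?thesis using cl length_lc_minus(2) qchar_minus lc_closed by simp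
  qed
  then have "(\<Prod>h\<in>Mon a. \<Prod>k\<in>Mon b. qchar (lc (f *\<^sub>P h -\<^sub>P g *\<^sub>P k))) =
      (\<Prod>h\<in>Mon a. \<Prod>k\<in>Mon b. sgn1 * qchar (lc (g *\<^sub>P k -\<^sub>P f *\<^sub>P h)))"
    by (intro prod.cong refl) auto
  also have "\<dots> = (sgn1 ^ (card (carrier R) ^ b)) ^ (card (carrier R) ^ a) *
      (\<Prod>h\<in>Mon a. \<Prod>k\<in>Mon b. qchar (lc (g *\<^sub>P k -\<^sub>P f *\<^sub>P h)))"
    unfolding prod.distrib prod_constant card_Mon ..
  also have "(sgn1 ^ (card (carrier R) ^ b)) ^ (card (carrier R) ^ a) = sgn1"
    using qpow[of sgn1 1] by simp
  also have "(\<Prod>h\<in>Mon a. \<Prod>k\<in>Mon b. qchar (lc (g *\<^sub>P k -\<^sub>P f *\<^sub>P h))) =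
      (\<Prod>k\<in>Mon b. \<Prod>h\<in>Mon a. qchar (lc (g *\<^sub>P k -\<^sub>P f *\<^sub>P h)))"
    by (rule prod.swap)
  also have "\<dots> = J_part f g b * sgn1 ^ a" by (rule side[OF g f deg[symmetric]])
  finally show ?thesis using side[OF f g deg] by simp
qed

text \<open>There are min(m, n) degrees d, each costing \<open>sgn1\<close> to the power m + n + 1,
  and (m + n + 1) min(m, n) has the parity of m n.\<close>

theorem J_reciprocity:
  assumes f: "f \<in> Mon m" and g: "g \<in> Mon n"
  shows "J g f = sgn1 ^ (m * n) * J f g"
proof -
  have s: "sgn1 = 1 \<or> sgn1 = -1" using sgn1_sq by (metis mult_minus_left square_eq_1_iff)
  have pow: "sgn1 ^ k = (if even k then 1 else sgn1)" for k using s by auto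
  have part: "J_part g f (d - m) = sgn1 ^ (m + n + 1) * J_part f g (d - n)" if "d \<in> {max m n..<m + n}" for d
  proof -
    define a b where "a = d - m" and "b = d - n"
    then have ab: "d = m + a" "d = n + b" using that by auto
    have "J_part g f a * sgn1 ^ b = J_part f g b * sgn1 ^ a * sgn1" using J_part_swap[OF f g] ab by simp
    then have "J_part g f a * (sgn1 ^ b * sgn1 ^ b) = J_part f g b * sgn1 ^ (a + b + 1)"
      by (simp add: power_add algebra_simps)
    moreover have "sgn1 ^ b * sgn1 ^ b = 1" using s by auto
    \<comment> \<open>Here a + b = 2 d - m - n.\<close>
    moreover have "even (a + b + 1) \<longleftrightarrow> even (m + n + 1)" using ab by presburger
    then have "sgn1 ^ (a + b + 1) = sgn1 ^ (m + n + 1)"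
      using pow[of "a + b + 1"] pow[of "m + n + 1"] by simp
    ultimately have "J_part g f a = sgn1 ^ (m + n + 1) * J_part f g b"
      by (simp only: mult_1_right mult.commute)
    then show ?thesis unfolding a_def b_def .
  qed
  have "J g f = (\<Prod>d\<in>{max m n..<m + n}. sgn1 ^ (m + n + 1) * J_part f g (d - n))"
    unfolding J_eq_prod_parts[OF f g] using part by (rule prod.cong[OF refl])
  also have "\<dots> = (sgn1 ^ (m + n + 1)) ^ (m + n - max m n) * J f g"
    unfolding J_eq_prod_parts[OF g f] by (simp add: prod.distrib max.commute add.commute)
  also have "(sgn1 ^ (m + n + 1)) ^ (m + n - max m n) = sgn1 ^ (m * n)"
  proof -
    have "even ((m + n + 1) * (m + n - max m n)) \<longleftrightarrow> even (m * n)" by (cases "m \<le> n") (auto simp: max_def)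
    then show ?thesis
      unfolding power_mult[symmetric] using pow[of "(m + n + 1) * (m + n - max m n)"] pow[of "m * n"] by simp
  qed
  finally show ?thesis .
qed

text \<open>The product over \<open>MonLt\<close> does not factor along with its modulus;
  reciprocity transfers multiplicativity from the upper argument.\<close>

lemma J_mult_lower:
  assumes "f \<in> Mon m" "g1 \<in> Mon n1" "g2 \<in> Mon n2"
  shows "J (g1 *\<^sub>P g2) f = J g1 f * J g2 f"
proof -
  have "J (g1 *\<^sub>P g2) f = sgn1 ^ (m * (n1 + n2)) * J f (g1 *\<^sub>P g2)"
    using J_reciprocity[OF assms(1) Mon_mult[OF assms(2,3)]] .
  also have "\<dots> = (sgn1 ^ (m * n1) * J f g1) * (sgn1 ^ (m * n2) * J f g2)"
    using J_mult[OF assms(1)] MonD(1) assms by (simp add: power_add algebra_simps)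
  finally show ?thesis using J_reciprocity[OF assms(1,2)] J_reciprocity[OF assms(1,3)] by simp
qed

end

section \<open>Residue fields and Gauss' lemma\<close>

context finite_field_odd
begin

lemma monic_irreducible:
  assumes "E \<in> Mon n" "pirreducible (carrier R) E"
  shows irreducible_prime: "\<lbrakk>a \<in> carrier PR; b \<in> carrier PR; E pdivides (a *\<^sub>P b)\<rbrakk> \<Longrightarrow> E pdivides a \<or> E pdivides b"
    and irreducible_degree_pos: "0 < n"
proof -
  have "pprime (carrier R) E" using assms MonD pprime_iff_pirreducible[OF carrier_is_subfield] by blast
  then show "\<lbrakk>a \<in> carrier PR; b \<in> carrier PR; E pdivides (a *\<^sub>P b)\<rbrakk> \<Longrightarrow> E pdivides a \<or> E pdivides b"
    using pprimeE(3)[OF carrier_is_subfield MonD(1)[OF assms(1)]] by blast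
  show "0 < n" using pirreducible_degree[OF carrier_is_subfield MonD(1)[OF assms(1)] assms(2)] MonD(2)[OF assms(1)] by simp
qed

lemma one_in_MonLt: "0 < n \<Longrightarrow> 1\<^sub>P \<in> MonLt n"
  using P.one_closed unfolding MonLt_iff one_PR by (simp add: lc_const)

lemma not_pdivides_small:
  assumes "E \<in> Mon n" "h \<in> carrier PR" "h \<noteq> []" "length h \<le> n"
  shows "\<not> E pdivides h"
  using pmod_small[of h E] pmod_Nil_iff[of h E] MonD[OF assms(1)] assms by auto

text \<open>If E divides f, the factor at h = 1 already vanishes. Conversely, primality moves E from
  f h to f, because h is nonzero of smaller degree.\<close>

lemma J_irreducible_eq_0_iff:
  assumes "E \<in> Mon n" "pirreducible (carrier R) E" "f \<in> carrier PR"
  shows "J E f = 0 \<longleftrightarrow> E pdivides f"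
proof
  assume "J E f = 0"
  then obtain h where h: "h \<in> MonLt n" "E pdivides (f *\<^sub>P h)" using J_eq_0_iff[OF assms(1,3)] by blast
  then have "h \<in> carrier PR" "h \<noteq> []" "length h \<le> n" using one_not_zero by (auto simp: MonLt_iff lc_def)
  then show "E pdivides f"
    using irreducible_prime[OF assms(1,2,3) _ h(2)] not_pdivides_small[OF assms(1)] by blast
next
  assume "E pdivides f"
  moreover have "1\<^sub>P \<in> MonLt n"
    using irreducible_degree_pos[OF assms(1,2)] by (rule one_in_MonLt)
  moreover have "f *\<^sub>P 1\<^sub>P = f" using assms(3) by simp
  ultimately show "J E f = 0" using J_eq_0_iff[OF assms(1,3)] by metis
qed

lemma res_hom: "E \<in> carrier PR \<Longrightarrow> ring_hom_ring PR (res_field R E) (res_map R E)"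
  using rupture_surj_hom(2)[OF carrier_is_subring] unfolding res_map_def .

lemma res_surj:
  assumes "E \<in> carrier PR" "x \<in> carrier (res_field R E)"
  obtains f where "f \<in> carrier PR" "x = res_map R E f"
  using assms unfolding res_map_def rupture_def FactRing_def A_RCOSETS_def' by auto

lemma res_eq_iff:
  assumes "E \<in> carrier PR" "f \<in> carrier PR" "g \<in> carrier PR"
  shows "res_map R E f = res_map R E g \<longleftrightarrow> E pdivides (f -\<^sub>P g)"
proof -
  interpret I: ideal "PIdl\<^bsub>PR\<^esub> E" PR using P.cgenideal_ideal assms(1) by simp
  have "res_map R E f = res_map R E g \<longleftrightarrow> f -\<^sub>P g \<in> PIdl\<^bsub>PR\<^esub> E"
    unfolding res_map_def using P.quotient_eq_iff_same_a_r_cos[OF I.ideal_axioms assms(2,3)] by simp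
  also have "\<dots> \<longleftrightarrow> E pdivides (f -\<^sub>P g)"
    using assms unfolding cgenideal_def pdivides_def factor_def by (auto simp: P.m_comm)
  finally show ?thesis .
qed

lemma res_eq_0_iff:
  assumes "E \<in> carrier PR" "f \<in> carrier PR"
  shows "res_map R E f = \<zero>\<^bsub>res_field R E\<^esub> \<longleftrightarrow> E pdivides f"
proof -
  interpret h: ring_hom_ring PR "res_field R E" "res_map R E" using res_hom assms by simp
  show ?thesis using res_eq_iff[OF assms P.zero_closed] assms by (simp add: a_minus_def)
qed

lemma res_pmod:
  assumes "E \<in> carrier PR" "f \<in> carrier PR" "E \<noteq> []"
  shows "res_map R E (f pmod E) = res_map R E f"
  using res_eq_iff[of E "f pmod E" f] pmod_eq_iff[of "f pmod E" f E] pmod_closed pmod_pmod assms by simp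

lemma res_field:
  assumes "E \<in> Mon n" "pirreducible (carrier R) E"
  shows "field (res_field R E)" "finite (carrier (res_field R E))"
proof -
  have E: "E \<in> carrier PR" "E \<noteq> []" "length E = Suc n" using MonD[OF assms(1)] by auto
  show "field (res_field R E)" using rupture_is_field_iff_pirreducible[OF carrier_is_subfield E(1)] assms by simp
  have "carrier (res_field R E) \<subseteq> res_map R E ` insert [] (NZ n)"
  proof
    fix x assume "x \<in> carrier (res_field R E)"
    then obtain f where f: "f \<in> carrier PR" "x = res_map R E f" using res_surj E by blast
    then have "x = res_map R E (f pmod E)" using res_pmod E by simp
    moreover have "f pmod E \<in> insert [] (NZ n)"
      using length_pmod[of f E] pmod_closed f E unfolding NZ_def by auto
    ultimately show "x \<in> res_map R E ` insert [] (NZ n)" by blast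
  qed
  then show "finite (carrier (res_field R E))" by (rule finite_subset) (simp add: prod_qchar_NZ)
qed

lemma poly_of_const_eq: "poly_of_const c = (if c = \<zero> then [] else [c])"
  unfolding poly_of_const_def by simp

lemma res_const_hom: "E \<in> carrier PR \<Longrightarrow> ring_hom_ring R (res_field R E) (res_const R E)"
proof -
  assume E: "E \<in> carrier PR"
  have "res_const R E \<in> ring_hom R (res_field R E)"
    using rupture_surj_norm_is_hom[OF carrier_is_subring E]
    by (simp add: res_const_def[abs_def] res_map_def o_def ring_hom_def)
  then show ?thesis
    using ring_hom_ring.axioms(2)[OF res_hom[OF E]] by (intro ring_hom_ringI2 ring_axioms)
qed

lemma qchar_finprod:
  assumes "finite A" "F \<in> A \<rightarrow> carrier R"
  shows "qchar (finprod R F A) = (\<Prod>x\<in>A. qchar (F x))"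
  using assms
proof (induction A rule: finite_induct)
  case (insert x A)
  then show ?case using qchar_mult[of "F x" "finprod R F A"] by (simp add: Pi_def)
qed simp

end

lemma (in field) finprod_nonzero:
  assumes "finite A" "\<And>x. x \<in> A \<Longrightarrow> F x \<in> carrier R - {\<zero>}"
  shows "finprod R F A \<in> carrier R - {\<zero>}"
  using assms
proof (induction A rule: finite_induct)
  case (insert x A)
  then have "F \<in> A \<rightarrow> carrier R" "F x \<in> carrier R" by auto
  then show ?case using insert integral[of "F x" "finprod R F A"] by auto
qed simp

lemma (in field) finite_field_pow_card:
  assumes "finite (carrier R)" "x \<in> carrier R - {\<zero>}"
  shows "x [^] card (carrier R - {\<zero>}) = \<one>"
proof -
  interpret G: group "Multiplicative_Group.mult_of R" by (rule field_mult_group)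
  have "x [^]\<^bsub>Multiplicative_Group.mult_of R\<^esub> order (Multiplicative_Group.mult_of R) = \<one>\<^bsub>Multiplicative_Group.mult_of R\<^esub>"
    using assms G.pow_order_eq_1[of x] by simp
  then show ?thesis by (simp add: order_def Multiplicative_Group.nat_pow_mult_of)
qed

section \<open>The symbol as a character of the norm, nonresidues and character sums\<close>

context finite_field_odd
begin

text \<open>In the residue field, multiplying f h = c_h \<open>\<tau> h\<close> over all h cancels
  the product of the h. As the exponent is 1 + q + ... + q^(n-1), \<open>C\<close> is the norm of f
  to the base field.\<close>

lemma gauss_lemma:
  assumes E: "E \<in> Mon n" "pirreducible (carrier R) E" and f: "f \<in> carrier PR" "\<not> E pdivides f"
  obtains C where "C \<in> U" "J E f = qchar C"
    "res_map R E f [^]\<^bsub>res_field R E\<^esub> card (MonLt n) = res_const R E C"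
proof -
  let ?K = "res_field R E" and ?\<rho> = "res_map R E"
  note ED = MonD[OF E(1)]
  interpret K: field ?K using res_field E by blast
  interpret \<rho>: ring_hom_ring PR ?K ?\<rho> using res_hom ED by simp
  interpret \<iota>: ring_hom_cring R ?K "res_const R E"
    using res_const_hom ED by (simp add: ring_hom_cring_def ring_hom_ring_def ring_hom_cring_axioms_def
        ring_hom_ring_axioms_def is_cring K.is_cring)
  have "J E f \<noteq> 0" using J_irreducible_eq_0_iff[OF E f(1)] f(2) by simp
  then obtain \<tau> where \<tau>: "bij_betw \<tau> (MonLt n) (MonLt n)"
    "\<And>h. h \<in> MonLt n \<Longrightarrow> lc ((f *\<^sub>P h) pmod E) \<in> U
      \<and> (f *\<^sub>P h) pmod E = [lc ((f *\<^sub>P h) pmod E)] *\<^sub>P \<tau> h"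
    using monic_residue_bij[OF E(1) f(1)] by blast
  define c where "c h = lc ((f *\<^sub>P h) pmod E)" for h
  have c: "c h \<in> U" if "h \<in> MonLt n" for h using \<tau>(2)[OF that] unfolding c_def by blast
  have Mc: "h \<in> carrier PR" if "h \<in> MonLt n" for h using that MonLt_iff by simp
  have \<tau>M: "\<tau> h \<in> MonLt n" if "h \<in> MonLt n" for h using \<tau>(1) that bij_betwE by blast
  define C where "C = finprod R c (MonLt n)"
  have CU: "C \<in> U" unfolding C_def using finprod_nonzero[OF finite_MonLt] c by blast
  have "J E f = qchar C"
    unfolding C_def J_def using qchar_finprod[OF finite_MonLt, of c n] c ED(2) by (auto simp: c_def)
  have step: "?\<rho> f \<otimes>\<^bsub>?K\<^esub> ?\<rho> h = res_const R E (c h) \<otimes>\<^bsub>?K\<^esub> ?\<rho> (\<tau> h)" if h: "h \<in> MonLt n" for h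
  proof -
    have cc: "[c h] \<in> carrier PR" using c h const_PR by simp
    have "?\<rho> f \<otimes>\<^bsub>?K\<^esub> ?\<rho> h = ?\<rho> ((f *\<^sub>P h) pmod E)" using res_pmod ED f Mc h by simp
    also have "(f *\<^sub>P h) pmod E = [c h] *\<^sub>P \<tau> h" using \<tau>(2)[OF h] unfolding c_def by blast
    also have "?\<rho> \<dots> = ?\<rho> [c h] \<otimes>\<^bsub>?K\<^esub> ?\<rho> (\<tau> h)" using cc \<tau>M Mc h by simp
    finally show ?thesis using c[OF h] by (simp add: res_const_def poly_of_const_eq)
  qed
  define W where "W = finprod ?K ?\<rho> (MonLt n)"
  have \<rho>nz: "?\<rho> h \<in> carrier ?K - {\<zero>\<^bsub>?K\<^esub>}" if h: "h \<in> MonLt n" for h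
  proof -
    have "h \<noteq> []" "length h \<le> n" using h one_not_zero by (auto simp: MonLt_iff lc_def)
    then show ?thesis using not_pdivides_small[OF E(1)] res_eq_0_iff ED Mc[OF h] by simp
  qed
  have W: "W \<in> carrier ?K - {\<zero>\<^bsub>?K\<^esub>}"
    unfolding W_def using K.finprod_nonzero[OF finite_MonLt] \<rho>nz by blast
  have "(?\<rho> f [^]\<^bsub>?K\<^esub> card (MonLt n)) \<otimes>\<^bsub>?K\<^esub> W = finprod ?K (\<lambda>h. ?\<rho> f \<otimes>\<^bsub>?K\<^esub> ?\<rho> h) (MonLt n)"
    unfolding W_def using f(1) Mc by (simp add: K.finprod_const Pi_def)
  also have "\<dots> = finprod ?K (\<lambda>h. res_const R E (c h) \<otimes>\<^bsub>?K\<^esub> ?\<rho> (\<tau> h)) (MonLt n)"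
    using step c Mc \<tau>M by (intro K.finprod_cong') auto
  also have "\<dots> = finprod ?K (\<lambda>h. res_const R E (c h)) (MonLt n) \<otimes>\<^bsub>?K\<^esub> finprod ?K (\<lambda>h. ?\<rho> (\<tau> h)) (MonLt n)"
    using c Mc \<tau>M by (intro K.finprod_multf) auto
  also have "finprod ?K (\<lambda>h. res_const R E (c h)) (MonLt n) = res_const R E C"
    unfolding C_def using c by (subst \<iota>.hom_finprod) (auto simp: o_def)
  also have "finprod ?K (\<lambda>h. ?\<rho> (\<tau> h)) (MonLt n) = W"
    unfolding W_def using \<tau>(1) Mc K.finprod_reindex[of ?\<rho> \<tau> "MonLt n"]
    by (auto simp: bij_betw_def)
  finally have "?\<rho> f [^]\<^bsub>?K\<^esub> card (MonLt n) = res_const R E C"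
    using K.m_rcancel[of W] W f(1) CU by auto
  then show thesis using that CU \<open>J E f = qchar C\<close> by blast
qed

text \<open>The multiples [c] h have degree below n, so they stay distinct and nonzero modulo
  E.\<close>

lemma card_res_field_ge:
  assumes E: "E \<in> Mon n" "pirreducible (carrier R) E"
  shows "card (MonLt n) * card U \<le> card (carrier (res_field R E) - {\<zero>\<^bsub>res_field R E\<^esub>})"
proof -
  let ?\<phi> = "\<lambda>(h, c). res_map R E ([c] *\<^sub>P h)"
  note ED = MonD[OF E(1)]
  have ch: "[c] *\<^sub>P h \<in> carrier PR \<and> length ([c] *\<^sub>P h) \<le> n \<and> [c] *\<^sub>P h \<noteq> [] \<and> lc ([c] *\<^sub>P h) = c"
    if "c \<in> U" "h \<in> MonLt n" for c h
  proof -
    have h: "h \<in> carrier PR" "lc h = \<one>" "length h \<le> n" "h \<noteq> []"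
      using that(2) one_not_zero by (auto simp: MonLt_iff lc_def)
    then show ?thesis
      using length_smult[OF that(1) h(1)] lc_mult[OF const_PR[OF that(1)] h(1)] const_PR[OF that(1)] that(1)
      by (auto simp: lc_const)
  qed
  interpret \<rho>: ring_hom_ring PR "res_field R E" "res_map R E" using res_hom ED by simp
  have "inj_on ?\<phi> (MonLt n \<times> U)"
  proof (rule inj_onI)
    fix v w assume vw: "v \<in> MonLt n \<times> U" "w \<in> MonLt n \<times> U" "?\<phi> v = ?\<phi> w"
    obtain h c k d where hcd: "v = (h, c)" "w = (k, d)" by (metis surj_pair)
    have h: "h \<in> MonLt n" "k \<in> MonLt n" and cd: "c \<in> U" "d \<in> U"
      and eq: "res_map R E ([c] *\<^sub>P h) = res_map R E ([d] *\<^sub>P k)"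
      using vw hcd by auto
    note x = ch[OF cd(1) h(1)] and y = ch[OF cd(2) h(2)]
    have "([c] *\<^sub>P h) pmod E = ([d] *\<^sub>P k) pmod E"
      using eq res_eq_iff pmod_eq_iff ED x y by simp
    then have eq': "[c] *\<^sub>P h = [d] *\<^sub>P k"
      using pmod_small[of "[c] *\<^sub>P h" E] pmod_small[of "[d] *\<^sub>P k" E] x y ED by simp
    then have "c = d" using x y by metis
    moreover have "h = k"
      using eq' \<open>c = d\<close> P.m_lcancel[of "[d]" h k] const_PR[OF cd(2)] h zero_PR by (auto simp: MonLt_iff)
    ultimately show "v = w" using hcd by simp
  qed
  moreover have "?\<phi> ` (MonLt n \<times> U) \<subseteq> carrier (res_field R E) - {\<zero>\<^bsub>res_field R E\<^esub>}"
  proof (rule image_subsetI)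
    fix y assume "y \<in> MonLt n \<times> U"
    then obtain h c where y: "y = (h, c)" "h \<in> MonLt n" "c \<in> U" by blast
    then have x: "[c] *\<^sub>P h \<in> carrier PR" "length ([c] *\<^sub>P h) \<le> n" "[c] *\<^sub>P h \<noteq> []" using ch by auto
    then show "?\<phi> y \<in> carrier (res_field R E) - {\<zero>\<^bsub>res_field R E\<^esub>}"
      using res_eq_0_iff[OF ED(1) x(1)] not_pdivides_small[OF E(1) x(1,3,2)] \<rho>.hom_closed[OF x(1)] y(1) by simp
  qed
  ultimately have "card (MonLt n \<times> U) \<le> card (carrier (res_field R E) - {\<zero>\<^bsub>res_field R E\<^esub>})"
    using res_field(2)[OF E] by (intro card_inj_on_le) auto
  then show ?thesis by (simp add: card_cartesian_product)
qed

text \<open>A generator a of the unit group is a nonresidue. Otherwise its norm \<open>C\<close>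
  would be some y^2, and the power \<open>card Sq\<close> = (q-1)/2 of it would give a^N = y^(q-1) =
  1 with N at most half the order of the group.\<close>

lemma J_nontrivial:
  assumes E: "E \<in> Mon n" "pirreducible (carrier R) E"
  shows "\<exists>f\<in>carrier PR. J E f = -1"
proof -
  let ?K = "res_field R E" and ?\<rho> = "res_map R E"
  note ED = MonD[OF E(1)]
  interpret K: field ?K using res_field E by blast
  interpret \<rho>: ring_hom_ring PR ?K ?\<rho> using res_hom ED by simp
  interpret \<iota>: ring_hom_ring R ?K "res_const R E" using res_const_hom ED by simp
  obtain a where a: "a \<in> carrier (Multiplicative_Group.mult_of ?K)" "carrier (Multiplicative_Group.mult_of ?K) = {a [^]\<^bsub>?K\<^esub> i | i::nat. i \<in> UNIV}"
    using K.finite_field_mult_group_has_gen[OF res_field(2)[OF E]] by blast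
  obtain f where f: "f \<in> carrier PR" "a = ?\<rho> f" using res_surj[OF ED(1), of a] a(1) by auto
  have "\<not> E pdivides f" using a(1) f res_eq_0_iff ED by simp
  then obtain C where C: "C \<in> U" "J E f = qchar C" "a [^]\<^bsub>?K\<^esub> card (MonLt n) = res_const R E C"
    using gauss_lemma[OF E f(1)] f(2) by metis
  have "J E f \<noteq> 1"
  proof
    assume "J E f = 1"
    then have "C \<in> Sq" using C(2) qchar_alt[OF C(1)] by (simp split: if_splits)
    then obtain y where y: "y \<in> U" "C = y \<otimes> y" unfolding Sq_def by blast
    define N where "N = card (MonLt n) * card Sq"
    have "0 < card U" using finite_U C(1) by (simp only: card_gt_0_iff) blast
    then have Sq0: "0 < card Sq" using card_U by simp
    have "1\<^sub>P \<in> MonLt n"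
      using irreducible_degree_pos[OF E] by (rule one_in_MonLt)
    then have "0 < card (MonLt n)" using finite_MonLt by (simp only: card_gt_0_iff) blast
    then have N0: "0 < N" using Sq0 unfolding N_def by simp
    have "2 * N \<le> card (carrier ?K - {\<zero>\<^bsub>?K\<^esub>})"
      using card_res_field_ge[OF E] unfolding N_def card_U by (simp only: mult.left_commute)
    then have N: "0 < N" "N < card (carrier ?K - {\<zero>\<^bsub>?K\<^esub>})" using N0 by linarith+
    have "a [^]\<^bsub>?K\<^esub> N = res_const R E C [^]\<^bsub>?K\<^esub> card Sq"
      unfolding N_def using C(3) a(1) K.nat_pow_pow[of a "card (MonLt n)" "card Sq"] by simp
    also have "\<dots> = res_const R E (C [^] card Sq)" using C(1) by (simp add: \<iota>.hom_nat_pow)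
    also have "C [^] card Sq = y [^] card U"
      using y nat_pow_pow[of y 2 "card Sq"] card_U by (simp add: numeral_2_eq_2)
    also have "y [^] card U = \<one>" by (rule finite_field_pow_card[OF finite_carrier y(1)])
    finally have aN: "a [^]\<^bsub>?K\<^esub> N = \<one>\<^bsub>?K\<^esub>" by simp
    have "carrier ?K - {\<zero>\<^bsub>?K\<^esub>} \<subseteq> (\<lambda>i. a [^]\<^bsub>?K\<^esub> i) ` {..<N}"
    proof
      fix x assume "x \<in> carrier ?K - {\<zero>\<^bsub>?K\<^esub>}"
      then obtain i :: nat where i: "x = a [^]\<^bsub>?K\<^esub> i" using a(2) by auto
      have "a [^]\<^bsub>?K\<^esub> i = a [^]\<^bsub>?K\<^esub> (N * (i div N) + i mod N)" by simp
      also have "\<dots> = (a [^]\<^bsub>?K\<^esub> N) [^]\<^bsub>?K\<^esub> (i div N) \<otimes>\<^bsub>?K\<^esub> a [^]\<^bsub>?K\<^esub> (i mod N)"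
        using a(1) K.nat_pow_mult[of a "N * (i div N)" "i mod N"] K.nat_pow_pow[of a N "i div N"] by simp
      also have "\<dots> = a [^]\<^bsub>?K\<^esub> (i mod N)" using aN a(1) by simp
      finally show "x \<in> (\<lambda>i. a [^]\<^bsub>?K\<^esub> i) ` {..<N}" using i N(1) by simp
    qed
    then have "card (carrier ?K - {\<zero>\<^bsub>?K\<^esub>}) \<le> card ((\<lambda>i. a [^]\<^bsub>?K\<^esub> i) ` {..<N})"
      by (intro card_mono) auto
    also have "\<dots> \<le> N" using card_image_le[of "{..<N}" "\<lambda>i. a [^]\<^bsub>?K\<^esub> i"] by simp
    finally show False using N(2) by simp
  qed
  moreover have "J E f \<noteq> 0" using C qchar_eq_0_iff by simp
  ultimately have "J E f = -1" using J_values[of E f] by simp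
  then show ?thesis using f(1) by blast
qed

lemma Mon_var_pow: "X ^\<^sub>P k \<in> Mon k"
proof (induction k)
  case 0 show ?case using P.one_closed unfolding Mon_def by (simp add: one_PR lc_const)
next
  case (Suc k)
  have "X \<in> Mon 1" using var_closed(1)[OF carrier_is_subring] unfolding Mon_def by (simp add: var_def lc_def)
  then show ?case using Mon_mult[OF Suc, of X 1] by simp
qed

text \<open>Chinese remaindering: 1 + B x is 1 modulo B, and B is invertible modulo E, so x can be
  chosen to make it a nonresidue modulo E.\<close>

lemma J_nontrivial_mult:
  assumes E: "E \<in> Mon n" "pirreducible (carrier R) E" and B: "B \<in> Mon b" "\<not> E pdivides B"
  shows "\<exists>m. \<exists>f\<in>Mon m. J (E *\<^sub>P B) f = -1"
proof -
  obtain g where g: "g \<in> carrier PR" "J E g = -1" using J_nontrivial[OF E] by blast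
  let ?K = "res_field R E" and ?\<rho> = "res_map R E"
  note ED = MonD[OF E(1)] and BD = MonD[OF B(1)]
  interpret K: field ?K using res_field E by blast
  interpret \<rho>: ring_hom_ring PR ?K ?\<rho> using res_hom ED by simp
  have "?\<rho> B \<noteq> \<zero>\<^bsub>?K\<^esub>" using B res_eq_0_iff ED BD by simp
  then have BU: "?\<rho> B \<in> Units ?K" using K.field_Units BD by simp
  obtain x where x: "x \<in> carrier PR" "inv\<^bsub>?K\<^esub> (?\<rho> B) \<otimes>\<^bsub>?K\<^esub> (?\<rho> g \<ominus>\<^bsub>?K\<^esub> \<one>\<^bsub>?K\<^esub>) = ?\<rho> x"
    using res_surj[OF ED(1), of "inv\<^bsub>?K\<^esub> (?\<rho> B) \<otimes>\<^bsub>?K\<^esub> (?\<rho> g \<ominus>\<^bsub>?K\<^esub> \<one>\<^bsub>?K\<^esub>)"] BU g by auto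
  let ?f = "1\<^sub>P +\<^sub>P B *\<^sub>P x"
  have f: "?f \<in> carrier PR" using BD x by simp
  have "?\<rho> B \<otimes>\<^bsub>?K\<^esub> ?\<rho> x = ?\<rho> g \<ominus>\<^bsub>?K\<^esub> \<one>\<^bsub>?K\<^esub>"
    using BU g x(2)[symmetric] K.Units_r_inv[OF BU] K.Units_inv_closed[OF BU] BD
    by (simp add: K.m_assoc[symmetric])
  then have "?\<rho> ?f = \<one>\<^bsub>?K\<^esub> \<oplus>\<^bsub>?K\<^esub> (?\<rho> g \<ominus>\<^bsub>?K\<^esub> \<one>\<^bsub>?K\<^esub>)" using BD x by simp
  also have "\<dots> = ?\<rho> g" using \<rho>.hom_closed[OF g(1)] K.one_closed by algebra
  finally have fg: "?\<rho> ?f = ?\<rho> g" .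
  define k where "k = length ?f"
  define m where "m = n + b + k"
  \<comment> \<open>A monic multiple of E B of degree above that of \<open>?f\<close>: adding it
    makes the representative monic and changes nothing modulo E or B.\<close>
  let ?D = "E *\<^sub>P B *\<^sub>P X ^\<^sub>P k"
  have D: "?D \<in> Mon m" using Mon_mult[OF Mon_mult[OF E(1) B(1)] Mon_var_pow] unfolding m_def .
  note DD = MonD[OF D]
  let ?F = "?D +\<^sub>P ?f"
  have F: "?F \<in> Mon m"
    using add_lower[OF DD(1) f] DD f unfolding Mon_def m_def k_def by simp
  have Xk: "X ^\<^sub>P k \<in> carrier PR" using MonD(1)[OF Mon_var_pow] .
  have "?F -\<^sub>P ?f = ?D" using DD(1) f by algebra
  then have dvd: "E pdivides (?F -\<^sub>P ?f)"
    using ED BD Xk by (intro pdividesI[of "B *\<^sub>P X ^\<^sub>P k"]) (auto simp: P.m_assoc)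
  have "J E ?F = J E ?f"
    using J_cong[OF E(1), of ?F ?f] pmod_eq_iff[of ?F ?f E] dvd f MonD(1)[OF F] ED by simp
  also have "\<dots> = J E g"
    using J_cong[OF E(1), of ?f g] pmod_eq_iff[of ?f g E] res_eq_iff[of E ?f g] fg f g ED by simp
  finally have 1: "J E ?F = -1" using g by simp
  have "?F -\<^sub>P 1\<^sub>P = B *\<^sub>P (E *\<^sub>P X ^\<^sub>P k +\<^sub>P x)"
    using ED(1) BD(1) Xk x(1) P.one_closed by algebra
  then have "B pdivides (?F -\<^sub>P 1\<^sub>P)" using pdividesI ED BD Xk x by auto
  then have "J B ?F = J B 1\<^sub>P"
    using J_cong[OF B(1), of ?F "1\<^sub>P"] pmod_eq_iff[of ?F "1\<^sub>P" B] MonD(1)[OF F] BD by simp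
  then have 2: "J B ?F = 1" using J_one[OF B(1)] by simp
  show ?thesis using J_mult_lower[OF F E(1) B(1)] 1 2 F by auto
qed

text \<open>Since \<open>J D f\<close> depends only on \<open>f\<close> modulo \<open>D\<close>, the monic polynomials of degree \<open>n\<close> are
  permuted by keeping the quotient by \<open>D\<close> and multiplying the remainder by \<open>f\<close>.\<close>

lemma sum_J_eq_0:
  assumes D: "D \<in> Mon d" and f: "f \<in> carrier PR" "J D f = -1" and n: "d \<le> n"
  shows "(\<Sum>g\<in>Mon n. J D g) = 0"
proof -
  note DD = MonD[OF D]
  define \<phi> where "\<phi> g = D *\<^sub>P (g pdiv D) +\<^sub>P ((g *\<^sub>P f) pmod D)" for g
  have \<phi>: "\<phi> g \<in> Mon n" "\<phi> g pdiv D = g pdiv D" "\<phi> g pmod D = (g *\<^sub>P f) pmod D" "J D (\<phi> g) = - J D g"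
    if g: "g \<in> Mon n" for g
  proof -
    note gD = MonD[OF g]
    let ?k = "g pdiv D" and ?r = "g pmod D" and ?s = "(g *\<^sub>P f) pmod D"
    have cl: "?k \<in> carrier PR" "?r \<in> carrier PR" "?s \<in> carrier PR" "length ?r < length D" "length ?s < length D"
      using pdiv_closed pmod_closed length_pmod[of g D] length_pmod[of "g *\<^sub>P f" D] gD DD f by auto
    have eq: "g = D *\<^sub>P ?k +\<^sub>P ?r" using pdiv_pmod_eq gD DD by simp
    \<comment> \<open>This is where n >= d enters: with a nonzero quotient, degree and leading
      coefficient do not depend on the remainder.\<close>
    have "?k \<noteq> []"
    proof
      assume "?k = []"
      then have "g = ?r" using eq DD cl zero_PR by (metis P.l_zero P.r_null)
      then show False using cl(4) gD(2) DD(2) n by simp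
    qed
    then have len: "length D \<le> length (D *\<^sub>P ?k)" using length_mult(1)[OF DD(1) cl(1) DD(4)] by (cases ?k) auto
    have Dk: "D *\<^sub>P ?k \<in> carrier PR" using DD cl by simp
    show "\<phi> g \<in> Mon n"
      using add_lower[OF Dk cl(2)] add_lower[OF Dk cl(3)] cl len gD eq Dk unfolding Mon_def \<phi>_def by auto
    show "\<phi> g pdiv D = ?k" "\<phi> g pmod D = ?s"
      using pdiv_pmod_unique[OF DD(1) cl(1,3,5) \<phi>_def] by auto
    have "\<phi> g \<in> carrier PR" using Dk cl unfolding \<phi>_def by simp
    then have "J D (\<phi> g) = J D (g *\<^sub>P f)"
      using J_cong[OF D, of "\<phi> g" "g *\<^sub>P f"] \<open>\<phi> g pmod D = ?s\<close> gD f by simp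
    then show "J D (\<phi> g) = - J D g" using J_mult[OF D] gD f by simp
  qed
  have "inj_on \<phi> (Mon n)"
  proof (rule inj_onI)
    fix g h assume g: "g \<in> Mon n" and h: "h \<in> Mon n" and "\<phi> g = \<phi> h"
    note gD = MonD[OF g] and hD = MonD[OF h]
    have q: "g pdiv D = h pdiv D" and r: "(g *\<^sub>P f) pmod D = (h *\<^sub>P f) pmod D"
      using \<phi>[OF g] \<phi>[OF h] \<open>\<phi> g = \<phi> h\<close> by metis+
    have "D pdivides (g *\<^sub>P f -\<^sub>P h *\<^sub>P f)" using r pmod_eq_iff gD hD DD f by simp
    moreover have "g *\<^sub>P f -\<^sub>P h *\<^sub>P f = f *\<^sub>P (g -\<^sub>P h)" using gD(1) hD(1) f(1) by algebra
    ultimately have "D pdivides (g -\<^sub>P h)" using cancel_mod[OF D f(1)] f(2) gD hD by simp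
    then have "g pmod D = h pmod D" using pmod_eq_iff gD hD DD by simp
    then show "g = h" using pdiv_pmod_eq[of g D] pdiv_pmod_eq[of h D] q gD hD DD by simp
  qed
  then have bij: "bij_betw \<phi> (Mon n) (Mon n)"
    unfolding bij_betw_def using \<phi>(1) finite_Mon by (simp add: endo_inj_surj image_subsetI)
  have "(\<Sum>g\<in>Mon n. J D g) = (\<Sum>g\<in>Mon n. J D (\<phi> g))"
    by (rule sum.reindex_bij_betw[OF bij, symmetric])
  also have "\<dots> = - (\<Sum>g\<in>Mon n. J D g)" using \<phi>(4) by (simp add: sum_negf)
  finally show ?thesis by simp
qed

end

section \<open>The Frobenius map and irreducible quartics\<close>

lemma (in cring) binomial:
  assumes x: "x \<in> carrier R" "y \<in> carrier R"
  shows "(x \<oplus> y) [^] n = (\<Oplus>k\<in>{..n}. [(n choose k)] \<cdot>\<^bsub>R\<^esub> (x [^] k \<otimes> y [^] (n - k)))"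
proof (induction n)
  case 0 then show ?case using x by simp
next
  case (Suc n)
  let ?t = "\<lambda>n k. [(n choose k)] \<cdot>\<^bsub>R\<^esub> (x [^] k \<otimes> y [^] (n - k))"
  have A: "x \<otimes> (\<Oplus>k\<in>{..n}. ?t n k) = (\<Oplus>k\<in>{..n}. [(n choose k)] \<cdot>\<^bsub>R\<^esub> (x [^] Suc k \<otimes> y [^] (n - k)))"
    using x by (subst finsum_rdistr) (auto simp: add_pow_rdistr m_ac intro!: finsum_cong')
  have "y \<otimes> (\<Oplus>k\<in>{..n}. ?t n k) = (\<Oplus>k\<in>{..n}. [(n choose k)] \<cdot>\<^bsub>R\<^esub> (x [^] k \<otimes> y [^] (Suc n - k)))"
    using x by (subst finsum_rdistr) (auto simp: add_pow_rdistr m_ac Suc_diff_le intro!: finsum_cong')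
  also have "\<dots> = (\<Oplus>k\<in>{..Suc n}. [(n choose k)] \<cdot>\<^bsub>R\<^esub> (x [^] k \<otimes> y [^] (Suc n - k)))"
    using x by (subst finsum_Suc) (auto simp: binomial_eq_0)
  also have "\<dots> = (\<Oplus>k\<in>{..n}. [(n choose Suc k)] \<cdot>\<^bsub>R\<^esub> (x [^] Suc k \<otimes> y [^] (n - k))) \<oplus> y [^] Suc n"
    using x by (subst finsum_Suc2) auto
  finally have B: "y \<otimes> (\<Oplus>k\<in>{..n}. ?t n k) =
      (\<Oplus>k\<in>{..n}. [(n choose Suc k)] \<cdot>\<^bsub>R\<^esub> (x [^] Suc k \<otimes> y [^] (n - k))) \<oplus> y [^] Suc n" .
  have "(x \<oplus> y) [^] Suc n = x \<otimes> (\<Oplus>k\<in>{..n}. ?t n k) \<oplus> y \<otimes> (\<Oplus>k\<in>{..n}. ?t n k)"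
  proof -
    have "(\<Oplus>k\<in>{..n}. ?t n k) \<in> carrier R" using x by (intro finsum_closed) auto
    then show ?thesis using x Suc by (simp add: l_distr m_comm)
  qed
  also have "\<dots> = (\<Oplus>k\<in>{..n}. [(n choose k)] \<cdot>\<^bsub>R\<^esub> (x [^] Suc k \<otimes> y [^] (n - k))) \<oplus>
      ((\<Oplus>k\<in>{..n}. [(n choose Suc k)] \<cdot>\<^bsub>R\<^esub> (x [^] Suc k \<otimes> y [^] (n - k))) \<oplus> y [^] Suc n)"
    unfolding A B ..
  also have "\<dots> = (\<Oplus>k\<in>{..n}. [(n choose k)] \<cdot>\<^bsub>R\<^esub> (x [^] Suc k \<otimes> y [^] (n - k)) \<oplus>
      [(n choose Suc k)] \<cdot>\<^bsub>R\<^esub> (x [^] Suc k \<otimes> y [^] (n - k))) \<oplus> y [^] Suc n"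
    using x by (simp add: finsum_addf a_assoc del: nat_pow_Suc)
  also have "\<dots> = (\<Oplus>k\<in>{..n}. ?t (Suc n) (Suc k)) \<oplus> ?t (Suc n) 0"
    using x by (simp add: add.nat_pow_mult)
  also have "\<dots> = (\<Oplus>k\<in>{..Suc n}. ?t (Suc n) k)"
    using x by (subst finsum_Suc2) auto
  finally show ?case .
qed

lemma (in cring) frobenius_add:
  assumes "Factorial_Ring.prime (p::nat)" "[p] \<cdot>\<^bsub>R\<^esub> \<one> = \<zero>" and x: "x \<in> carrier R" "y \<in> carrier R"
  shows "(x \<oplus> y) [^] p = x [^] p \<oplus> y [^] p"
proof -
  let ?t = "\<lambda>k. [(p choose k)] \<cdot>\<^bsub>R\<^esub> (x [^] k \<otimes> y [^] (p - k))"
  have p0: "[p] \<cdot>\<^bsub>R\<^esub> z = \<zero>" if "z \<in> carrier R" for z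
  proof -
    have "[p] \<cdot>\<^bsub>R\<^esub> (\<one> \<otimes> z) = ([p] \<cdot>\<^bsub>R\<^esub> \<one>) \<otimes> z" using that by (simp add: add_pow_ldistr)
    then show ?thesis using assms(2) that by simp
  qed
  have van: "?t k = \<zero>" if "0 < k" "k < p" for k
  proof -
    obtain j where "p choose k = p * j" using dvd_choose_prime[of k p] assms(1) \<open>0 < k\<close> \<open>k < p\<close> by (metis dvdE gr_implies_not0)
    then show ?thesis using p0 x add.nat_pow_pow[of "x [^] k \<otimes> y [^] (p - k)" p j]
      by (simp add: mult.commute[of p])
  qed
  obtain m where m: "p = Suc (Suc m)"
    using prime_ge_2_nat[OF assms(1)] by (metis add_2_eq_Suc le_Suc_ex)
  have "(x \<oplus> y) [^] p = (\<Oplus>k\<in>{..Suc (Suc m)}. ?t k)" using binomial[OF x, of p] m by simp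
  also have "\<dots> = ?t (Suc (Suc m)) \<oplus> (\<Oplus>k\<in>{..Suc m}. ?t k)"
    using x by (intro finsum_Suc) auto
  also have "(\<Oplus>k\<in>{..Suc m}. ?t k) = (\<Oplus>k\<in>{..m}. ?t (Suc k)) \<oplus> ?t 0"
    using x by (intro finsum_Suc2) auto
  also have "(\<Oplus>k\<in>{..m}. ?t (Suc k)) = \<zero>"
    by (intro add.finprod_one_eqI van) (auto simp: m)
  finally show ?thesis using x m by simp
qed

lemma (in cring) nat_pow_minus_odd:
  assumes "x \<in> carrier R" "odd (n::nat)" shows "(\<ominus> x) [^] n = \<ominus> (x [^] n)"
proof -
  obtain k where k: "n = Suc (2 * k)" using assms(2) by (auto elim: oddE)
  have "(\<ominus> x) [^] (2::nat) = x [^] (2::nat)" using assms(1) by (simp add: numeral_2_eq_2 l_minus r_minus)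
  then have "(\<ominus> x) [^] (2 * k) = x [^] (2 * k)"
    using assms(1) nat_pow_pow[of "\<ominus> x" 2 k] nat_pow_pow[of x 2 k] by simp
  then show ?thesis using assms(1) k by (simp add: r_minus)
qed

lemma (in domain) frobenius_inj:
  assumes "Factorial_Ring.prime (p::nat)" "odd p" "[p] \<cdot>\<^bsub>R\<^esub> \<one> = \<zero>" and x: "x \<in> carrier R" "y \<in> carrier R"
    and eq: "x [^] p = y [^] p"
  shows "x = y"
proof -
  have "(x \<ominus> y) [^] p = \<zero>"
    using frobenius_add[OF assms(1,3), of x "\<ominus> y"] nat_pow_minus_odd[OF x(2) assms(2)] x eq
    by (simp add: a_minus_def r_neg)
  moreover have nil: "z = \<zero>" if "z \<in> carrier R" "z [^] n = \<zero>" for z and n :: nat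
    using that by (induction n) (auto dest: integral)
  ultimately have "x \<ominus> y = \<zero>" using x by blast
  then show ?thesis using x by simp
qed

lemma (in field) pth_root_exists:
  assumes "Factorial_Ring.prime (p::nat)" "odd p" "[p] \<cdot>\<^bsub>R\<^esub> \<one> = \<zero>" "finite (carrier R)" and x: "x \<in> carrier R"
  obtains y where "y \<in> carrier R" "y [^] p = x"
proof -
  have "inj_on (\<lambda>y. y [^] p) (carrier R)" using frobenius_inj[OF assms(1-3)] by (auto simp: inj_on_def)
  moreover have "(\<lambda>y. y [^] p) ` carrier R \<subseteq> carrier R" by auto
  ultimately have "(\<lambda>y. y [^] p) ` carrier R = carrier R" using assms(4) endo_inj_surj by blast
  then show thesis using that x by (metis imageE)
qed

text \<open>Injectivity of Frobenius gives uniqueness and finiteness gives existence, so the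
  definite description in \<open>pth_root\<close> denotes.\<close>

lemma (in field) pth_root_works:
  assumes "Factorial_Ring.prime (p::nat)" "odd p" "[p] \<cdot>\<^bsub>R\<^esub> \<one> = \<zero>" "finite (carrier R)" and x: "x \<in> carrier R"
  shows "pth_root R p x \<in> carrier R" "pth_root R p x [^] p = x"
proof -
  obtain y where y: "y \<in> carrier R" "y [^] p = x" using pth_root_exists[OF assms] by blast
  then have "pth_root R p x = y"
    unfolding pth_root_def using frobenius_inj[OF assms(1-3)] by (intro the_equality) auto
  then show "pth_root R p x \<in> carrier R" "pth_root R p x [^] p = x" using y by auto
qed

section \<open>Irreducibility of the quartics c (T^2 + u)^2 + e\<close>

context finite_field_odd
begin

lemma coeff_mult:
  assumes "f \<in> carrier PR" "g \<in> carrier PR"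
  shows "coeff (f *\<^sub>P g) n = (\<Oplus>k\<in>{..n}. coeff f k \<otimes> coeff g (n - k))"
  using poly_mult_coeff[of f g] assms polynomial_in_carrier[OF carrier_is_subring]
  by (simp add: univ_poly_carrier univ_poly_mult)

lemma coeff_add:
  assumes "f \<in> carrier PR" "g \<in> carrier PR"
  shows "coeff (f +\<^sub>P g) n = coeff f n \<oplus> coeff g n"
  using poly_add_coeff[of f g] assms polynomial_in_carrier[OF carrier_is_subring]
  by (simp add: univ_poly_carrier univ_poly_add)

lemma coeff_closed: "f \<in> carrier PR \<Longrightarrow> coeff f n \<in> carrier R"
  using coeff_in_carrier polynomial_in_carrier[OF carrier_is_subring] by (simp add: univ_poly_carrier)

lemma coeff_const: "coeff (poly_of_const c) n = (if n = 0 then c else \<zero>)"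
  unfolding poly_of_const_def normalize_coeff[symmetric] by simp

lemma const_closed: "c \<in> carrier R \<Longrightarrow> poly_of_const c \<in> carrier PR"
  unfolding poly_of_const_eq using const_PR[of c] by auto

lemma coeff_var_square_add:
  assumes "u \<in> carrier R"
  shows "coeff (X ^\<^sub>P 2 +\<^sub>P poly_of_const u) n = (if n = 0 then u else if n = 2 then \<one> else \<zero>)"
proof -
  have X: "X \<in> carrier PR" using var_closed(1)[OF carrier_is_subring] .
  have "coeff (X ^\<^sub>P 2) n = (if n = 2 then \<one> else \<zero>)"
    using X unfolding unitary_monom_eq_var_pow[OF carrier_is_subring, symmetric] by (simp add: monom_coeff)
  then show ?thesis using coeff_add[OF P.nat_pow_closed[OF X] const_closed[OF assms]] assms
    by (simp add: coeff_const)
qed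

text \<open>With s for T^2 + u, these are the lower coefficients of T^4 + 2 u T^2 + (u^2 +
  e).\<close>

lemma quartic_coeffs:
  assumes s: "s \<in> carrier PR" "\<And>n. coeff s n = (if n = 0 then u else if n = 2 then \<one> else \<zero>)"
    and ue: "u \<in> carrier R" "e \<in> carrier R"
    and m: "m = s *\<^sub>P s +\<^sub>P poly_of_const e"
  shows "coeff m 0 = u \<otimes> u \<oplus> e" "coeff m 1 = \<zero>" "coeff m 2 = u \<oplus> u" "coeff m 3 = \<zero>"
  unfolding m using s ue
  by (simp_all add: coeff_add coeff_mult const_closed coeff_const numeral_eq_Suc coeff_closed)

text \<open>The equations compare coefficients with (T + b)(T^3 + a2 T^2 + a1 T + a0); the
  conclusion is the quartic evaluated at its root -b.\<close>

lemma quartic_no_linear_factor: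
  assumes cl: "u \<in> carrier R" "e \<in> carrier R" "b \<in> carrier R" "a0 \<in> carrier R" "a1 \<in> carrier R" "a2 \<in> carrier R"
    and eqs: "b \<otimes> a0 = u \<otimes> u \<oplus> e" "b \<otimes> a1 \<oplus> a0 = \<zero>" "b \<otimes> a2 \<oplus> a1 = u \<oplus> u" "b \<oplus> a2 = \<zero>"
  shows "(u \<oplus> b \<otimes> b) \<otimes> (u \<oplus> b \<otimes> b) = \<ominus> e"
proof -
  have a2: "a2 = \<ominus> b" using eqs(4) cl by (metis add.m_comm minus_equality)
  have "a1 = (b \<otimes> a2 \<oplus> a1) \<oplus> b \<otimes> b" unfolding a2 using cl by algebra
  then have a1: "a1 = (u \<oplus> u) \<oplus> b \<otimes> b" unfolding eqs(3) .
  have a0: "a0 = \<ominus> (b \<otimes> a1)" using eqs(2) cl by (metis add.m_comm m_closed minus_equality)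
  have "e = b \<otimes> a0 \<ominus> u \<otimes> u" using eqs(1) cl by algebra
  then show ?thesis unfolding a0 a1 using cl by algebra
qed

text \<open>For (T^2 + a1 T + a0)(T^2 + b1 T + b0) the vanishing odd coefficients give b1 = -a1 and
  a1 (b0 - a0) = 0. If a1 = 0, then (u - a0)^2 = -e; if a0 = b0, then a0^2 = u^2 + e.\<close>

lemma quartic_no_quadratic_factor:
  assumes cl: "u \<in> carrier R" "e \<in> carrier R" "a0 \<in> carrier R" "a1 \<in> carrier R" "b0 \<in> carrier R" "b1 \<in> carrier R"
    and eqs: "a0 \<otimes> b0 = u \<otimes> u \<oplus> e" "a0 \<otimes> b1 \<oplus> a1 \<otimes> b0 = \<zero>"
      "a0 \<oplus> a1 \<otimes> b1 \<oplus> b0 = u \<oplus> u" "a1 \<oplus> b1 = \<zero>"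
  shows "(\<exists>y\<in>carrier R. y \<otimes> y = \<ominus> e) \<or> (\<exists>y\<in>carrier R. y \<otimes> y = u \<otimes> u \<oplus> e)"
proof -
  have b1: "b1 = \<ominus> a1" using eqs(4) cl by (metis add.m_comm minus_equality)
  have "a1 \<otimes> (b0 \<ominus> a0) = a0 \<otimes> b1 \<oplus> a1 \<otimes> b0" unfolding b1 using cl by algebra
  then have "a1 = \<zero> \<or> b0 \<ominus> a0 = \<zero>" using eqs(2) cl integral[of a1 "b0 \<ominus> a0"] by auto
  then show ?thesis
  proof
    assume a1: "a1 = \<zero>"
    have s: "a0 \<oplus> b0 = u \<oplus> u" using eqs(3) cl unfolding b1 a1 by simp
    have e: "e = a0 \<otimes> b0 \<ominus> u \<otimes> u" using eqs(1) cl by algebra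
    have "(u \<ominus> a0) \<otimes> (u \<ominus> a0) = u \<otimes> u \<ominus> a0 \<otimes> ((u \<oplus> u) \<ominus> a0)" using cl by algebra
    also have "\<dots> = u \<otimes> u \<ominus> a0 \<otimes> ((a0 \<oplus> b0) \<ominus> a0)" unfolding s ..
    also have "\<dots> = \<ominus> e" unfolding e using cl by algebra
    finally show ?thesis using cl by (intro disjI1 bexI[of _ "u \<ominus> a0"]) auto
  next
    assume "b0 \<ominus> a0 = \<zero>"
    then have "b0 = a0" using cl by simp
    then show ?thesis using eqs(1) cl by auto
  qed
qed

lemma Mon_list: "f \<in> Mon n \<Longrightarrow> \<exists>l. f = \<one> # l \<and> length l = n \<and> set l \<subseteq> carrier R"
  unfolding Mon_eq by auto

text \<open>Dividing by c leaves a monic quartic, whose proper factorizations have type 1 + 3 or 2 +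
  2. The hypotheses avoid division by c so that Frobenius can be applied to them directly.\<close>

lemma quartic_irreducible:
  assumes c: "c \<in> U" and ue: "u \<in> carrier R" "e \<in> carrier R"
    and ns1: "\<And>y. y \<in> carrier R \<Longrightarrow> c \<otimes> (y \<otimes> y) \<noteq> \<ominus> e"
    and ns2: "\<And>y. y \<in> carrier R \<Longrightarrow> c \<otimes> (y \<otimes> y) \<noteq> c \<otimes> (u \<otimes> u) \<oplus> e"
  defines "f \<equiv> poly_of_const c *\<^sub>P ((X ^\<^sub>P 2 +\<^sub>P poly_of_const u) ^\<^sub>P 2) +\<^sub>P poly_of_const e"
  shows "pirreducible (carrier R) f" "f \<in> carrier PR"
proof -
  define \<epsilon> where "\<epsilon> = inv c \<otimes> e"
  have ic: "inv c \<in> carrier R" "c \<otimes> inv c = \<one>" using c field_Units Units_r_inv by auto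
  have \<epsilon>: "\<epsilon> \<in> carrier R" "c \<otimes> \<epsilon> = e" using ic c ue unfolding \<epsilon>_def by (auto simp: m_assoc[symmetric])
  define s where "s = X ^\<^sub>P 2 +\<^sub>P poly_of_const u"
  have len_const: "length (poly_of_const a) \<le> 1" for a by (simp add: poly_of_const_eq)
  have s: "s \<in> Mon 2"
    using add_lower[of "X ^\<^sub>P 2" "poly_of_const u"] MonD[OF Mon_var_pow[of 2]] const_closed[OF ue(1)] len_const[of u]
    unfolding s_def Mon_def by simp
  define m where "m = s *\<^sub>P s +\<^sub>P poly_of_const \<epsilon>"
  note sD = MonD[OF s]
  have ss: "s *\<^sub>P s \<in> Mon 4" using Mon_mult[OF s s] by simp
  have m: "m \<in> Mon 4"
    using add_lower[of "s *\<^sub>P s" "poly_of_const \<epsilon>"] MonD[OF ss] const_closed[OF \<epsilon>(1)] len_const[of \<epsilon>]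
    unfolding m_def Mon_def by simp
  note mD = MonD[OF m]
  have pc: "poly_of_const c = [c]" using c by (simp add: poly_of_const_eq)
  have pe: "poly_of_const e = [c] *\<^sub>P poly_of_const \<epsilon>"
  proof (cases "\<epsilon> = \<zero>")
    case True
    then have "e = \<zero>" using \<epsilon>(2) c by simp
    then show ?thesis using True P.r_null[OF const_PR[OF c]] zero_PR by (simp add: poly_of_const_eq)
  next
    case False
    then have "e \<noteq> \<zero>" using \<epsilon> c integral by auto
    then show ?thesis using False \<epsilon> const_mult[OF c, of \<epsilon>] by (simp add: poly_of_const_eq)
  qed
  have fm: "f = [c] *\<^sub>P m"
    unfolding f_def s_def[symmetric] m_def pc pe using sD(1) const_PR[OF c] const_closed[OF \<epsilon>(1)]
    by (simp add: numeral_2_eq_2 P.r_distr)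
  show fc: "f \<in> carrier PR" unfolding fm using mD const_PR[OF c] by simp
  have f5: "length f = 5" unfolding fm using length_smult[OF c mD(1)] mD(2) by simp
  have ms: "\<And>n. coeff s n = (if n = 0 then u else if n = 2 then \<one> else \<zero>)"
    unfolding s_def using coeff_var_square_add[OF ue(1)] .
  note mc = quartic_coeffs[OF sD(1) ms ue(1) \<epsilon>(1) m_def]
  have no1: "y \<otimes> y \<noteq> \<ominus> \<epsilon>" if "y \<in> carrier R" for y
  proof
    assume "y \<otimes> y = \<ominus> \<epsilon>"
    then have "c \<otimes> (y \<otimes> y) = \<ominus> e" using \<epsilon> c by (simp add: r_minus)
    then show False using ns1 that by blast
  qed
  have no2: "y \<otimes> y \<noteq> u \<otimes> u \<oplus> \<epsilon>" if "y \<in> carrier R" for y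
  proof
    assume "y \<otimes> y = u \<otimes> u \<oplus> \<epsilon>"
    then have "c \<otimes> (y \<otimes> y) = c \<otimes> (u \<otimes> u) \<oplus> e" using \<epsilon> c ue by (simp add: r_distr)
    then show False using ns2 that by blast
  qed
  have factor: False if g: "g \<in> Mon i" and h: "h \<in> Mon j" and mgh: "m = g *\<^sub>P h" and ij: "1 \<le> i" "i \<le> j" for g h i j
  proof -
    have cl: "g \<in> carrier PR" "h \<in> carrier PR" using MonD g h by auto
    have "i + j = 4" using MonD(2)[OF Mon_mult[OF g h]] mD(2) mgh by simp
    then consider "i = 1" "j = 3" | "i = 2" "j = 2" using ij by linarith
    then show False
    proof cases
      case 1
      obtain b where b: "g = [\<one>, b]" "b \<in> carrier R" using Mon_list[OF g] 1 by (auto simp: length_Suc_conv numeral_eq_Suc)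
      obtain a2 a1 a0 where a: "h = [\<one>, a2, a1, a0]" "a2 \<in> carrier R" "a1 \<in> carrier R" "a0 \<in> carrier R"
        using Mon_list[OF h] 1 by (auto simp: length_Suc_conv numeral_eq_Suc)
      have eq: "coeff m n = (\<Oplus>k\<in>{..n}. coeff g k \<otimes> coeff h (n - k))" for n
        unfolding mgh using coeff_mult[OF cl] .
      have "b \<otimes> a0 = u \<otimes> u \<oplus> \<epsilon>" using eq[of 0] mc(1) b a by simp
      moreover have "b \<otimes> a1 \<oplus> a0 = \<zero>" using eq[of 1] mc(2) b a by (simp add: numeral_eq_Suc a_comm)
      moreover have "b \<otimes> a2 \<oplus> a1 = u \<oplus> u" using eq[of 2] mc(3) b a by (simp add: numeral_eq_Suc a_comm)
      moreover have "b \<oplus> a2 = \<zero>" using eq[of 3] mc(4) b a by (simp add: numeral_eq_Suc a_comm)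
      ultimately have "(u \<oplus> b \<otimes> b) \<otimes> (u \<oplus> b \<otimes> b) = \<ominus> \<epsilon>"
        using quartic_no_linear_factor[OF ue(1) \<epsilon>(1) b(2) a(4,3,2)] by blast
      then show False using no1[of "u \<oplus> b \<otimes> b"] ue b by simp
    next
      case 2
      obtain a1 a0 where a: "g = [\<one>, a1, a0]" "a1 \<in> carrier R" "a0 \<in> carrier R"
        using Mon_list[OF g] 2 by (auto simp: length_Suc_conv numeral_eq_Suc)
      obtain b1 b0 where b: "h = [\<one>, b1, b0]" "b1 \<in> carrier R" "b0 \<in> carrier R"
        using Mon_list[OF h] 2 by (auto simp: length_Suc_conv numeral_eq_Suc)
      have eq: "coeff m n = (\<Oplus>k\<in>{..n}. coeff g k \<otimes> coeff h (n - k))" for n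
        unfolding mgh using coeff_mult[OF cl] .
      have "a0 \<otimes> b0 = u \<otimes> u \<oplus> \<epsilon>" using eq[of 0] mc(1) b a by simp
      moreover have "a0 \<otimes> b1 \<oplus> a1 \<otimes> b0 = \<zero>" using eq[of 1] mc(2) b a by (simp add: numeral_eq_Suc a_comm)
      moreover have "a0 \<oplus> a1 \<otimes> b1 \<oplus> b0 = u \<oplus> u" using eq[of 2] mc(3) b a by (simp add: numeral_eq_Suc a_ac)
      moreover have "a1 \<oplus> b1 = \<zero>" using eq[of 3] mc(4) b a by (simp add: numeral_eq_Suc a_comm)
      ultimately show False
        using quartic_no_quadratic_factor[OF ue(1) \<epsilon>(1) a(3,2) b(3,2)] no1 no2 by blast
    qed
  qed
  show "pirreducible (carrier R) f"
  proof (rule pirreducibleI[OF carrier_is_subring fc])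
    show "f \<noteq> []" using f5 by auto
    show "f \<notin> Units PR" using f5 univ_poly_units'[OF carrier_is_subfield, of f] by simp
    fix g h assume gh: "g \<in> carrier PR" "h \<in> carrier PR" "f = g *\<^sub>P h"
    have ne: "g \<noteq> []" "h \<noteq> []" using gh \<open>f \<noteq> []\<close> zero_PR P.l_null P.r_null by metis+
    obtain g' where g': "g' \<in> Mon (length g - 1)" "g = [lc g] *\<^sub>P g'" using normalize_monic gh ne by blast
    obtain h' where h': "h' \<in> Mon (length h - 1)" "h = [lc h] *\<^sub>P h'" using normalize_monic gh ne by blast
    have l: "lc g \<in> U" "lc h \<in> U" using lc_closed lc_eq_0 gh ne by auto
    have cl: "[lc g] \<in> carrier PR" "[lc h] \<in> carrier PR" "g' \<in> carrier PR" "h' \<in> carrier PR"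
      using const_PR l MonD(1) g'(1) h'(1) by auto
    have "f = ([lc g] *\<^sub>P g') *\<^sub>P ([lc h] *\<^sub>P h')" using gh(3) g'(2) h'(2) by simp
    also have "\<dots> = ([lc g] *\<^sub>P [lc h]) *\<^sub>P (g' *\<^sub>P h')" using cl by (simp add: P.m_ac)
    also have "[lc g] *\<^sub>P [lc h] = [lc g \<otimes> lc h]" using const_mult[OF l] .
    also have "lc g \<otimes> lc h = c"
      using lc_mult[OF gh(1,2)] gh(3) lc_mult[OF const_PR[OF c] mD(1)] mD(3) c unfolding fm by (simp add: lc_const)
    finally have "[c] *\<^sub>P m = [c] *\<^sub>P (g' *\<^sub>P h')" unfolding fm .
    then have mgh: "m = g' *\<^sub>P h'"
      using P.m_lcancel[of "[c]" m "g' *\<^sub>P h'"] const_PR[OF c] mD(1) cl zero_PR by simp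
    have "\<not> (1 \<le> length g - 1 \<and> 1 \<le> length h - 1)"
    proof
      assume ge: "1 \<le> length g - 1 \<and> 1 \<le> length h - 1"
      show False
      proof (cases "length g - 1 \<le> length h - 1")
        case True then show False using factor[OF g'(1) h'(1) mgh] ge by simp
      next
        case False
        have "m = h' *\<^sub>P g'" using mgh P.m_comm cl by simp
        then show False using factor[OF h'(1) g'(1)] ge False by simp
      qed
    qed
    then show "g \<in> Units PR \<or> h \<in> Units PR"
      using univ_poly_units'[OF carrier_is_subfield, of g] univ_poly_units'[OF carrier_is_subfield, of h]
        gh(1,2) ne by auto
  qed
qed

end

section \<open>Squarefree trinomials\<close>

lemma (in ring_hom_ring) hom_add_pow: "x \<in> carrier R \<Longrightarrow> h ([(n::nat)] \<cdot>\<^bsub>R\<^esub> x) = [n] \<cdot>\<^bsub>S\<^esub> h x"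
  by (induction n) auto

context finite_field_odd
begin

lemma irreducible_divisor_exists:
  assumes "f \<in> Mon n" "0 < n"
  shows "\<exists>k E. E \<in> Mon k \<and> pirreducible (carrier R) E \<and> E pdivides f"
  using assms
proof (induction n arbitrary: f rule: less_induct)
  case (less n)
  note fD = MonD[OF less.prems(1)]
  show ?case
  proof (cases "pirreducible (carrier R) f")
    case True
    have "f pdivides f" using pdividesI[of "1\<^sub>P" f f] fD by simp
    then show ?thesis using True less.prems(1) by blast
  next
    case False
    have "f \<notin> Units PR" using univ_poly_units'[OF carrier_is_subfield, of f] fD less.prems(2) by simp
    then obtain g h where gh: "g \<in> carrier PR" "h \<in> carrier PR" "f = g *\<^sub>P h" "g \<notin> Units PR" "h \<notin> Units PR"
      using pirreducibleI[OF carrier_is_subring fD(1,4)] False by blast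
    have ne: "g \<noteq> []" "h \<noteq> []" using gh(1-3) fD(4) zero_PR P.l_null P.r_null by metis+
    have deg: "0 < length g - 1" "0 < length h - 1"
      using univ_poly_units'[OF carrier_is_subfield, of g] univ_poly_units'[OF carrier_is_subfield, of h]
        gh(1,2,4,5) ne by auto
    have len: "Suc n = length g + length h - 1" using length_mult(1)[OF gh(1,2) ne] gh(3) fD(2) by simp
    obtain g' where g': "g' \<in> Mon (length g - 1)" "g = [lc g] *\<^sub>P g'" using normalize_monic gh(1) ne by blast
    have l: "lc g \<in> U" using lc_closed lc_eq_0 gh(1) ne by auto
    have "length g - 1 < n" using len deg by linarith
    then obtain k E where E: "E \<in> Mon k" "pirreducible (carrier R) E" "E pdivides g'"
      using less.IH[OF _ g'(1) deg(1)] by blast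
    have "f = g' *\<^sub>P ([lc g] *\<^sub>P h)"
    proof -
      have "f = ([lc g] *\<^sub>P g') *\<^sub>P h" using gh(3) g'(2) by simp
      then show ?thesis using MonD(1)[OF g'(1)] const_PR[OF l] gh(2) by (simp add: P.m_ac)
    qed
    then have "E pdivides f"
      using pdivides_mult[OF E(3) MonD(1)[OF E(1)], of "[lc g] *\<^sub>P h"] const_PR[OF l] gh(2) by simp
    then show ?thesis using E by blast
  qed
qed

lemma pdivides_trans: "\<lbrakk>f pdivides g; g pdivides h; f \<in> carrier PR\<rbrakk> \<Longrightarrow> f pdivides h"
  using P.divides_trans unfolding pdivides_def by blast

lemma pdivides_minus: "\<lbrakk>g pdivides f; g pdivides h; g \<in> carrier PR\<rbrakk> \<Longrightarrow> g pdivides (f -\<^sub>P h)"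
proof (elim pdividesE)
  fix k l assume "g \<in> carrier PR" "k \<in> carrier PR" "l \<in> carrier PR" "f = g *\<^sub>P k" "h = g *\<^sub>P l"
  then show ?thesis by (intro pdividesI[of "k -\<^sub>P l"]) (auto simp: P.r_distr P.r_minus a_minus_def)
qed

lemma pdivides_mult_left: "\<lbrakk>g pdivides f; g \<in> carrier PR; f \<in> carrier PR; x \<in> carrier PR\<rbrakk> \<Longrightarrow> g pdivides (x *\<^sub>P f)"
  using pdivides_mult[of g f x] P.m_comm[of x f] by simp

lemma irreducible_not_pdivides_const:
  assumes "E \<in> Mon n" "pirreducible (carrier R) E" "c \<in> U"
  shows "\<not> E pdivides [c]"
  using not_pdivides_small[OF assms(1) const_PR[OF assms(3)]] irreducible_degree_pos[OF assms(1,2)] by simp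

lemma irreducible_pdivides_smult:
  assumes "E \<in> Mon n" "pirreducible (carrier R) E" "c \<in> U" "f \<in> carrier PR"
  shows "E pdivides ([c] *\<^sub>P f) \<longleftrightarrow> E pdivides f"
  using irreducible_prime[OF assms(1,2) const_PR[OF assms(3)] assms(4)]
    irreducible_not_pdivides_const[OF assms(1-3)] pdivides_mult_left[of E f "[c]"]
    MonD(1)[OF assms(1)] const_PR[OF assms(3)] assms(4) by blast

text \<open>Irreducible factors are stripped off one at a time. With D = E D' and B = D' y,
  squarefreeness keeps E from dividing D', so E must divide y.\<close>

lemma squarefree_pdivides:
  assumes "D \<in> Mon d" and B: "B \<in> carrier PR"
    and "\<And>E n. \<lbrakk>E \<in> Mon n; pirreducible (carrier R) E; E pdivides D\<rbrakk> \<Longrightarrow> \<not> (E *\<^sub>P E) pdivides D \<and> E pdivides B"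
  shows "D pdivides B"
  using assms(1,3)
proof (induction d arbitrary: D rule: less_induct)
  case (less d)
  note DD = MonD[OF less.prems(1)]
  show ?case
  proof (cases "d = 0")
    case True
    then have "D = 1\<^sub>P" using Mon_list[OF less.prems(1)] one_PR by auto
    then show ?thesis using pdividesI[of B B "1\<^sub>P"] B by simp
  next
    case False
    then obtain k E where E: "E \<in> Mon k" "pirreducible (carrier R) E" "E pdivides D"
      using irreducible_divisor_exists[OF less.prems(1)] by blast
    note ED = MonD[OF E(1)]
    obtain D' where D': "D' \<in> carrier PR" "D = E *\<^sub>P D'" using E(3) by (rule pdividesE)
    have "D' \<noteq> []" using D' DD(4) zero_PR P.r_null[OF ED(1)] by metis
    have lc1: "lc D' = \<one>" using lc_mult[OF ED(1) D'(1)] D'(2) DD(3) ED(3) lc_closed[OF D'(1)] by simp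
    have len: "Suc d = k + length D'"
      using length_mult(1)[OF ED(1) D'(1) ED(4) \<open>D' \<noteq> []\<close>] D'(2) DD(2) ED(2) by simp
    then have D'M: "D' \<in> Mon (d - k)"
      using D'(1) lc1 \<open>D' \<noteq> []\<close> unfolding Mon_def by (cases D') auto
    have sub: "F pdivides D' \<Longrightarrow> F \<in> carrier PR \<Longrightarrow> F pdivides D" for F
      using pdivides_mult_left[of F D' E] D' ED(1) by simp
    have "0 < k" using irreducible_degree_pos[OF E(1,2)] .
    moreover have "k \<le> d" using len \<open>D' \<noteq> []\<close> by (cases D') auto
    ultimately have "D' pdivides B"
    proof (intro less.IH[OF _ D'M])
      fix F n assume F: "F \<in> Mon n" "pirreducible (carrier R) F" "F pdivides D'"
      have "\<not> (F *\<^sub>P F) pdivides D" "F pdivides B" using less.prems(2)[OF F(1,2)] sub[OF F(3)] MonD(1)[OF F(1)] by auto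
      then show "\<not> (F *\<^sub>P F) pdivides D' \<and> F pdivides B" using sub MonD(1)[OF F(1)] by auto
    qed auto
    then obtain y where y: "y \<in> carrier PR" "B = D' *\<^sub>P y" by (rule pdividesE)
    have "\<not> E pdivides D'"
    proof
      assume "E pdivides D'"
      then obtain z where "z \<in> carrier PR" "D' = E *\<^sub>P z" by (rule pdividesE)
      then have "(E *\<^sub>P E) pdivides D" using D'(2) ED(1) by (intro pdividesI[of z]) (auto simp: P.m_assoc)
      then show False using less.prems(2)[OF E] by blast
    qed
    then have "E pdivides y"
      using irreducible_prime[OF E(1,2) D'(1) y(1)] less.prems(2)[OF E] y(2) by auto
    then obtain w where "w \<in> carrier PR" "y = E *\<^sub>P w" by (rule pdividesE)
    then show ?thesis using D' y ED(1) by (intro pdividesI[of w]) (auto simp: P.m_ac)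
  qed
qed

lemma const_hom: "ring_hom_ring R PR poly_of_const"
proof (rule ring_hom_ringI2[OF ring_axioms P.ring_axioms])
  show "poly_of_const \<in> ring_hom R PR"
    using canonical_embedding_is_hom[OF carrier_is_subring] by (simp add: ring_hom_def)
qed

end

section \<open>Characteristic p: p-th powers modulo a polynomial\<close>

locale finite_field_char = finite_field_odd +
  fixes p :: nat
  assumes prime_p: "Factorial_Ring.prime p" and odd_p: "odd p" and char_p: "[p] \<cdot>\<^bsub>R\<^esub> \<one> = \<zero>"
begin

sublocale C: ring_hom_ring R PR poly_of_const
  by (rule const_hom)

lemma X_closed: "X \<in> carrier PR"
  using var_closed(1)[OF carrier_is_subring] .

lemma char_PR: "[p] \<cdot>\<^bsub>PR\<^esub> 1\<^sub>P = 0\<^sub>P"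
  using C.hom_add_pow[OF one_closed, of p] char_p by simp

lemma p_pos: "0 < p"
  using prime_gt_0_nat[OF prime_p] .

lemma const_pth_root:
  assumes "a \<in> carrier R" obtains b where "b \<in> carrier R" "b [^] p = a"
  using pth_root_exists[OF prime_p odd_p char_p finite_carrier assms] .

lemma frobenius_add_PR:
  "\<lbrakk>f \<in> carrier PR; g \<in> carrier PR\<rbrakk> \<Longrightarrow> (f +\<^sub>P g) ^\<^sub>P p = f ^\<^sub>P p +\<^sub>P g ^\<^sub>P p"
  using P.frobenius_add[OF prime_p char_PR] .

text \<open>Horner's scheme: f = X k + a with k congruent to h^p by induction and a = b^p, so f is
  congruent to (g h + b)^p.\<close>

lemma pth_power_mod:
  assumes I: "I \<in> carrier PR" and g: "g \<in> carrier PR" and X: "I pdivides (X -\<^sub>P g ^\<^sub>P p)"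
  shows "f \<in> carrier PR \<Longrightarrow> \<exists>h\<in>carrier PR. I pdivides (f -\<^sub>P h ^\<^sub>P p)"
proof (induction "length f" arbitrary: f rule: less_induct)
  case less
  show ?case
  proof (cases "f = []")
    case True
    have "0\<^sub>P ^\<^sub>P p = 0\<^sub>P" using p_pos by (cases p) auto
    moreover have "I pdivides 0\<^sub>P" using pdividesI[of "0\<^sub>P" "0\<^sub>P" I] I by simp
    moreover have "0\<^sub>P -\<^sub>P 0\<^sub>P = 0\<^sub>P" by (simp add: a_minus_def)
    moreover have "f = 0\<^sub>P" using True zero_PR by simp
    ultimately show ?thesis using P.zero_closed by metis
  next
    case False
    note xc = X_closed
    have X2: "length X = 2" "X \<noteq> []" by (auto simp: var_def)
    define k where "k = f pdiv X"
    define r where "r = f pmod X"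
    have kr: "k \<in> carrier PR" "r \<in> carrier PR" "length r < 2" "f = X *\<^sub>P k +\<^sub>P r"
      unfolding k_def r_def using pdiv_closed pmod_closed length_pmod[of f X] pdiv_pmod_eq[of f X] less.prems xc X2 by auto
    have "\<exists>a\<in>carrier R. r = poly_of_const a"
    proof (cases r)
      case Nil then show ?thesis by (intro bexI[of _ \<zero>]) (auto simp: poly_of_const_eq)
    next
      case (Cons a l)
      then have "r = [a]" "lc r = a" using kr(3) by (auto simp: lc_def)
      then show ?thesis using lc_closed[OF kr(2)] lc_eq_0[OF kr(2)]
        by (intro bexI[of _ a]) (auto simp: poly_of_const_eq)
    qed
    then obtain a where a: "a \<in> carrier R" "r = poly_of_const a" by blast
    obtain b where b: "b \<in> carrier R" "b [^] p = a" using const_pth_root[OF a(1)] .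
    have rb: "r = poly_of_const b ^\<^sub>P p" using a(2) b C.hom_nat_pow[OF b(1), of p] by simp
    have "length k < length f"
    proof (cases "k = []")
      case True then show ?thesis using False by simp
    next
      case k: False
      have "length (X *\<^sub>P k) = length k + 1" using length_mult(1)[OF xc kr(1) X2(2) k] X2(1) by simp
      moreover have "length r < length (X *\<^sub>P k)" using calculation kr(3) k by (cases k) auto
      ultimately show ?thesis using add_lower(1)[of "X *\<^sub>P k" r] kr xc by simp
    qed
    then obtain h where h: "h \<in> carrier PR" "I pdivides (k -\<^sub>P h ^\<^sub>P p)" using less.hyps kr(1) by blast
    let ?h = "g *\<^sub>P h +\<^sub>P poly_of_const b"
    have bc: "poly_of_const b \<in> carrier PR" using const_closed[OF b(1)] .
    have hp: "?h ^\<^sub>P p = g ^\<^sub>P p *\<^sub>P h ^\<^sub>P p +\<^sub>P r"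
      using frobenius_add_PR[of "g *\<^sub>P h" "poly_of_const b"] P.nat_pow_distrib[of g h p] g h(1) bc rb by simp
    define G where "G = g ^\<^sub>P p"
    define H where "H = h ^\<^sub>P p"
    have GH: "G \<in> carrier PR" "H \<in> carrier PR" unfolding G_def H_def using g h by auto
    \<comment> \<open>The first summand is divisible by I through the choice of h, the second
      through the hypothesis on X.\<close>
    have "f -\<^sub>P ?h ^\<^sub>P p = X *\<^sub>P (k -\<^sub>P H) +\<^sub>P (X -\<^sub>P G) *\<^sub>P H"
      unfolding hp kr(4) G_def[symmetric] H_def[symmetric] using xc kr(1,2) GH by algebra
    moreover have "I pdivides \<dots>"
      using pdivides_add[OF pdivides_mult_left[OF h(2)] pdivides_mult[OF X]] I xc kr(1) GH
      unfolding G_def H_def by simp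
    ultimately have "I pdivides (f -\<^sub>P ?h ^\<^sub>P p)" by simp
    then show ?thesis using g h(1) bc by (intro bexI[of _ ?h]) auto
  qed
qed

text \<open>In characteristic \<open>p\<close> the relation \<open>D = 0\<close> exhibits \<open>X\<close>, and hence everything, as a \<open>p\<close>-th
  power modulo any divisor of \<open>D\<close>; but \<open>E\<close> cannot be a \<open>p\<close>-th power modulo \<open>E\<close> squared.\<close>

lemma trinomial_squarefree:
  assumes \<alpha>: "\<alpha> \<in> carrier R" and \<beta>: "\<beta> \<in> U" and \<gamma>: "\<gamma> \<in> carrier R"
    and E: "E \<in> Mon n" "pirreducible (carrier R) E"
  shows "\<not> (E *\<^sub>P E) pdivides (poly_of_const \<alpha> *\<^sub>P X ^\<^sub>P (2 * p) +\<^sub>P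
      (poly_of_const \<beta> *\<^sub>P X +\<^sub>P poly_of_const \<gamma>))" (is "\<not> ?I pdivides ?D")
proof
  assume dvd: "?I pdivides ?D"
  note ED = MonD[OF E(1)] and xc = X_closed
  have Ic: "?I \<in> carrier PR" using ED by simp
  have ib: "inv \<beta> \<in> carrier R" "inv \<beta> \<otimes> \<beta> = \<one>" using \<beta> field_Units Units_l_inv by auto
  \<comment> \<open>Solving D = 0 for X gives X = -(\<alpha>/\<beta>) X^(2p) - \<gamma>/\<beta>.
    Taking p-th roots a and b of the two coefficients writes this as (a X^2 + b)^p.\<close>
  obtain a where a: "a \<in> carrier R" "a [^] p = \<ominus> (inv \<beta> \<otimes> \<alpha>)" using const_pth_root[of "\<ominus> (inv \<beta> \<otimes> \<alpha>)"] ib \<alpha> by auto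
  obtain b where b: "b \<in> carrier R" "b [^] p = \<ominus> (inv \<beta> \<otimes> \<gamma>)" using const_pth_root[of "\<ominus> (inv \<beta> \<otimes> \<gamma>)"] ib \<gamma> by auto
  let ?g = "poly_of_const a *\<^sub>P X ^\<^sub>P 2 +\<^sub>P poly_of_const b"
  let ?B = "poly_of_const (inv \<beta>)" and ?al = "poly_of_const \<alpha>" and ?be = "poly_of_const \<beta>" and ?ga = "poly_of_const \<gamma>"
  have cl: "?B \<in> carrier PR" "?al \<in> carrier PR" "?be \<in> carrier PR" "?ga \<in> carrier PR"
    "poly_of_const a \<in> carrier PR" "poly_of_const b \<in> carrier PR"
    using ib(1) \<alpha> \<beta> \<gamma> a(1) b(1) by auto
  define Y where "Y = X ^\<^sub>P (2 * p)"
  have Y: "Y \<in> carrier PR" "(X ^\<^sub>P 2) ^\<^sub>P p = Y" unfolding Y_def using xc by (auto simp: P.nat_pow_pow)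
  have gp: "?g ^\<^sub>P p = -\<^sub>P (?B *\<^sub>P ?al) *\<^sub>P Y +\<^sub>P -\<^sub>P (?B *\<^sub>P ?ga)"
  proof -
    have pa: "poly_of_const a ^\<^sub>P p = -\<^sub>P (?B *\<^sub>P ?al)"
      using C.hom_nat_pow[OF a(1), of p] a(2) ib(1) \<alpha> by simp
    have pb: "poly_of_const b ^\<^sub>P p = -\<^sub>P (?B *\<^sub>P ?ga)"
      using C.hom_nat_pow[OF b(1), of p] b(2) ib(1) \<gamma> by simp
    show ?thesis
      using frobenius_add_PR[of "poly_of_const a *\<^sub>P X ^\<^sub>P 2" "poly_of_const b"]
        P.nat_pow_distrib[of "poly_of_const a" "X ^\<^sub>P 2" p] xc cl Y(2) pa pb by simp
  qed
  have "?B *\<^sub>P ?be = 1\<^sub>P" using C.hom_mult[OF ib(1), of \<beta>] ib(2) \<beta> by simp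
  then have "X = (?B *\<^sub>P ?be) *\<^sub>P X" using xc by simp
  then have "X -\<^sub>P ?g ^\<^sub>P p = (?B *\<^sub>P ?be) *\<^sub>P X -\<^sub>P
      (-\<^sub>P (?B *\<^sub>P ?al) *\<^sub>P Y +\<^sub>P -\<^sub>P (?B *\<^sub>P ?ga))" using gp by simp
  also have "\<dots> = ?B *\<^sub>P (?al *\<^sub>P Y +\<^sub>P (?be *\<^sub>P X +\<^sub>P ?ga))"
    using cl(1-4) Y(1) xc by algebra
  finally have "?I pdivides (X -\<^sub>P ?g ^\<^sub>P p)"
    using pdivides_mult_left[OF dvd Ic _ cl(1)] cl xc Y(1) unfolding Y_def by simp
  then obtain h where h: "h \<in> carrier PR" "?I pdivides (E -\<^sub>P h ^\<^sub>P p)"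
    using pth_power_mod[OF Ic _ _ ED(1), of ?g] cl xc by auto
  have hp: "h ^\<^sub>P p \<in> carrier PR" using h by simp
  have "E pdivides ?I" using pdividesI ED by blast
  then have "E pdivides (E -\<^sub>P h ^\<^sub>P p)" using pdivides_trans h(2) ED by blast
  moreover have "E pdivides E" using pdividesI[of "1\<^sub>P" E E] ED by simp
  moreover have "E -\<^sub>P (E -\<^sub>P h ^\<^sub>P p) = h ^\<^sub>P p" using ED(1) hp by algebra
  ultimately have "E pdivides (h ^\<^sub>P p)" using pdivides_minus[of E E] ED by metis
  moreover have "E pdivides h" if "E pdivides (h ^\<^sub>P k)" for k :: nat
    using that
  proof (induction k)
    case 0
    then show ?case using irreducible_not_pdivides_const[OF E, of \<one>] one_PR by simp
  next
    case (Suc k)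
    then show ?case using irreducible_prime[OF E, of "h ^\<^sub>P k" h] h by auto
  qed
  ultimately have "E pdivides h" by blast
  then obtain w where w: "w \<in> carrier PR" "h = E *\<^sub>P w" by (rule pdividesE)
  \<comment> \<open>As p >= 2, E dividing h makes h^p divisible by the square of E. Then E itself is
    divisible by its square, which is absurd.\<close>
  obtain m where m: "p = Suc (Suc m)" using prime_ge_2_nat[OF prime_p] by (metis add_2_eq_Suc le_Suc_ex)
  have "h ^\<^sub>P p = ?I *\<^sub>P (h ^\<^sub>P m *\<^sub>P (w *\<^sub>P w))"
    unfolding m using h(1) w ED(1) by (simp add: P.m_ac)
  then have "?I pdivides (h ^\<^sub>P p)" using h w by (intro pdividesI) auto
  moreover have "(E -\<^sub>P h ^\<^sub>P p) +\<^sub>P h ^\<^sub>P p = E" using ED(1) hp by algebra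
  ultimately have "?I pdivides E" using pdivides_add[OF h(2) _ Ic] by metis
  then obtain y where y: "y \<in> carrier PR" "E = E *\<^sub>P E *\<^sub>P y" by (rule pdividesE)
  then have "E *\<^sub>P 1\<^sub>P = E *\<^sub>P (E *\<^sub>P y)" using ED(1) by (simp add: P.m_assoc)
  then have "1\<^sub>P = E *\<^sub>P y" using P.m_lcancel[of E "1\<^sub>P" "E *\<^sub>P y"] ED y(1) zero_PR by simp
  then have "E pdivides 1\<^sub>P" using pdividesI[OF y(1)] by simp
  then show False using irreducible_not_pdivides_const[OF E, of \<one>] one_PR by simp
qed

end

section \<open>The four polynomials attached to the point\<close>

locale curve_setup = finite_field_char +
  fixes c d :: 'a
  assumes c: "c \<in> U" and d: "d \<in> U"
begin

abbreviation Y where "Y \<equiv> X ^\<^sub>P (2 * p)"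
abbreviation four where "four \<equiv> (\<one> \<oplus> \<one>) \<oplus> (\<one> \<oplus> \<one>)"
abbreviation F4 where "F4 \<equiv> (1\<^sub>P +\<^sub>P 1\<^sub>P) +\<^sub>P (1\<^sub>P +\<^sub>P 1\<^sub>P)"
abbreviation Pc where "Pc \<equiv> poly_of_const c"
abbreviation Pd where "Pd \<equiv> poly_of_const d"

text \<open>With \<open>u\<close> for \<open>X\<close>, these are the \<open>p\<close>-th powers of the elements that must be nonsquares: for
  \<open>\<pi>\<^sub>1 = \<gamma> (T\<^sup>2 + u)\<^sup>2 + e\<close> with \<open>\<gamma>\<^sup>p = c\<close> and \<open>e\<^sup>p = d u\<close> one needs \<open>- \<gamma> e\<close> and
  \<open>\<gamma>\<^sup>2 u\<^sup>2 + \<gamma> e\<close> (\<open>Dp 1\<close>, \<open>Dp 3\<close>), and for \<open>\<pi>\<^sub>2 = 4 \<gamma> (T\<^sup>2 + u)\<^sup>2 + (4 e + 1)\<close> one needs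
  \<open>- \<gamma> (4 e + 1)\<close> and \<open>4 \<gamma>\<^sup>2 u\<^sup>2 + \<gamma> (4 e + 1)\<close> (\<open>Dp 2\<close>, \<open>Dp 4\<close>).\<close>

definition Dp :: "nat \<Rightarrow> 'a list" where
  "Dp i = (if i = 1 then -\<^sub>P (Pc *\<^sub>P Pd *\<^sub>P X)
     else if i = 2 then -\<^sub>P (Pc *\<^sub>P (F4 *\<^sub>P Pd *\<^sub>P X +\<^sub>P 1\<^sub>P))
     else if i = 3 then Pc *\<^sub>P Pc *\<^sub>P Y +\<^sub>P Pc *\<^sub>P Pd *\<^sub>P X
     else F4 *\<^sub>P (Pc *\<^sub>P Pc *\<^sub>P Y +\<^sub>P Pc *\<^sub>P Pd *\<^sub>P X) +\<^sub>P Pc)"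

lemma four_U: "four \<in> U"
proof -
  have "four = (\<one> \<oplus> \<one>) \<otimes> (\<one> \<oplus> \<one>)" by (simp add: l_distr r_distr)
  then show ?thesis using integral[of "\<one> \<oplus> \<one>" "\<one> \<oplus> \<one>"] two_neq_0 by auto
qed

lemma U_mult: "\<lbrakk>x \<in> U; y \<in> U\<rbrakk> \<Longrightarrow> x \<otimes> y \<in> U" using integral by auto

lemma U_minus: "x \<in> U \<Longrightarrow> \<ominus> x \<in> U" by auto

lemma PcPd: "Pc \<in> carrier PR" "Pd \<in> carrier PR" "Y \<in> carrier PR" "F4 = poly_of_const four"
  using c d X_closed by auto

text \<open>The common shape of the four polynomials; in characteristic p its formal derivative is
  the constant \<beta>, which explains squarefreeness.\<close>

definition trinomial :: "'a \<Rightarrow> 'a \<Rightarrow> 'a \<Rightarrow> 'a list" where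
  "trinomial \<alpha> \<beta> \<gamma> = poly_of_const \<alpha> *\<^sub>P Y +\<^sub>P (poly_of_const \<beta> *\<^sub>P X +\<^sub>P poly_of_const \<gamma>)"

lemma Dp_trinomial:
  "Dp 1 = trinomial \<zero> (\<ominus> (c \<otimes> d)) \<zero>"
  "Dp 2 = trinomial \<zero> (\<ominus> (four \<otimes> (c \<otimes> d))) (\<ominus> c)"
  "Dp 3 = trinomial (c \<otimes> c) (c \<otimes> d) \<zero>"
  "Dp 4 = trinomial (four \<otimes> (c \<otimes> c)) (four \<otimes> (c \<otimes> d)) c"
proof -
  note cl = PcPd(1-3) X_closed c d
  have cd: "c \<in> carrier R" "d \<in> carrier R" using c d by auto
  have F: "poly_of_const four \<in> carrier PR" by simp
  show "Dp 1 = trinomial \<zero> (\<ominus> (c \<otimes> d)) \<zero>"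
    unfolding Dp_def trinomial_def using cl by (simp add: P.l_minus)
  show "Dp 3 = trinomial (c \<otimes> c) (c \<otimes> d) \<zero>"
    unfolding Dp_def trinomial_def using cl by simp
  show "Dp 2 = trinomial \<zero> (\<ominus> (four \<otimes> (c \<otimes> d))) (\<ominus> c)"
  proof -
    have "trinomial \<zero> (\<ominus> (four \<otimes> (c \<otimes> d))) (\<ominus> c) =
        -\<^sub>P (F4 *\<^sub>P (Pc *\<^sub>P Pd)) *\<^sub>P X +\<^sub>P -\<^sub>P Pc"
      unfolding trinomial_def using cl by simp
    also have "\<dots> = -\<^sub>P (Pc *\<^sub>P (F4 *\<^sub>P Pd *\<^sub>P X +\<^sub>P 1\<^sub>P))"
      unfolding PcPd(4) using cl(1,2,4) F P.one_closed by algebra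
    finally show ?thesis unfolding Dp_def by simp
  qed
  show "Dp 4 = trinomial (four \<otimes> (c \<otimes> c)) (four \<otimes> (c \<otimes> d)) c"
  proof -
    have "trinomial (four \<otimes> (c \<otimes> c)) (four \<otimes> (c \<otimes> d)) c =
        F4 *\<^sub>P (Pc *\<^sub>P Pc) *\<^sub>P Y +\<^sub>P (F4 *\<^sub>P (Pc *\<^sub>P Pd) *\<^sub>P X +\<^sub>P Pc)"
      unfolding trinomial_def using cl by simp
    also have "\<dots> = F4 *\<^sub>P (Pc *\<^sub>P Pc *\<^sub>P Y +\<^sub>P Pc *\<^sub>P Pd *\<^sub>P X) +\<^sub>P Pc"
      unfolding PcPd(4) using cl(1-4) F by algebra
    finally show ?thesis unfolding Dp_def by simp
  qed
qed

lemma trinomial_closed: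
  "\<lbrakk>\<alpha> \<in> carrier R; \<beta> \<in> carrier R; \<gamma> \<in> carrier R\<rbrakk> \<Longrightarrow> trinomial \<alpha> \<beta> \<gamma> \<in> carrier PR"
  unfolding trinomial_def using X_closed by simp

lemma trinomial_length:
  assumes "\<beta> \<in> U" "\<gamma> \<in> carrier R" and "\<alpha> \<in> carrier R"
  shows "length (trinomial \<alpha> \<beta> \<gamma>) = (if \<alpha> = \<zero> then 2 else 2 * p + 1)"
proof -
  let ?r = "poly_of_const \<beta> *\<^sub>P X +\<^sub>P poly_of_const \<gamma>"
  have X2: "length X = 2" by (simp add: var_def)
  have "poly_of_const \<beta> = [\<beta>]" using assms by (simp add: poly_of_const_eq)
  then have "length (poly_of_const \<beta> *\<^sub>P X) = 2" using length_smult[OF assms(1) X_closed] X2 by simp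
  moreover have "length (poly_of_const \<gamma>) \<le> 1" by (simp add: poly_of_const_eq)
  ultimately have r: "length ?r = 2" "?r \<in> carrier PR"
    using add_lower(1)[of "poly_of_const \<beta> *\<^sub>P X" "poly_of_const \<gamma>"] assms X_closed by auto
  show ?thesis
  proof (cases "\<alpha> = \<zero>")
    case True
    then show ?thesis unfolding trinomial_def using r PcPd(3) by simp
  next
    case False
    then have \<alpha>: "\<alpha> \<in> U" "poly_of_const \<alpha> = [\<alpha>]" using assms by (auto simp: poly_of_const_eq)
    have "length (poly_of_const \<alpha> *\<^sub>P Y) = 2 * p + 1"
      using length_smult[OF \<alpha>(1) PcPd(3)] \<alpha>(2) MonD(2)[OF Mon_var_pow[of "2 * p"]] by simp
    moreover have "2 < 2 * p + 1" using prime_ge_2_nat[OF prime_p] by simp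
    ultimately show ?thesis
      unfolding trinomial_def using add_lower(1)[of "poly_of_const \<alpha> *\<^sub>P Y" ?r] r assms(3) PcPd(3) False by simp
  qed
qed

definition Ix :: "nat set" where "Ix = {1, 2, 3, 4}"

lemma Dp_props:
  assumes "i \<in> Ix"
  shows "Dp i \<in> carrier PR" "length (Dp i) = (if i \<le> 2 then 2 else 2 * p + 1)"
    "\<lbrakk>E \<in> Mon n; pirreducible (carrier R) E\<rbrakk> \<Longrightarrow> \<not> (E *\<^sub>P E) pdivides (Dp i)"
proof -
  have "\<exists>\<alpha> \<beta> \<gamma>. Dp i = trinomial \<alpha> \<beta> \<gamma> \<and> \<alpha> \<in> carrier R \<and> \<beta> \<in> U \<and> \<gamma> \<in> carrier R \<and> (\<alpha> = \<zero> \<longleftrightarrow> i \<le> 2)"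
  proof -
    have "c \<otimes> d \<in> U" "c \<otimes> c \<in> U" "four \<otimes> (c \<otimes> d) \<in> U" "four \<otimes> (c \<otimes> c) \<in> U"
      using U_mult[OF c d] U_mult[OF c c] U_mult[OF four_U U_mult[OF c d]] U_mult[OF four_U U_mult[OF c c]] by auto
    note u = this U_minus[OF this(1)] U_minus[OF this(3)]
    consider "i = 1" | "i = 2" | "i = 3" | "i = 4" using assms unfolding Ix_def by auto
    then show ?thesis
    proof cases
      case 1 then show ?thesis using Dp_trinomial(1) u(5)
        by (intro exI[of _ \<zero>] exI[of _ "\<ominus> (c \<otimes> d)"]) auto
    next
      case 2 then show ?thesis using Dp_trinomial(2) u(6) c
        by (intro exI[of _ \<zero>] exI[of _ "\<ominus> (four \<otimes> (c \<otimes> d))"] exI[of _ "\<ominus> c"]) auto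
    next
      case 3 then show ?thesis using Dp_trinomial(3) u(1,2)
        by (intro exI[of _ "c \<otimes> c"] exI[of _ "c \<otimes> d"] exI[of _ \<zero>]) auto
    next
      case 4 then show ?thesis using Dp_trinomial(4) u(3,4) c
        by (intro exI[of _ "four \<otimes> (c \<otimes> c)"] exI[of _ "four \<otimes> (c \<otimes> d)"] exI[of _ c]) auto
    qed
  qed
  then obtain \<alpha> \<beta> \<gamma> where t: "Dp i = trinomial \<alpha> \<beta> \<gamma>" "\<alpha> \<in> carrier R" "\<beta> \<in> U" "\<gamma> \<in> carrier R" "\<alpha> = \<zero> \<longleftrightarrow> i \<le> 2"
    by blast
  show "Dp i \<in> carrier PR" using t trinomial_closed by auto
  show "length (Dp i) = (if i \<le> 2 then 2 else 2 * p + 1)" using t trinomial_length[OF t(3,4,2)] by simp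
  show "\<not> (E *\<^sub>P E) pdivides (Dp i)" if "E \<in> Mon n" "pirreducible (carrier R) E"
    unfolding t(1) trinomial_def by (rule trinomial_squarefree[OF t(2,3,4) that])
qed

lemma Dp_nonzero: "i \<in> Ix \<Longrightarrow> Dp i \<noteq> []"
  using Dp_props(2)[of i] by (auto split: if_splits)

text \<open>The monic associate, required because reciprocity is stated for monic
  polynomials.\<close>

definition mDp :: "nat \<Rightarrow> 'a list" where
  "mDp i = (SOME f'. f' \<in> Mon (degree (Dp i)) \<and> Dp i = [lc (Dp i)] *\<^sub>P f')"

lemma mDp:
  assumes "i \<in> Ix"
  shows "mDp i \<in> Mon (degree (Dp i))" "Dp i = [lc (Dp i)] *\<^sub>P mDp i" "lc (Dp i) \<in> U"
proof -
  have "mDp i \<in> Mon (degree (Dp i)) \<and> Dp i = [lc (Dp i)] *\<^sub>P mDp i"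
    unfolding mDp_def by (rule someI_ex[OF normalize_monic[OF Dp_props(1)[OF assms] Dp_nonzero[OF assms]]])
  then show "mDp i \<in> Mon (degree (Dp i))" "Dp i = [lc (Dp i)] *\<^sub>P mDp i" by blast+
  show "lc (Dp i) \<in> U" using lc_closed lc_eq_0 Dp_props(1) Dp_nonzero assms by auto
qed

lemma irreducible_pdivides_mDp:
  assumes "E \<in> Mon n" "pirreducible (carrier R) E" "i \<in> Ix"
  shows "E pdivides (mDp i) \<longleftrightarrow> E pdivides (Dp i)"
  using irreducible_pdivides_smult[OF assms(1,2) mDp(3)[OF assms(3)] MonD(1)[OF mDp(1)[OF assms(3)]]]
    mDp(2)[OF assms(3)] by simp

lemma mDp_squarefree:
  assumes "E \<in> Mon n" "pirreducible (carrier R) E" "i \<in> Ix"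
  shows "\<not> (E *\<^sub>P E) pdivides (mDp i)"
proof
  assume "(E *\<^sub>P E) pdivides (mDp i)"
  then have "(E *\<^sub>P E) pdivides ([lc (Dp i)] *\<^sub>P mDp i)"
    using pdivides_mult_left MonD(1)[OF assms(1)] MonD(1)[OF mDp(1)] const_PR mDp(3) assms(3) by auto
  then show False using Dp_props(3)[OF assms(3,1,2)] mDp(2)[OF assms(3)] by simp
qed

lemma Dp_irreducible_divisor:
  assumes "i \<in> Ix" shows "\<exists>n E. E \<in> Mon n \<and> pirreducible (carrier R) E \<and> E pdivides (Dp i)"
proof -
  have "0 < degree (Dp i)" using Dp_props(2)[OF assms] prime_ge_2_nat[OF prime_p] by auto
  then show ?thesis
    using irreducible_divisor_exists[OF mDp(1)[OF assms]] irreducible_pdivides_mDp assms by blast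
qed

text \<open>Four relations suffice: \<open>Dp 1\<close> is a constant times X, \<open>Dp 2\<close>
  is -c modulo X, \<open>Dp 4\<close> = 4 \<open>Dp 3\<close> + c, and \<open>Dp 4\<close> +
  \<open>Dp 2\<close> = 4 c^2 X^(2p). The pairs (1, 3) and (2, 3) are absent: X divides both
  \<open>Dp 1\<close> and \<open>Dp 3\<close>, and \<open>Dp 2\<close> and \<open>Dp 3\<close> can
  share a root.\<close>

lemma Dp_common_divisors:
  assumes E: "E \<in> Mon n" "pirreducible (carrier R) E"
  shows "E pdivides (Dp 1) \<Longrightarrow> \<not> E pdivides (Dp 2)"
    and "E pdivides (Dp 1) \<Longrightarrow> \<not> E pdivides (Dp 4)"
    and "E pdivides (Dp 2) \<Longrightarrow> \<not> E pdivides (Dp 4)"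
    and "E pdivides (Dp 3) \<Longrightarrow> \<not> E pdivides (Dp 4)"
proof -
  note ED = MonD[OF E(1)]
  have F: "F4 \<in> carrier PR" by simp
  note cl = PcPd(1-3) X_closed F P.one_closed ED(1)
  have Dc: "Dp i \<in> carrier PR" if "i \<in> Ix" for i using Dp_props(1)[OF that] .
  have nc: "\<not> E pdivides Pc" using irreducible_not_pdivides_const[OF E c] c by (simp add: poly_of_const_eq)
  have XY: "E pdivides Y" if "E pdivides X"
  proof -
    have "Y = X ^\<^sub>P (2 * p - 1) *\<^sub>P X" using p_pos P.nat_pow_Suc[of X "2 * p - 1"] by (cases p) auto
    then show ?thesis using pdivides_mult_left[OF that cl(7) X_closed, of "X ^\<^sub>P (2 * p - 1)"] X_closed by simp
  qed
  have d1X: "E pdivides X" if "E pdivides (Dp 1)"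
  proof -
    have "\<ominus> (c \<otimes> d) \<in> U" using U_minus U_mult c d by blast
    moreover have "Dp 1 = [\<ominus> (c \<otimes> d)] *\<^sub>P X"
    proof -
      have "Dp 1 = poly_of_const (\<ominus> (c \<otimes> d)) *\<^sub>P X"
        unfolding Dp_trinomial(1) trinomial_def using cl(3,4) c d by simp
      then show ?thesis using calculation by (simp add: poly_of_const_eq)
    qed
    ultimately show ?thesis using irreducible_pdivides_smult[OF E _ X_closed] that by simp
  qed
  have X2: "\<not> E pdivides (Dp 2)" if "E pdivides X"
  proof
    assume 2: "E pdivides (Dp 2)"
    have "E pdivides (-\<^sub>P (Pc *\<^sub>P F4 *\<^sub>P Pd) *\<^sub>P X -\<^sub>P Dp 2)"
      using pdivides_minus[OF pdivides_mult_left[OF that cl(7) X_closed] 2 cl(7)] cl by simp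
    moreover have "-\<^sub>P (Pc *\<^sub>P F4 *\<^sub>P Pd) *\<^sub>P X -\<^sub>P Dp 2 = Pc"
    proof -
      have "Dp 2 = -\<^sub>P (Pc *\<^sub>P (F4 *\<^sub>P Pd *\<^sub>P X +\<^sub>P 1\<^sub>P))" unfolding Dp_def by simp
      then show ?thesis using cl(1,2,4,6) by algebra
    qed
    ultimately show False using nc by simp
  qed
  have D4: "Dp 4 = F4 *\<^sub>P Dp 3 +\<^sub>P Pc" unfolding Dp_def by simp
  have D3: "Dp 3 = Pc *\<^sub>P Pc *\<^sub>P Y +\<^sub>P Pc *\<^sub>P Pd *\<^sub>P X" unfolding Dp_def by simp
  have D3c: "Dp 3 \<in> carrier PR" "Dp 4 \<in> carrier PR" "Dp 2 \<in> carrier PR" using Dc unfolding Ix_def by auto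
  show d34: "\<not> E pdivides (Dp 4)" if "E pdivides (Dp 3)"
  proof
    assume 4: "E pdivides (Dp 4)"
    have "E pdivides (Dp 4 -\<^sub>P F4 *\<^sub>P Dp 3)"
      using pdivides_minus[OF 4 pdivides_mult_left[OF that cl(7) D3c(1) F] cl(7)] .
    moreover have "Dp 4 -\<^sub>P F4 *\<^sub>P Dp 3 = Pc" unfolding D4 using D3c(1) cl(1,6) by algebra
    ultimately show False using nc by simp
  qed
  have X4: "\<not> E pdivides (Dp 4)" if "E pdivides X"
  proof -
    have "E pdivides (Dp 3)"
      unfolding D3 using pdivides_add[OF pdivides_mult_left[OF XY[OF that]] pdivides_mult_left[OF that]] cl by simp
    then show ?thesis using d34 by simp
  qed
  show "\<not> E pdivides (Dp 2)" if "E pdivides (Dp 1)" using d1X X2 that by simp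
  show "\<not> E pdivides (Dp 4)" if "E pdivides (Dp 1)" using d1X X4 that by simp
  show "\<not> E pdivides (Dp 4)" if "E pdivides (Dp 2)"
  proof
    assume 4: "E pdivides (Dp 4)"
    have "E pdivides (Dp 4 +\<^sub>P Dp 2)" using pdivides_add[OF 4 that cl(7)] .
    moreover have "Dp 4 +\<^sub>P Dp 2 = F4 *\<^sub>P (Pc *\<^sub>P Pc) *\<^sub>P Y"
    proof -
      have id: "(G *\<^sub>P (C *\<^sub>P C *\<^sub>P Z +\<^sub>P C *\<^sub>P D *\<^sub>P W) +\<^sub>P C) +\<^sub>P
          -\<^sub>P (C *\<^sub>P (G *\<^sub>P D *\<^sub>P W +\<^sub>P 1\<^sub>P)) = G *\<^sub>P (C *\<^sub>P C) *\<^sub>P Z"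
        if "C \<in> carrier PR" "D \<in> carrier PR" "Z \<in> carrier PR" "W \<in> carrier PR" "G \<in> carrier PR" for C D Z W G
      proof -
        have "C *\<^sub>P (G *\<^sub>P D *\<^sub>P W +\<^sub>P 1\<^sub>P) = C *\<^sub>P (G *\<^sub>P D *\<^sub>P W) +\<^sub>P C"
          using that by (simp add: P.r_distr)
        then show ?thesis using that by algebra
      qed
      have "Dp 2 = -\<^sub>P (Pc *\<^sub>P (F4 *\<^sub>P Pd *\<^sub>P X +\<^sub>P 1\<^sub>P))" unfolding Dp_def by simp
      then show ?thesis unfolding D4 D3 using id[OF cl(1-5)] by simp
    qed
    moreover have "F4 *\<^sub>P (Pc *\<^sub>P Pc) = [four \<otimes> (c \<otimes> c)]" "four \<otimes> (c \<otimes> c) \<in> U"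
    proof -
      show *: "four \<otimes> (c \<otimes> c) \<in> U" using U_mult four_U c by blast
      have "F4 *\<^sub>P (Pc *\<^sub>P Pc) = poly_of_const (four \<otimes> (c \<otimes> c))" using c by simp
      then show "F4 *\<^sub>P (Pc *\<^sub>P Pc) = [four \<otimes> (c \<otimes> c)]" using * by (simp add: poly_of_const_eq)
    qed
    ultimately have "E pdivides Y" using irreducible_pdivides_smult[OF E _ cl(3)] by simp
    moreover have "E pdivides X" if "E pdivides (X ^\<^sub>P k)" for k :: nat
      using that
    proof (induction k)
      case 0 then show ?case using irreducible_not_pdivides_const[OF E, of \<one>] one_PR by simp
    next
      case (Suc k) then show ?case using irreducible_prime[OF E, of "X ^\<^sub>P k" X] X_closed by auto
    qed
    ultimately have "E pdivides X" by blast
    then show False using X4 4 by blast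
  qed
qed

text \<open>The largest index in S serves. \<open>Dp 4\<close> is coprime to the other three.
  \<open>Dp 3\<close> is squarefree of degree 2 p > 2, so some irreducible factor of it divides
  neither of the linear \<open>Dp 1\<close> and \<open>Dp 2\<close>. \<open>Dp 2\<close> is coprime
  to \<open>Dp 1\<close>.\<close>

lemma Dp_independent:
  assumes "S \<subseteq> Ix" "S \<noteq> {}"
  shows "\<exists>i\<in>S. \<exists>n E. E \<in> Mon n \<and> pirreducible (carrier R) E \<and> E pdivides (Dp i) \<and> (\<forall>j\<in>S - {i}. \<not> E pdivides (Dp j))"
proof -
  have S: "j = 1 \<or> j = 2 \<or> j = 3 \<or> j = 4" if "j \<in> S" for j using assms(1) that unfolding Ix_def by auto
  have Ix: "1 \<in> Ix" "2 \<in> Ix" "3 \<in> Ix" "4 \<in> Ix" unfolding Ix_def by auto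
  consider "4 \<in> S" | "4 \<notin> S" "3 \<in> S" | "4 \<notin> S" "3 \<notin> S" "2 \<in> S" | "4 \<notin> S" "3 \<notin> S" "2 \<notin> S" "1 \<in> S"
    using assms(2) S by fastforce
  then show ?thesis
  proof cases
    case 1
    obtain n E where E: "E \<in> Mon n" "pirreducible (carrier R) E" "E pdivides (Dp 4)"
      using Dp_irreducible_divisor[OF Ix(4)] by blast
    have "\<not> E pdivides (Dp j)" if "j \<in> S - {4}" for j
      using S[of j] that Dp_common_divisors(2-4)[OF E(1,2)] E(3) by blast
    then show ?thesis using 1 E by blast
  next
    case 2
    have "\<exists>n E. E \<in> Mon n \<and> pirreducible (carrier R) E \<and> E pdivides (Dp 3) \<and> \<not> E pdivides (Dp 1) \<and> \<not> E pdivides (Dp 2)"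
    proof (rule ccontr)
      assume none: "\<not> ?thesis"
      note Dc = Dp_props(1)[OF Ix(1)] Dp_props(1)[OF Ix(2)]
      have "(mDp 3) pdivides (Dp 1 *\<^sub>P Dp 2)"
      proof (rule squarefree_pdivides[OF mDp(1)[OF Ix(3)]])
        fix E n assume E: "E \<in> Mon n" "pirreducible (carrier R) E" "E pdivides (mDp 3)"
        then have "E pdivides (Dp 1) \<or> E pdivides (Dp 2)"
          using none irreducible_pdivides_mDp[OF E(1,2) Ix(3)] by blast
        then have "E pdivides (Dp 1 *\<^sub>P Dp 2)"
          using pdivides_mult[of E "Dp 1" "Dp 2"] pdivides_mult_left[of E "Dp 2" "Dp 1"] Dc MonD(1)[OF E(1)] by blast
        then show "\<not> (E *\<^sub>P E) pdivides (mDp 3) \<and> E pdivides (Dp 1 *\<^sub>P Dp 2)"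
          using mDp_squarefree[OF E(1,2) Ix(3)] by blast
      qed (use Dc in simp)
      then have "degree (mDp 3) \<le> degree (Dp 1 *\<^sub>P Dp 2)"
        using pdivides_imp_degree_le[OF carrier_is_subring MonD(1)[OF mDp(1)[OF Ix(3)]], of "Dp 1 *\<^sub>P Dp 2"]
          Dc length_mult(2)[OF Dc Dp_nonzero[OF Ix(1)] Dp_nonzero[OF Ix(2)]] by simp
      then show False
        using MonD(2)[OF mDp(1)[OF Ix(3)]] Dp_props(2)[OF Ix(3)] Dp_props(2)[OF Ix(1)] Dp_props(2)[OF Ix(2)]
          length_mult(1)[OF Dc Dp_nonzero[OF Ix(1)] Dp_nonzero[OF Ix(2)]] prime_ge_2_nat[OF prime_p] by simp
    qed
    then obtain n E where E: "E \<in> Mon n" "pirreducible (carrier R) E" "E pdivides (Dp 3)"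
      "\<not> E pdivides (Dp 1)" "\<not> E pdivides (Dp 2)" by blast
    have "\<not> E pdivides (Dp j)" if "j \<in> S - {3}" for j using S[of j] that 2 E by blast
    then show ?thesis using 2 E by blast
  next
    case 3
    obtain n E where E: "E \<in> Mon n" "pirreducible (carrier R) E" "E pdivides (Dp 2)"
      using Dp_irreducible_divisor[OF Ix(2)] by blast
    have "\<not> E pdivides (Dp j)" if "j \<in> S - {2}" for j
      using S[of j] that Dp_common_divisors(1)[OF E(1,2)] E(3) 3 by blast
    then show ?thesis using 3 E by blast
  next
    case 4
    obtain n E where E: "E \<in> Mon n" "pirreducible (carrier R) E" "E pdivides (Dp 1)"
      using Dp_irreducible_divisor[OF Ix(1)] by blast
    have "\<not> E pdivides (Dp j)" if "j \<in> S - {1}" for j using S[of j] that 4 by blast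
    then show ?thesis using 4 E by blast
  qed
qed

text \<open>Reciprocity turns the symbol into a character of f modulo \<open>mDp i\<close>, up to a
  sign raised to the degree of f. That sign is constant in each degree, hence harmless in character
  sums.\<close>

lemma J_Dp:
  assumes "i \<in> Ix" "f \<in> Mon m"
  shows "J f (Dp i) = (qchar (lc (Dp i)) * sgn1 ^ degree (Dp i)) ^ m * J (mDp i) f"
proof -
  have "J f (Dp i) = J f [lc (Dp i)] * J f (mDp i)"
    by (subst (1) mDp(2)[OF assms(1)])
      (rule J_mult[OF assms(2) const_PR[OF mDp(3)[OF assms(1)]] MonD(1)[OF mDp(1)[OF assms(1)]]])
  also have "\<dots> = qchar (lc (Dp i)) ^ m * (sgn1 ^ (degree (Dp i) * m) * J (mDp i) f)"
    using J_const[OF assms(2) mDp(3)[OF assms(1)]] J_reciprocity[OF mDp(1)[OF assms(1)] assms(2)] by simp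
  finally show ?thesis by (simp add: power_mult_distrib power_mult)
qed

text \<open>Provides a single modulus, the product of the \<open>mDp i\<close>, for the whole
  product of characters. The last clause keeps it prime to any E that divides none of the
  \<open>Dp j\<close>.\<close>

lemma mDp_product:
  assumes "finite S" "S \<subseteq> Ix"
  shows "\<exists>N B. B \<in> Mon N \<and> (\<forall>m. \<forall>f\<in>Mon m. J B f = (\<Prod>i\<in>S. J (mDp i) f)) \<and>
    (\<forall>n E. E \<in> Mon n \<longrightarrow> pirreducible (carrier R) E \<longrightarrow> (\<forall>j\<in>S. \<not> E pdivides (Dp j)) \<longrightarrow> \<not> E pdivides B)"
  using assms
proof (induction S rule: finite_induct)
  case empty
  have one: "1\<^sub>P \<in> Mon 0" using Mon_var_pow[of 0] by simp
  have "J 1\<^sub>P f = 1" for f by (simp add: J_def one_PR MonLt_def)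
  moreover have "\<not> E pdivides 1\<^sub>P" if "E \<in> Mon n" "pirreducible (carrier R) E" for E n
    using irreducible_not_pdivides_const[OF that, of \<one>] one_PR by simp
  ultimately show ?case
    using one by (intro exI[of _ 0] exI[of _ "1\<^sub>P"]) simp
next
  case (insert i S)
  then obtain N B where B: "B \<in> Mon N" "\<forall>m. \<forall>f\<in>Mon m. J B f = (\<Prod>i\<in>S. J (mDp i) f)"
    "\<forall>n E. E \<in> Mon n \<longrightarrow> pirreducible (carrier R) E \<longrightarrow> (\<forall>j\<in>S. \<not> E pdivides (Dp j)) \<longrightarrow> \<not> E pdivides B"
    by auto
  have i: "i \<in> Ix" using insert.prems by simp
  note M = Mon_mult[OF mDp(1)[OF i] B(1)]
  have "J (mDp i *\<^sub>P B) f = (\<Prod>i\<in>insert i S. J (mDp i) f)" if "f \<in> Mon m" for m f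
    using J_mult_lower[OF that mDp(1)[OF i] B(1)] B(2) that insert.hyps by simp
  moreover have "\<not> E pdivides (mDp i *\<^sub>P B)"
    if E: "E \<in> Mon n" "pirreducible (carrier R) E" "\<forall>j\<in>insert i S. \<not> E pdivides (Dp j)" for n E
    using irreducible_prime[OF E(1,2) MonD(1)[OF mDp(1)[OF i]] MonD(1)[OF B(1)]]
      irreducible_pdivides_mDp[OF E(1,2) i] B(3) E by blast
  ultimately show ?case using M by blast
qed

text \<open>With E from \<open>Dp_independent\<close>, the modulus is E times a cofactor prime to E.
  Its character therefore takes the value -1, and its sums vanish in every degree from that of the
  modulus on.\<close>

lemma sum_J_Dp_vanishes:
  assumes S: "S \<subseteq> Ix" "S \<noteq> {}"
  shows "\<exists>N. \<forall>n\<ge>N. (\<Sum>f\<in>Mon n. \<Prod>i\<in>S. J f (Dp i)) = 0"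
proof -
  have finS: "finite S" using S finite_subset[of S Ix] by (simp add: Ix_def)
  obtain i n E where iE: "i \<in> S" "E \<in> Mon n" "pirreducible (carrier R) E" "E pdivides (Dp i)"
    "\<forall>j\<in>S - {i}. \<not> E pdivides (Dp j)" using Dp_independent[OF S] by blast
  have i: "i \<in> Ix" using iE S by blast
  note ED = MonD[OF iE(2)] and mD = MonD[OF mDp(1)[OF i]]
  have "E pdivides (mDp i)" using irreducible_pdivides_mDp[OF iE(2,3) i] iE(4) by simp
  then obtain C where C: "C \<in> carrier PR" "mDp i = E *\<^sub>P C" by (rule pdividesE)
  have "C \<noteq> []" using C mD(4) zero_PR P.r_null[OF ED(1)] by metis
  have "lc C = \<one>" using lc_mult[OF ED(1) C(1)] C(2) mD(3) ED(3) lc_closed[OF C(1)] by simp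
  then have CM: "C \<in> Mon (length C - 1)" using C(1) \<open>C \<noteq> []\<close> unfolding Mon_def by (cases C) auto
  \<comment> \<open>Squarefreeness is essential here: if E occurred twice, its two symbols would
    cancel.\<close>
  have nEC: "\<not> E pdivides C"
  proof
    assume "E pdivides C"
    then obtain z where "z \<in> carrier PR" "C = E *\<^sub>P z" by (rule pdividesE)
    then have "(E *\<^sub>P E) pdivides (mDp i)" using C(2) ED(1) by (intro pdividesI[of z]) (auto simp: P.m_assoc)
    then show False using mDp_squarefree[OF iE(2,3) i] by blast
  qed
  obtain N B where B: "B \<in> Mon N" "\<forall>m. \<forall>f\<in>Mon m. J B f = (\<Prod>i\<in>S - {i}. J (mDp i) f)" "\<not> E pdivides B"
    using mDp_product[of "S - {i}"] finS S iE(2,3,5) by blast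
  have CB: "C *\<^sub>P B \<in> Mon (length C - 1 + N)" using Mon_mult[OF CM B(1)] .
  have "\<not> E pdivides (C *\<^sub>P B)" using irreducible_prime[OF iE(2,3) C(1) MonD(1)[OF B(1)]] nEC B(3) by blast
  then obtain m f0 where f0: "f0 \<in> Mon m" "J (E *\<^sub>P (C *\<^sub>P B)) f0 = -1"
    using J_nontrivial_mult[OF iE(2,3) CB] by blast
  have "E *\<^sub>P (C *\<^sub>P B) = mDp i *\<^sub>P B" using C ED(1) MonD(1)[OF B(1)] by (simp add: P.m_assoc)
  then have f0': "J (mDp i *\<^sub>P B) f0 = -1" using f0(2) by simp
  note M = Mon_mult[OF mDp(1)[OF i] B(1)]
  have prod: "J (mDp i *\<^sub>P B) f = (\<Prod>i\<in>S. J (mDp i) f)" if "f \<in> Mon k" for f k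
    using J_mult_lower[OF that mDp(1)[OF i] B(1)] B(2) that prod.remove[OF finS iE(1), of "\<lambda>i. J (mDp i) f"] by simp
  have "(\<Sum>f\<in>Mon k. \<Prod>i\<in>S. J f (Dp i)) = 0" if k: "degree (Dp i) + N \<le> k" for k
  proof -
    have "(\<Prod>i\<in>S. J f (Dp i)) = (\<Prod>i\<in>S. (qchar (lc (Dp i)) * sgn1 ^ degree (Dp i)) ^ k) * J (mDp i *\<^sub>P B) f"
      if f: "f \<in> Mon k" for f
    proof -
      have "(\<Prod>i\<in>S. J f (Dp i)) = (\<Prod>i\<in>S. (qchar (lc (Dp i)) * sgn1 ^ degree (Dp i)) ^ k * J (mDp i) f)"
        using J_Dp[OF _ f] S by (intro prod.cong) auto
      then show ?thesis using prod[OF f] by (simp add: prod.distrib)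
    qed
    then have "(\<Sum>f\<in>Mon k. \<Prod>i\<in>S. J f (Dp i)) =
        (\<Sum>f\<in>Mon k. (\<Prod>i\<in>S. (qchar (lc (Dp i)) * sgn1 ^ degree (Dp i)) ^ k) * J (mDp i *\<^sub>P B) f)"
      by (intro sum.cong) auto
    also have "\<dots> = (\<Prod>i\<in>S. (qchar (lc (Dp i)) * sgn1 ^ degree (Dp i)) ^ k) * (\<Sum>f\<in>Mon k. J (mDp i *\<^sub>P B) f)"
      by (simp only: sum_distrib_left)
    also have "(\<Sum>f\<in>Mon k. J (mDp i *\<^sub>P B) f) = 0"
      using sum_J_eq_0[OF M MonD(1)[OF f0(1)] f0' k] .
    finally show ?thesis by simp
  qed
  then show ?thesis by blast
qed

end

section \<open>Closed points\<close>

context finite_field_odd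
begin

lemma closed_point_iff: "closed_point R P \<longleftrightarrow> P \<in> Mon (degree P) \<and> pirreducible (carrier R) P"
proof -
  have "P \<noteq> []" if "P \<in> carrier PR" "pirreducible (carrier R) P"
    using pirreducibleE(1)[OF carrier_is_subring that] .
  then show ?thesis unfolding closed_point_def Mon_def lc_def using one_not_zero by auto
qed

lemma res_const_nonzero:
  assumes "E \<in> Mon n" "pirreducible (carrier R) E" "a \<in> U"
  shows "res_const R E a \<noteq> \<zero>\<^bsub>res_field R E\<^esub>"
  using res_eq_0_iff[OF MonD(1)[OF assms(1)] const_PR[OF assms(3)]] irreducible_not_pdivides_const[OF assms] assms(3)
  by (simp add: res_const_def poly_of_const_eq)

lemma res_field_odd:
  assumes "E \<in> Mon n" "pirreducible (carrier R) E"
  shows "finite_field_odd (res_field R E)"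
proof -
  interpret \<iota>: ring_hom_ring R "res_field R E" "res_const R E" using res_const_hom MonD(1)[OF assms(1)] by simp
  have "\<one>\<^bsub>res_field R E\<^esub> \<oplus>\<^bsub>res_field R E\<^esub> \<one>\<^bsub>res_field R E\<^esub> \<noteq> \<zero>\<^bsub>res_field R E\<^esub>"
    using res_const_nonzero[OF assms, of "\<one> \<oplus> \<one>"] two_neq_0 by simp
  then show ?thesis
    using res_field[OF assms] by (intro finite_field_odd.intro finite_field_odd_axioms.intro)
qed

text \<open>Restricting to monic polynomials removes all units except 1, so that each prime has a
  single representative, as \<open>Pr_divides_Pr\<close> demands.\<close>

definition monic_monoid :: "'a list monoid" where
  "monic_monoid = \<lparr>carrier = {f \<in> carrier PR. lc f = \<one>}, monoid.mult = monoid.mult PR, one = 1\<^sub>P\<rparr>"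

lemma monic_iff: "f \<in> carrier monic_monoid \<longleftrightarrow> f \<in> Mon (degree f)"
proof -
  have "f \<noteq> []" if "lc f = \<one>" using that one_not_zero by (auto simp: lc_def)
  then show ?thesis unfolding monic_monoid_def Mon_def by auto
qed

lemma monic_degree_eq: "{x \<in> carrier monic_monoid. degree x = n} = Mon n"
proof (intro equalityI subsetI)
  fix x assume "x \<in> {x \<in> carrier monic_monoid. degree x = n}"
  then have x: "x \<in> carrier monic_monoid" "degree x = n" by auto
  show "x \<in> Mon n" using x(1) unfolding monic_iff x(2) .
next
  fix x assume x: "x \<in> Mon n"
  then have "degree x = n" using MonD(2)[OF x] by simp
  then show "x \<in> {x \<in> carrier monic_monoid. degree x = n}" using x monic_iff[of x] by simp
qed

lemma monic_divides_iff:
  assumes "f \<in> carrier monic_monoid" "g \<in> carrier monic_monoid"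
  shows "f divides\<^bsub>monic_monoid\<^esub> g \<longleftrightarrow> f pdivides g"
proof
  assume "f divides\<^bsub>monic_monoid\<^esub> g"
  then show "f pdivides g" unfolding factor_def monic_monoid_def by (auto intro: pdividesI)
next
  assume "f pdivides g"
  then obtain k where k: "k \<in> carrier PR" "g = f *\<^sub>P k" by (rule pdividesE)
  have "lc k = \<one>"
    using lc_mult[of f k] k assms lc_closed[OF k(1)] unfolding monic_monoid_def by simp
  then show "f divides\<^bsub>monic_monoid\<^esub> g" using k unfolding factor_def monic_monoid_def by auto
qed

lemma monic_arith_semigroup:
  "arith_semigroup monic_monoid (\<lambda>f. degree f) {P. closed_point R P} (card (carrier R))"
proof -
  have one: "1\<^sub>P \<in> Mon 0" using Mon_var_pow[of 0] by simp
  have M: "f \<in> carrier PR" "f \<noteq> []" "lc f = \<one>" "f \<in> Mon (degree f)" if "f \<in> carrier monic_monoid" for f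
    using that monic_iff MonD by blast+
  have cp: "P \<in> carrier monic_monoid" "P \<in> Mon (degree P)" "pirreducible (carrier R) P" if "closed_point R P" for P
    using that closed_point_iff monic_iff by auto
  interpret comm_monoid monic_monoid
  proof (rule comm_monoidI)
    fix x y assume "x \<in> carrier monic_monoid" "y \<in> carrier monic_monoid"
    then show "x \<otimes>\<^bsub>monic_monoid\<^esub> y \<in> carrier monic_monoid"
      unfolding monic_monoid_def using lc_mult by auto
  next
    show "\<one>\<^bsub>monic_monoid\<^esub> \<in> carrier monic_monoid"
      unfolding monic_monoid_def using MonD[OF one] by simp
  qed (auto simp: monic_monoid_def P.m_ac)
  show ?thesis
  proof unfold_locales
    fix x y z assume xyz: "x \<in> carrier monic_monoid" "y \<in> carrier monic_monoid" "z \<in> carrier monic_monoid"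
      and "x \<otimes>\<^bsub>monic_monoid\<^esub> y = x \<otimes>\<^bsub>monic_monoid\<^esub> z"
    then have "x *\<^sub>P y = x *\<^sub>P z" by (simp add: monic_monoid_def)
    then show "y = z" using P.m_lcancel[OF _ M(1)[OF xyz(1)] M(1)[OF xyz(2)] M(1)[OF xyz(3)]] M(2)[OF xyz(1)] zero_PR by simp
  next
    fix x y assume "x \<in> carrier monic_monoid" "y \<in> carrier monic_monoid"
    then show "degree (x \<otimes>\<^bsub>monic_monoid\<^esub> y) = degree x + degree y"
      using MonD(2)[OF Mon_mult[OF M(4) M(4), of x y]] by (simp add: monic_monoid_def)
  next
    fix n
    show "card {x \<in> carrier monic_monoid. degree x = n} = card (carrier R) ^ n"
      unfolding monic_degree_eq by (rule card_Mon)
  next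
    have "{\<zero>, \<one>} \<subseteq> carrier R" by auto
    then have "card {\<zero>, \<one>} \<le> card (carrier R)" using finite_carrier card_mono by blast
    then show "2 \<le> card (carrier R)" using one_not_zero by auto
  next
    fix P assume "P \<in> {P. closed_point R P}"
    then show "P \<in> carrier monic_monoid" using cp by simp
  next
    fix P assume "P \<in> {P. closed_point R P}"
    then show "0 < degree P" using irreducible_degree_pos[OF cp(2,3)] by simp
  next
    fix P x y assume P: "P \<in> {P. closed_point R P}"
      and x: "x \<in> carrier monic_monoid" and y: "y \<in> carrier monic_monoid"
      and dvd: "P divides\<^bsub>monic_monoid\<^esub> x \<otimes>\<^bsub>monic_monoid\<^esub> y"
    have "P pdivides (x *\<^sub>P y)"
    proof -
      have "x \<otimes>\<^bsub>monic_monoid\<^esub> y = x *\<^sub>P y" by (simp add: monic_monoid_def)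
      moreover have "P \<in> carrier monic_monoid" using cp(1) P by blast
      ultimately show ?thesis using dvd monic_divides_iff[OF _ m_closed[OF x y]] by metis
    qed
    then have "P pdivides x \<or> P pdivides y"
      using irreducible_prime[OF cp(2,3) M(1)[OF x] M(1)[OF y]] P by blast
    then show "P divides\<^bsub>monic_monoid\<^esub> x \<or> P divides\<^bsub>monic_monoid\<^esub> y"
      using monic_divides_iff[of P x] monic_divides_iff[of P y] cp(1) P x y by blast
  next
    fix P Q assume P: "P \<in> {P. closed_point R P}" and Q: "Q \<in> {P. closed_point R P}"
      and dvd: "P divides\<^bsub>monic_monoid\<^esub> Q"
    obtain k where k: "k \<in> carrier monic_monoid" "Q = P *\<^sub>P k"
      using dvd unfolding factor_def by (auto simp: monic_monoid_def)
    have PQ: "P \<in> carrier PR" "Q \<in> carrier PR" using M(1) cp(1) P Q by blast+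
    have "P \<in> Units PR \<or> k \<in> Units PR"
      using pirreducibleE(3)[OF carrier_is_subring PQ(2) cp(3) PQ(1) M(1)[OF k(1)] k(2)] Q by simp
    moreover have "P \<notin> Units PR" using pirreducibleE(2)[OF carrier_is_subring PQ(1) cp(3)] P by simp
    ultimately have "degree k = 0" using univ_poly_units'[OF carrier_is_subfield, of k] by simp
    then have "k = [\<one>]" using M(4)[OF k(1)] Mon_list[of k 0] by auto
    then show "P = Q" using k(2) PQ by (simp add: one_PR[symmetric])
  next
    fix x assume x: "x \<in> carrier monic_monoid" "x \<noteq> \<one>\<^bsub>monic_monoid\<^esub>"
    have "degree x \<noteq> 0"
    proof
      assume "degree x = 0"
      then have "x = [\<one>]" using M(4)[OF x(1)] Mon_list[of x 0] by auto
      then show False using x(2) by (simp add: monic_monoid_def one_PR)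
    qed
    then obtain k E where E: "E \<in> Mon k" "pirreducible (carrier R) E" "E pdivides x"
      using irreducible_divisor_exists[OF M(4)[OF x(1)]] by blast
    then have "closed_point R E" using closed_point_iff MonD(2)[OF E(1)] by simp
    then show "\<exists>P\<in>{P. closed_point R P}. P divides\<^bsub>monic_monoid\<^esub> x"
      using monic_divides_iff[of E x] cp(1) E(3) x(1) by blast
  qed
qed

end

section \<open>The two quartics over the residue field\<close>

context finite_field_char
begin

lemma res_field_char:
  assumes "E \<in> Mon n" "pirreducible (carrier R) E"
  shows "finite_field_char (res_field R E) p"
proof -
  interpret \<iota>: ring_hom_ring R "res_field R E" "res_const R E" using res_const_hom MonD(1)[OF assms(1)] by simp
  show ?thesis
    using \<iota>.hom_add_pow[OF one_closed, of p] char_p prime_p odd_p res_field_odd[OF assms]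
    by (intro finite_field_char.intro finite_field_char_axioms.intro) auto
qed

text \<open>A relation for cr y^2 becomes, under Frobenius, a relation for \<open>\<gamma>\<close>
  v^2 with v = y^p; multiplying by \<open>\<gamma>\<close> exhibits the square of
  \<open>\<gamma>\<close> v. For the second quartic, with leading coefficient 4 cr, the square is
  that of 2 \<open>\<gamma>\<close> v.\<close>

lemma quartic_pair_irreducible:
  fixes \<gamma> \<delta> u cr e F :: 'a
  defines "F \<equiv> (\<one> \<oplus> \<one>) \<oplus> (\<one> \<oplus> \<one>)"
  assumes cl: "\<gamma> \<in> carrier R" "\<delta> \<in> carrier R" "u \<in> carrier R" and "\<gamma> \<noteq> \<zero>"
    and cr: "cr \<in> carrier R" "cr [^] p = \<gamma>" and e: "e \<in> carrier R" "e [^] p = \<delta> \<otimes> u"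
    and nsq: "\<And>z. z \<in> carrier R \<Longrightarrow> z \<otimes> z \<noteq> \<ominus> (\<gamma> \<otimes> \<delta> \<otimes> u)"
      "\<And>z. z \<in> carrier R \<Longrightarrow> z \<otimes> z \<noteq> \<ominus> (\<gamma> \<otimes> (F \<otimes> \<delta> \<otimes> u \<oplus> \<one>))"
      "\<And>z. z \<in> carrier R \<Longrightarrow> z \<otimes> z \<noteq> \<gamma> \<otimes> \<gamma> \<otimes> u [^] (2 * p) \<oplus> \<gamma> \<otimes> \<delta> \<otimes> u"
      "\<And>z. z \<in> carrier R \<Longrightarrow> z \<otimes> z \<noteq> F \<otimes> (\<gamma> \<otimes> \<gamma> \<otimes> u [^] (2 * p) \<oplus> \<gamma> \<otimes> \<delta> \<otimes> u) \<oplus> \<gamma>"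
  defines "f \<equiv> poly_of_const cr *\<^sub>P ((X ^\<^sub>P 2 +\<^sub>P poly_of_const u) ^\<^sub>P 2) +\<^sub>P poly_of_const e"
  shows "pirreducible (carrier R) f" "pirreducible (carrier R) (1\<^sub>P +\<^sub>P [(4::nat)] \<cdot>\<^bsub>PR\<^esub> f)"
proof -
  note frob = frobenius_add[OF prime_p char_p]
  have F: "F \<in> carrier R" "F \<noteq> \<zero>"
  proof -
    have "F = (\<one> \<oplus> \<one>) \<otimes> (\<one> \<oplus> \<one>)" unfolding F_def by (simp add: l_distr r_distr)
    then show "F \<in> carrier R" "F \<noteq> \<zero>" using integral[of "\<one> \<oplus> \<one>" "\<one> \<oplus> \<one>"] two_neq_0 by auto
  qed
  note cl = cl F(1) and F0 = F(2)
  \<comment> \<open>F is 4 written as a sum of ones, so additivity of Frobenius fixes it.\<close>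
  have Fp: "F [^] p = F" unfolding F_def by (simp add: frob)
  have cr0: "cr \<noteq> \<zero>" using cr \<open>\<gamma> \<noteq> \<zero>\<close> p_pos by (cases p) auto
  have pow2: "x [^] (2 * p) = x [^] p \<otimes> x [^] p" if "x \<in> carrier R" for x
    using nat_pow_mult[OF that, of p p] by (simp add: mult_2)
  have sq: "(g \<otimes> (y \<otimes> y)) [^] p = g [^] p \<otimes> (y [^] p \<otimes> y [^] p)"
    if "g \<in> carrier R" "y \<in> carrier R" for g y
    using that nat_pow_distrib by simp
  have T1: "cr \<otimes> (y \<otimes> y) \<noteq> \<ominus> e" if y: "y \<in> carrier R" for y
  proof
    assume eq: "cr \<otimes> (y \<otimes> y) = \<ominus> e"
    define v where "v = y [^] p"
    have v: "v \<in> carrier R" unfolding v_def using y by simp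
    have h: "\<gamma> \<otimes> (v \<otimes> v) = \<ominus> (\<delta> \<otimes> u)"
      using arg_cong[OF eq, of "\<lambda>x. x [^] p"] sq[OF cr(1) y] nat_pow_minus_odd[OF e(1) odd_p] cr e
      unfolding v_def by simp
    have "(\<gamma> \<otimes> v) \<otimes> (\<gamma> \<otimes> v) = \<gamma> \<otimes> (\<gamma> \<otimes> (v \<otimes> v))" using cl(1) v by (simp add: m_ac)
    also have "\<dots> = \<ominus> (\<gamma> \<otimes> \<delta> \<otimes> u)"
      unfolding h using cl(1-3) by (simp add: r_minus m_assoc)
    finally show False using nsq(1) cl(1) v by simp
  qed
  have T3: "cr \<otimes> (y \<otimes> y) \<noteq> cr \<otimes> (u \<otimes> u) \<oplus> e" if y: "y \<in> carrier R" for y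
  proof
    assume eq: "cr \<otimes> (y \<otimes> y) = cr \<otimes> (u \<otimes> u) \<oplus> e"
    define v w where "v = y [^] p" and "w = u [^] p"
    have v: "v \<in> carrier R" "w \<in> carrier R" unfolding v_def w_def using y cl by auto
    have h: "\<gamma> \<otimes> (v \<otimes> v) = \<gamma> \<otimes> (w \<otimes> w) \<oplus> \<delta> \<otimes> u"
      using arg_cong[OF eq, of "\<lambda>x. x [^] p"] sq[OF cr(1) y] sq[OF cr(1) cl(3)]
        frob[of "cr \<otimes> (u \<otimes> u)" e] cr e cl(3) unfolding v_def w_def by simp
    have "(\<gamma> \<otimes> v) \<otimes> (\<gamma> \<otimes> v) = \<gamma> \<otimes> (\<gamma> \<otimes> (v \<otimes> v))" using cl(1) v by (simp add: m_ac)
    also have "\<dots> = \<gamma> \<otimes> \<gamma> \<otimes> u [^] (2 * p) \<oplus> \<gamma> \<otimes> \<delta> \<otimes> u"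
      unfolding h pow2[OF cl(3)] w_def[symmetric] using cl(1-3) v by (simp add: r_distr m_assoc)
    finally show False using nsq(3) cl(1) v by simp
  qed
  \<comment> \<open>The second quartic is 1 + 4 (cr (T^2 + u)^2 + e) = 4 cr (T^2 + u)^2 + (4 e +
    1).\<close>
  define cr4 where "cr4 = F \<otimes> cr"
  define e4 where "e4 = F \<otimes> e \<oplus> \<one>"
  have cr4: "cr4 \<in> carrier R - {\<zero>}" "cr4 [^] p = F \<otimes> \<gamma>"
    unfolding cr4_def using integral[of F cr] F0 cr0 cl(4) cr Fp nat_pow_distrib by auto
  have e4: "e4 \<in> carrier R" "e4 [^] p = F \<otimes> (\<delta> \<otimes> u) \<oplus> \<one>"
    unfolding e4_def using frob[of "F \<otimes> e" "\<one>"] cl(4) e Fp nat_pow_distrib[of F e p] by auto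
  \<comment> \<open>The square root 2 of F, which makes 4 \<open>\<gamma>\<close>^2 v^2 visibly a
    square.\<close>
  define h2 where "h2 = \<one> \<oplus> \<one>"
  have h2: "h2 \<in> carrier R" "h2 \<otimes> h2 = F" unfolding h2_def F_def by (auto simp: l_distr r_distr)
  have sq4: "(h2 \<otimes> \<gamma> \<otimes> v) \<otimes> (h2 \<otimes> \<gamma> \<otimes> v) = \<gamma> \<otimes> (F \<otimes> \<gamma> \<otimes> (v \<otimes> v))"
    if "v \<in> carrier R" for v
    unfolding h2(2)[symmetric] using h2(1) cl(1) that by (simp add: m_ac)
  have T2: "cr4 \<otimes> (y \<otimes> y) \<noteq> \<ominus> e4" if y: "y \<in> carrier R" for y
  proof
    assume eq: "cr4 \<otimes> (y \<otimes> y) = \<ominus> e4"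
    define v where "v = y [^] p"
    have v: "v \<in> carrier R" unfolding v_def using y by simp
    have h: "F \<otimes> \<gamma> \<otimes> (v \<otimes> v) = \<ominus> (F \<otimes> (\<delta> \<otimes> u) \<oplus> \<one>)"
      using arg_cong[OF eq, of "\<lambda>x. x [^] p"] sq[OF _ y, of cr4] nat_pow_minus_odd[OF e4(1) odd_p] cr4 e4
      unfolding v_def by simp
    have "\<gamma> \<otimes> (F \<otimes> \<gamma> \<otimes> (v \<otimes> v)) = \<ominus> (\<gamma> \<otimes> (F \<otimes> \<delta> \<otimes> u \<oplus> \<one>))"
      unfolding h using cl by (simp add: r_minus m_assoc)
    then show False using nsq(2)[of "h2 \<otimes> \<gamma> \<otimes> v"] sq4[OF v] cl(1) v h2(1) by simp
  qed
  have T4: "cr4 \<otimes> (y \<otimes> y) \<noteq> cr4 \<otimes> (u \<otimes> u) \<oplus> e4" if y: "y \<in> carrier R" for y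
  proof
    assume eq: "cr4 \<otimes> (y \<otimes> y) = cr4 \<otimes> (u \<otimes> u) \<oplus> e4"
    define v w where "v = y [^] p" and "w = u [^] p"
    have v: "v \<in> carrier R" "w \<in> carrier R" unfolding v_def w_def using y cl by auto
    have h: "F \<otimes> \<gamma> \<otimes> (v \<otimes> v) =
        F \<otimes> \<gamma> \<otimes> (w \<otimes> w) \<oplus> (F \<otimes> (\<delta> \<otimes> u) \<oplus> \<one>)"
      using arg_cong[OF eq, of "\<lambda>x. x [^] p"] sq[OF _ y, of cr4] sq[OF _ cl(3), of cr4]
        frob[of "cr4 \<otimes> (u \<otimes> u)" e4] cr4 e4 cl(3) unfolding v_def w_def by simp
    have "\<gamma> \<otimes> (F \<otimes> \<gamma> \<otimes> (v \<otimes> v)) = F \<otimes> (\<gamma> \<otimes> \<gamma> \<otimes> u [^] (2 * p) \<oplus> \<gamma> \<otimes> \<delta> \<otimes> u) \<oplus> \<gamma>"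
      unfolding h pow2[OF cl(3)] w_def[symmetric] using cl v by (simp add: r_distr m_ac a_assoc)
    then show False using nsq(4)[of "h2 \<otimes> \<gamma> \<otimes> v"] sq4[OF v(1)] cl(1) v h2(1) by simp
  qed
  let ?S = "(X ^\<^sub>P 2 +\<^sub>P poly_of_const u) ^\<^sub>P 2"
  have Sc: "?S \<in> carrier PR" using X_closed cl by simp
  show "pirreducible (carrier R) f"
    unfolding f_def using cr cr0 by (intro quartic_irreducible(1) cl e T1 T3) auto
  have pc: "poly_of_const cr \<in> carrier PR" "poly_of_const e \<in> carrier PR" "poly_of_const F \<in> carrier PR"
    using cr e cl by auto
  have fc: "f \<in> carrier PR" unfolding f_def using pc Sc by simp
  have "[(4::nat)] \<cdot>\<^bsub>PR\<^esub> f = poly_of_const F *\<^sub>P f"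
    unfolding F_def using fc by (simp add: numeral_eq_Suc P.l_distr P.a_ac)
  then have "1\<^sub>P +\<^sub>P [(4::nat)] \<cdot>\<^bsub>PR\<^esub> f = poly_of_const F *\<^sub>P poly_of_const cr *\<^sub>P ?S +\<^sub>P
      (poly_of_const F *\<^sub>P poly_of_const e +\<^sub>P 1\<^sub>P)"
    unfolding f_def using pc Sc by (simp add: P.r_distr P.m_assoc P.a_ac)
  also have "\<dots> = poly_of_const cr4 *\<^sub>P ?S +\<^sub>P poly_of_const e4"
    unfolding cr4_def e4_def using cl(4) cr(1) e(1) by simp
  finally have pi2: "1\<^sub>P +\<^sub>P [(4::nat)] \<cdot>\<^bsub>PR\<^esub> f = poly_of_const cr4 *\<^sub>P ?S +\<^sub>P poly_of_const e4" .
  show "pirreducible (carrier R) (1\<^sub>P +\<^sub>P [(4::nat)] \<cdot>\<^bsub>PR\<^esub> f)"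
    unfolding pi2 by (intro quartic_irreducible(1) cl e4 cr4 T2 T4)
qed

end

section \<open>Nonresidue points and irreducibility at them\<close>

context curve_setup
begin

lemma infinitely_many_nonresidue_points:
  "infinite {P \<in> {P. closed_point R P}. \<forall>i\<in>Ix. J P (Dp i) = -1}"
proof -
  interpret A: arith_semigroup monic_monoid "\<lambda>f. degree f" "{P. closed_point R P}" "card (carrier R)"
    by (rule monic_arith_semigroup)
  have Deg: "A.Deg n = Mon n" for n
    unfolding A.Deg_def by (rule monic_degree_eq)
  have one: "1\<^sub>P \<in> Mon 0" using Mon_var_pow[of 0] by simp
  show ?thesis
  proof (rule A.infinitely_many_primes_prescribed[where \<chi> = "\<lambda>i f. J f (Dp i)"])
    show "finite Ix" by (simp add: Ix_def)
  next
    fix i assume i: "i \<in> Ix"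
    \<comment> \<open>As \<open>Dp i\<close> need not be monic, multiplicativity in the modulus goes
      through \<open>J_Dp\<close>, whose sign is a power with the degree as exponent and hence
      multiplicative too.\<close>
    have "J (x *\<^sub>P y) (Dp i) = J x (Dp i) * J y (Dp i)"
      if "x \<in> carrier monic_monoid" "y \<in> carrier monic_monoid" for x y
    proof -
      have xy: "x \<in> Mon (degree x)" "y \<in> Mon (degree y)" using that monic_iff by auto
      show ?thesis
        using J_mult[OF mDp(1)[OF i] MonD(1)[OF xy(1)] MonD(1)[OF xy(2)]]
        unfolding J_Dp[OF i xy(1)] J_Dp[OF i xy(2)] J_Dp[OF i Mon_mult[OF xy]]
        by (simp add: power_add)
    qed
    moreover have "J 1\<^sub>P (Dp i) = 1" unfolding J_def one_PR by (simp add: MonLt_def)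
    ultimately show "A.completely_mult (\<lambda>f. J f (Dp i))"
      unfolding A.completely_mult_def using J_values by (simp add: monic_monoid_def)
  next
    fix S assume "S \<subseteq> Ix" "S \<noteq> {}"
    then show "\<exists>N. \<forall>n\<ge>N. A.coeff_sum (\<lambda>f. \<Prod>i\<in>S. J f (Dp i)) n = 0"
      unfolding A.coeff_sum_def Deg by (rule sum_J_Dp_vanishes)
  next
    fix i assume i: "i \<in> Ix"
    \<comment> \<open>A point with symbol 0 divides the nonzero polynomial \<open>Dp i\<close>,
      which bounds its degree.\<close>
    have "{P \<in> {P. closed_point R P}. J P (Dp i) = 0} \<subseteq> (\<Union>k\<le>degree (Dp i). Mon k)"
    proof
      fix P assume "P \<in> {P \<in> {P. closed_point R P}. J P (Dp i) = 0}"
      then have P: "P \<in> Mon (degree P)" "pirreducible (carrier R) P" "J P (Dp i) = 0"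
        using closed_point_iff by auto
      then have "P pdivides (Dp i)" using J_irreducible_eq_0_iff Dp_props(1)[OF i] by blast
      then have "degree P \<le> degree (Dp i)"
        using pdivides_imp_degree_le[OF carrier_is_subring MonD(1)[OF P(1)] Dp_props(1)[OF i] Dp_nonzero[OF i]] by simp
      then show "P \<in> (\<Union>k\<le>degree (Dp i). Mon k)" using P(1) by blast
    qed
    then show "finite {P \<in> {P. closed_point R P}. J P (Dp i) = 0}"
      using finite_Mon by (meson finite_UN finite_atMost finite_subset)
  qed
qed

text \<open>The symbol depends only on the residue class and is multiplicative, so on a square it is
  the square of a real number, never -1.\<close>

lemma nonresidue_not_square:
  assumes P: "closed_point R P" and f: "f \<in> carrier PR" "J P f = -1" and z: "z \<in> carrier (res_field R P)"
  shows "z \<otimes>\<^bsub>res_field R P\<^esub> z \<noteq> res_map R P f"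
proof
  have PM: "P \<in> Mon (degree P)" using P closed_point_iff by simp
  note PD = MonD[OF PM]
  interpret \<rho>: ring_hom_ring PR "res_field R P" "res_map R P" using res_hom PD by simp
  obtain s where s: "s \<in> carrier PR" "z = res_map R P s" using res_surj[OF PD(1) z] .
  assume "z \<otimes>\<^bsub>res_field R P\<^esub> z = res_map R P f"
  then have eq: "res_map R P (s *\<^sub>P s) = res_map R P f" using s by simp
  have ss: "s *\<^sub>P s \<in> carrier PR" using s(1) by simp
  have "(s *\<^sub>P s) pmod P = f pmod P"
    using eq res_eq_iff[OF PD(1) ss f(1)] pmod_eq_iff[OF ss f(1) PD(1)] by blast
  then have "J P (s *\<^sub>P s) = J P f" by (rule J_cong[OF PM ss f(1)])
  then have "J P s * J P s = -1" using J_mult[OF PM s(1) s(1)] f(2) by simp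
  then show False by (metis not_square_less_zero neg_less_0_iff_less zero_less_one)
qed

text \<open>Reduction modulo \<open>P\<close> sends the four \<open>Dp i\<close> to the four
  elements that \<open>quartic_pair_irreducible\<close> wants nonsquare, with
  \<open>\<gamma>\<close>, \<open>\<delta>\<close> and u the images of c, d and X.\<close>

lemma nonresidue_point_irreducible:
  assumes P: "closed_point R P" and J: "\<forall>i\<in>Ix. J P (Dp i) = -1"
  shows "pirreducible\<^bsub>res_field R P\<^esub> (carrier (res_field R P)) (pi1 R p c d P)"
    "pirreducible\<^bsub>res_field R P\<^esub> (carrier (res_field R P)) (pi2 R p c d P)"
proof -
  have PM: "P \<in> Mon (degree P)" and irr: "pirreducible (carrier R) P" using P closed_point_iff by auto
  note PD = MonD[OF PM]
  let ?K = "res_field R P"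
  interpret K: finite_field_char ?K p using res_field_char[OF PM irr] .
  interpret \<rho>: ring_hom_ring PR ?K "res_map R P" using res_hom PD by simp
  interpret \<iota>: ring_hom_ring R ?K "res_const R P" using res_const_hom PD by simp
  define \<gamma> where "\<gamma> = res_const R P c"
  define \<delta> where "\<delta> = res_const R P d"
  define u where "u = res_u R P"
  define cr where "cr = pth_root ?K p \<gamma>"
  define e where "e = pth_root ?K p \<delta> \<otimes>\<^bsub>?K\<^esub> pth_root ?K p u"
  have cl: "\<gamma> \<in> carrier ?K" "\<delta> \<in> carrier ?K" "u \<in> carrier ?K"
    unfolding \<gamma>_def \<delta>_def u_def res_u_def using c d X_closed by auto
  note root = K.pth_root_works[OF prime_p odd_p K.char_p K.finite_carrier]
  have cr: "cr \<in> carrier ?K" "cr [^]\<^bsub>?K\<^esub> p = \<gamma>" unfolding cr_def using root cl by auto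
  have e: "e \<in> carrier ?K" "e [^]\<^bsub>?K\<^esub> p = \<delta> \<otimes>\<^bsub>?K\<^esub> u"
    unfolding e_def using root cl K.nat_pow_distrib by auto
  have "\<gamma> \<noteq> \<zero>\<^bsub>?K\<^esub>" unfolding \<gamma>_def using res_const_nonzero[OF PM irr c] .
  have nsq: "z \<otimes>\<^bsub>?K\<^esub> z \<noteq> res_map R P (Dp i)" if "i \<in> Ix" "z \<in> carrier ?K" for i z
    using nonresidue_not_square[OF P Dp_props(1)[OF that(1)] _ that(2)] J that(1) by simp
  have Ix: "1 \<in> Ix" "2 \<in> Ix" "3 \<in> Ix" "4 \<in> Ix" unfolding Ix_def by auto
  have Dp_images: "res_map R P (Dp 1) = \<ominus>\<^bsub>?K\<^esub> (\<gamma> \<otimes>\<^bsub>?K\<^esub> \<delta> \<otimes>\<^bsub>?K\<^esub> u)"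
    "res_map R P (Dp 2) = \<ominus>\<^bsub>?K\<^esub> (\<gamma> \<otimes>\<^bsub>?K\<^esub> (F \<otimes>\<^bsub>?K\<^esub> \<delta> \<otimes>\<^bsub>?K\<^esub> u \<oplus>\<^bsub>?K\<^esub> \<one>\<^bsub>?K\<^esub>))"
    "res_map R P (Dp 3) = \<gamma> \<otimes>\<^bsub>?K\<^esub> \<gamma> \<otimes>\<^bsub>?K\<^esub> u [^]\<^bsub>?K\<^esub> (2 * p) \<oplus>\<^bsub>?K\<^esub> \<gamma> \<otimes>\<^bsub>?K\<^esub> \<delta> \<otimes>\<^bsub>?K\<^esub> u"
    "res_map R P (Dp 4) = F \<otimes>\<^bsub>?K\<^esub> (\<gamma> \<otimes>\<^bsub>?K\<^esub> \<gamma> \<otimes>\<^bsub>?K\<^esub> u [^]\<^bsub>?K\<^esub> (2 * p) \<oplus>\<^bsub>?K\<^esub> \<gamma> \<otimes>\<^bsub>?K\<^esub> \<delta> \<otimes>\<^bsub>?K\<^esub> u) \<oplus>\<^bsub>?K\<^esub> \<gamma>"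
    if "F = (\<one>\<^bsub>?K\<^esub> \<oplus>\<^bsub>?K\<^esub> \<one>\<^bsub>?K\<^esub>) \<oplus>\<^bsub>?K\<^esub> (\<one>\<^bsub>?K\<^esub> \<oplus>\<^bsub>?K\<^esub> \<one>\<^bsub>?K\<^esub>)" for F
    unfolding that Dp_def \<gamma>_def \<delta>_def u_def res_u_def res_const_def
    using PcPd(1-3) X_closed \<rho>.hom_nat_pow[OF X_closed, of "2 * p"]
    by (simp_all del: C.hom_closed)
  note irreducible = K.quartic_pair_irreducible[OF cl \<open>\<gamma> \<noteq> \<zero>\<^bsub>?K\<^esub>\<close> cr e
      nsq[OF Ix(1), unfolded Dp_images[OF refl]] nsq[OF Ix(2), unfolded Dp_images[OF refl]]
      nsq[OF Ix(3), unfolded Dp_images[OF refl]] nsq[OF Ix(4), unfolded Dp_images[OF refl]]]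
  have pi1: "pi1 R p c d P = K.poly_of_const cr \<otimes>\<^bsub>poly_ring ?K\<^esub>
      (X\<^bsub>?K\<^esub> [^]\<^bsub>poly_ring ?K\<^esub> (2::nat) \<oplus>\<^bsub>poly_ring ?K\<^esub> K.poly_of_const u) [^]\<^bsub>poly_ring ?K\<^esub> (2::nat)
      \<oplus>\<^bsub>poly_ring ?K\<^esub> K.poly_of_const e"
    unfolding pi1_def Let_def cr_def e_def \<gamma>_def \<delta>_def u_def ..
  show "pirreducible\<^bsub>?K\<^esub> (carrier ?K) (pi1 R p c d P)"
    unfolding pi1 by (rule irreducible(1))
  show "pirreducible\<^bsub>?K\<^esub> (carrier ?K) (pi2 R p c d P)"
    unfolding pi2_def Let_def pi1 by (rule irreducible(2))
qed

end

theorem theorem5p1: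
  fixes R :: "('a, 'b) ring_scheme" and p :: nat and c d :: 'a
  assumes "field R" and "finite (carrier R)"
    and "Factorial_Ring.prime p" and "[p] \<cdot>\<^bsub>R\<^esub> \<one>\<^bsub>R\<^esub> = \<zero>\<^bsub>R\<^esub>" and "p \<noteq> 2"
    and "c \<in> carrier R - {\<zero>\<^bsub>R\<^esub>}" and "d \<in> carrier R - {\<zero>\<^bsub>R\<^esub>}"
  shows "infinite {f. closed_point R f
            \<and> pirreducible\<^bsub>res_field R f\<^esub> (carrier (res_field R f)) (pi1 R p c d f)
            \<and> pirreducible\<^bsub>res_field R f\<^esub> (carrier (res_field R f)) (pi2 R p c d f)}"
proof -
  interpret field R by fact
  have odd: "odd p" using assms(3,5) prime_odd_nat[of p] prime_ge_2_nat[of p] by fastforce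
  have two: "\<one>\<^bsub>R\<^esub> \<oplus>\<^bsub>R\<^esub> \<one>\<^bsub>R\<^esub> \<noteq> \<zero>\<^bsub>R\<^esub>"
  proof
    assume "\<one>\<^bsub>R\<^esub> \<oplus>\<^bsub>R\<^esub> \<one>\<^bsub>R\<^esub> = \<zero>\<^bsub>R\<^esub>"
    then have 2: "[(2::nat)] \<cdot>\<^bsub>R\<^esub> \<one>\<^bsub>R\<^esub> = \<zero>\<^bsub>R\<^esub>" by (simp add: numeral_2_eq_2)
    \<comment> \<open>With p = 2 k + 1, the relation 2 = 0 would turn p = 0 into 1 = 0.\<close>
    obtain k where k: "p = Suc (2 * k)" using odd by (auto elim: oddE)
    have "[(2 * k)] \<cdot>\<^bsub>R\<^esub> \<one>\<^bsub>R\<^esub> = \<zero>\<^bsub>R\<^esub>" using 2 add.nat_pow_pow[of "\<one>\<^bsub>R\<^esub>" k 2] by simp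
    then have "[p] \<cdot>\<^bsub>R\<^esub> \<one>\<^bsub>R\<^esub> = \<one>\<^bsub>R\<^esub>" unfolding k by simp
    then show False using assms(4) one_not_zero by simp
  qed
  interpret curve_setup R p c d
    by unfold_locales (use assms two odd in auto)
  have "{P \<in> {P. closed_point R P}. \<forall>i\<in>Ix. J P (Dp i) = -1} \<subseteq> {f. closed_point R f
            \<and> pirreducible\<^bsub>res_field R f\<^esub> (carrier (res_field R f)) (pi1 R p c d f)
            \<and> pirreducible\<^bsub>res_field R f\<^esub> (carrier (res_field R f)) (pi2 R p c d f)}"
    using nonresidue_point_irreducible by blast
  then show ?thesis using infinitely_many_nonresidue_points infinite_super by blast
qed

end
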